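(* Let $K$ be a convex body in $\mathbb{R}^d$ and let $F$ be a linear subspace of dimension $s\in\{0,1,\dots,d\}$. Assume $K$ is in Löwner position with fixed axis $F$, i.e. $K\subseteq B^d$ and $K$ has maximal volume among all members of $\mathcal{A}_F(K)$ contained in $B^d$. Then (1) $\Big(\frac{\mathrm{vol}_s(P_FK)}{\mathrm{vol}_s(\Delta_L^s)}\Big)^{1/s}\ge\sqrt{\frac{s}{d}}$; (2) $P_FK\subset P_FB^d\subset d\cdot P_FK$; (3) the circumradius of $P_{F^\perp}K$ is at least $\sqrt{\frac{d-s}{d}}$. If, additionally, $K$ is centrally symmetric, then (S1) $\Big(\frac{\mathrm{vol}_s(P_FK)}{\mathrm{vol}_s(\lozenge^s)}\Big)^{1/s}\ge\sqrt{\frac{s}{d}}$; (S2) $P_FK\subset P_FB^d\subset \sqrt{d}\cdot P_FK$.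
   Context: A convex body is a compact convex set with nonempty interior; $B^d$ is the closed Euclidean unit ball centered at the origin. For a linear subspace $F$, an $F$-operator is an invertible linear operator $A$ on $\mathbb{R}^d$ such that $F$ and $F^\perp$ are invariant under $A$ and $A|_{F^\perp}$ is a nonzero multiple of the identity on $F^\perp$; $\mathcal{A}_F(S)=\{AS+z:\ A\text{ an }F\text{-operator},\ z\in\mathbb{R}^d\}$. $P_F$ is orthogonal projection onto $F$. $\Delta_L^s$ is the regular $s$-dimensional simplex inscribed in $B^s$, $\lozenge^s$ is the standard $s$-dimensional cross-polytope $\operatorname{conv}\{\pm e_1,\dots,\pm e_s\}$, and the circumradius of a set is the smallest radius of a ball containing it. *)

theory Defs
  imports "HOL-Analysis.Analysis"
begin

definition convex_body :: "'a::euclidean_space set \<Rightarrow> bool" where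
  "convex_body K \<longleftrightarrow> compact K \<and> convex K \<and> interior K \<noteq> {}"

definition orth_proj :: "'a::euclidean_space set \<Rightarrow> 'a \<Rightarrow> 'a" where
  "orth_proj F x = (THE y. y \<in> F \<and> (\<forall>z\<in>F. inner (x - y) z = 0))"

definition F_operator :: "'a::euclidean_space set \<Rightarrow> ('a \<Rightarrow> 'a) \<Rightarrow> bool" where
  "F_operator F A \<longleftrightarrow> linear A \<and> bij A \<and> A ` F \<subseteq> F \<and> A ` (orthogonal_comp F) \<subseteq> orthogonal_comp F
     \<and> (\<exists>c::real. c \<noteq> 0 \<and> (\<forall>x\<in>orthogonal_comp F. A x = c *\<^sub>R x))"

definition A_family :: "'a::euclidean_space set \<Rightarrow> 'a set \<Rightarrow> 'a set set" where
  "A_family F S = {(\<lambda>x. A x + z) ` S | A z. F_operator F A}"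

definition loewner_position_axis :: "'a::euclidean_space set \<Rightarrow> 'a set \<Rightarrow> bool" where
  "loewner_position_axis F K \<longleftrightarrow> K \<subseteq> cball 0 1 \<and>
     (\<forall>L\<in>A_family F K. L \<subseteq> cball 0 1 \<longrightarrow> measure lebesgue L \<le> measure lebesgue K)"

definition circumradius :: "'a::euclidean_space set \<Rightarrow> real" where
  "circumradius S = Inf {r. \<exists>c. S \<subseteq> cball c r}"

definition orthonormal_basis_of :: "'a::euclidean_space set \<Rightarrow> (nat \<Rightarrow> 'a) \<Rightarrow> bool" where
  "orthonormal_basis_of F b \<longleftrightarrow> (\<forall>i<dim F. b i \<in> F) \<and>
     (\<forall>i<dim F. \<forall>j<dim F. inner (b i) (b j) = (if i = j then 1 else 0)) \<and>
     span (b ` {..<dim F}) = F"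

definition onb :: "'a::euclidean_space set \<Rightarrow> nat \<Rightarrow> 'a" where
  "onb F = (SOME b. orthonormal_basis_of F b)"

text \<open>Coordinates of x with respect to the chosen orthonormal basis of F, as a point of
  R^s = extensional functions on {..<s}; s-dimensional Lebesgue measure is the
  product of s copies of lborel.\<close>
definition coords :: "'a::euclidean_space set \<Rightarrow> 'a \<Rightarrow> (nat \<Rightarrow> real)" where
  "coords F x = (\<lambda>i\<in>{..<dim F}. inner x (onb F i))"

definition vol_sub :: "'a::euclidean_space set \<Rightarrow> 'a set \<Rightarrow> real" where
  "vol_sub F X = measure (Pi\<^sub>M {..<dim F} (\<lambda>_. lborel)) (coords F ` X)"

text \<open>Regular s-simplex inscribed in the unit ball of F (an isometric copy of Delta_L^s).\<close>
definition reg_simplex_vertices :: "'a::euclidean_space set \<Rightarrow> (nat \<Rightarrow> 'a) \<Rightarrow> bool" where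
  "reg_simplex_vertices F v \<longleftrightarrow>
     (dim F = 0 \<longrightarrow> v 0 = 0) \<and>
     (dim F > 0 \<longrightarrow> (\<forall>i\<le>dim F. v i \<in> F \<and> norm (v i) = 1) \<and> inj_on v {..dim F} \<and>
        (\<exists>a. \<forall>i\<le>dim F. \<forall>j\<le>dim F. i \<noteq> j \<longrightarrow> dist (v i) (v j) = a))"

definition reg_simplex_in :: "'a::euclidean_space set \<Rightarrow> 'a set" where
  "reg_simplex_in F = convex hull ((SOME v. reg_simplex_vertices F v) ` {..dim F})"

definition cross_polytope_in :: "'a::euclidean_space set \<Rightarrow> 'a set" where
  "cross_polytope_in F = convex hull (onb F ` {..<dim F} \<union> (\<lambda>i. - onb F i) ` {..<dim F})"

definition centrally_symmetric :: "'a::real_vector set \<Rightarrow> bool" where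
  "centrally_symmetric K \<longleftrightarrow> (\<exists>c. \<forall>x. x \<in> K \<longleftrightarrow> 2 *\<^sub>R c - x \<in> K)"

end

(* Maximality gives, by first-order perturbation of K within F-operators and separation of convex
   sets, contact points u of K with the sphere and weights lam(u) > 0 such that sum lam(u) = d,
   sum lam(u) u = 0 and sum lam(u) (Pu)(Pu)^T = P, where P is the projection onto F. The inclusions and
   the circumradius bound follow by testing these identities.

   For the volume bounds, lift Pu to w = (Pu, 1/sqrt d): the frame identity becomes one in F x R
   (in the symmetric case no lift is needed). Barthe's transport of a Gaussian to one-sided
   (resp. two-sided) exponential densities along the frame bounds the exponential integral over the
   cone spanned by w, i.e. the volume of the hull of the Pu, from below by
   prod |w|^(lam |w|^2); since the w need not be unit vectors, convexity of x ln x is used to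
   minimise this product. For the regular simplex the lifted frame is orthonormal, so the same
   integral is computed exactly. *)
theory Submission
  imports Defs "HOL-Probability.Probability"
begin

text \<open>The normalisation sum lam(u) = d comes from the scalar part of the admissible
  perturbations: \<open>x \<mapsto> c x - G x\<close> with \<open>G\<close> living on F preserves
  volume to first order exactly when c is the mean eigenvalue tr(G)/d, so contact points are
  compared with P/d.

  The ball controls |u| but not |Pu|, so the projected frame is not normalised. The transport is
  rescaled by |w| for each vector, which costs the product of the |w|^(lam |w|^2). With sum lam
  |w|^2 = n and sum lam <= d it is at least (n/d)^(n/2); here n = s + 1 after lifting and n = s in
  the symmetric case. The regular simplex attains the lifted bound with d replaced by s, and the
  quotient of the two bounds is (s/d)^(s/2). The height 1/sqrt d is forced: sum lam(u)/d = 1 is the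
  new diagonal entry, and sum lam(u) u = 0 removes the mixed terms.

  A subspace is not a type. Volumes in F are therefore integrals over the whole space (or its
  product with the line) carrying a Gaussian factor across F, where the transport is the identity.
  The weight exp(-t) over dilates tX turns such a volume, times s!, into an integral that the
  transport can bound.\<close>

subsection \<open>Orthonormal bases\<close>

definition orthonormal :: "'a::euclidean_space set \<Rightarrow> bool" where
  "orthonormal S \<longleftrightarrow> pairwise orthogonal S \<and> (\<forall>c\<in>S. norm c = 1)"

definition onbasis :: "'a::euclidean_space set \<Rightarrow> bool" where
  "onbasis S \<longleftrightarrow> orthonormal S \<and> span S = UNIV"

lemma orthonormal_inner:
  "orthonormal S \<Longrightarrow> c \<in> S \<Longrightarrow> c' \<in> S \<Longrightarrow> c \<bullet> c' = (if c = c' then 1 else 0)"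
  by (auto simp: orthonormal_def pairwise_def orthogonal_def norm_eq_1)

lemma orthonormal_nonzero: "orthonormal S \<Longrightarrow> 0 \<notin> S"
  by (auto simp: orthonormal_def)

lemma orthonormal_independent: "orthonormal S \<Longrightarrow> independent S"
  using orthonormal_nonzero pairwise_orthogonal_independent orthonormal_def by blast

lemma orthonormal_finite: "orthonormal S \<Longrightarrow> finite S"
  using orthonormal_independent independent_imp_finite by blast

lemma onbasis_card: "onbasis S \<Longrightarrow> card (S::'a::euclidean_space set) = DIM('a)"
  using dim_eq_card_independent[of S] dim_span[of S] orthonormal_independent[of S]
  by (simp add: onbasis_def)

lemma orthonormal_span_expand:
  assumes "orthonormal S" "x \<in> span S"
  shows "(\<Sum>c\<in>S. (x \<bullet> c) *\<^sub>R c) = x"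
proof -
  have fin: "finite S" using assms orthonormal_finite by blast
  obtain u where u: "x = (\<Sum>c\<in>S. u c *\<^sub>R c)"
    using assms(2) span_finite[OF fin] by auto
  have "x \<bullet> c = u c" if "c \<in> S" for c
  proof -
    have "x \<bullet> c = (\<Sum>c'\<in>S. u c' * (c' \<bullet> c))" by (simp add: u inner_sum_left)
    also have "\<dots> = (\<Sum>c'\<in>S. if c' = c then u c' else 0)"
      using assms(1) that by (intro sum.cong) (auto simp: orthonormal_inner)
    also have "\<dots> = u c" using fin that by simp
    finally show ?thesis .
  qed
  then show ?thesis unfolding u by (intro sum.cong) auto
qed

lemma onbasis_expand: "onbasis S \<Longrightarrow> (\<Sum>c\<in>S. (x \<bullet> c) *\<^sub>R c) = x"
  using orthonormal_span_expand by (auto simp: onbasis_def)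

lemma onbasis_parseval: "onbasis S \<Longrightarrow> (\<Sum>c\<in>S. (x \<bullet> c) * (y \<bullet> c)) = x \<bullet> y"
proof -
  assume S: "onbasis S"
  have "x \<bullet> y = (\<Sum>c\<in>S. (x \<bullet> c) *\<^sub>R c) \<bullet> y" by (simp add: onbasis_expand[OF S])
  also have "\<dots> = (\<Sum>c\<in>S. (x \<bullet> c) * (y \<bullet> c))" by (simp add: inner_sum_left inner_commute[of y])
  finally show ?thesis ..
qed

lemma onbasis_Basis: "onbasis (Basis :: 'a::euclidean_space set)"
  by (auto simp: onbasis_def orthonormal_def pairwise_def orthogonal_def inner_Basis)

lemma onbasis_Un:
  assumes B: "orthonormal B" "span B = F" and C: "orthonormal C" "span C = orthogonal_comp F"
  shows "onbasis (B \<union> C)" "B \<inter> C = {}"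
proof -
  have perp: "orthogonal b c" if "b \<in> B" "c \<in> C" for b c
    using that assms span_superset[of B] span_superset[of C]
    by (auto simp: orthogonal_comp_def)
  have on: "orthonormal (B \<union> C)"
    using B(1) C(1) perp unfolding orthonormal_def pairwise_def by (metis Un_iff orthogonal_commute)
  show "B \<inter> C = {}"
  proof (rule ccontr)
    assume "B \<inter> C \<noteq> {}"
    then obtain b where "b \<in> B" "b \<in> C" by auto
    then show False using perp[of b b] orthonormal_nonzero[OF B(1)] by (auto simp: orthogonal_def)
  qed
  have "x \<in> span (B \<union> C)" for x
  proof -
    have "subspace F" using B by (metis subspace_span)
    then obtain y z where "y \<in> F" "\<And>w. w \<in> F \<Longrightarrow> orthogonal z w" "x = y + z"
      using orthogonal_subspace_decomp_exists[of F x] \<open>subspace F\<close> by (metis span_eq_iff)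
    moreover have "z \<in> orthogonal_comp F"
      using calculation by (auto simp: orthogonal_comp_def orthogonal_commute)
    ultimately show ?thesis
      using B(2) C(2) span_mono[of B "B \<union> C"] span_mono[of C "B \<union> C"] by (auto intro!: span_add)
  qed
  then show "onbasis (B \<union> C)" using on by (auto simp: onbasis_def)
qed

subsection \<open>Spectral theorem\<close>

text \<open>A maximiser \<open>e\<close> of \<open>x \<bullet> A x\<close> on the unit sphere of
  \<open>V\<close> works. Vanishing of the first variation makes \<open>A e\<close> orthogonal to
  every \<open>h\<close> in \<open>V\<close> with \<open>e \<bullet> h = 0\<close>; invariance of
  \<open>V\<close> allows the choice \<open>h = A e - m *\<^sub>R e\<close>, which is then
  orthogonal to itself.\<close>

lemma self_adjoint_eigenvector:
  fixes A :: "'a::euclidean_space \<Rightarrow> 'a"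
  assumes lin: "linear A" and sa: "\<And>x y. A x \<bullet> y = x \<bullet> A y"
    and V: "subspace V" "V \<noteq> {0}" "A ` V \<subseteq> V"
  shows "\<exists>e\<in>V. norm e = 1 \<and> (\<exists>m. A e = m *\<^sub>R e)"
proof -
  let ?K = "V \<inter> sphere 0 1"
  have "compact ?K" by (rule closed_Int_compact[OF closed_subspace[OF V(1)] compact_sphere])
  moreover have "?K \<noteq> {}"
  proof -
    obtain x where "x \<in> V" "x \<noteq> 0" using V subspace_0 by blast
    then have "x /\<^sub>R norm x \<in> ?K" using V(1) by (simp add: subspace_scale)
    then show ?thesis by blast
  qed
  moreover have "continuous_on ?K (\<lambda>x. x \<bullet> A x)"
    using lin by (intro continuous_intros linear_continuous_on) (simp add: linear_linear)
  ultimately obtain e where e: "e \<in> V" "norm e = 1" and max0: "\<forall>x\<in>?K. x \<bullet> A x \<le> e \<bullet> A e"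
    using continuous_attains_sup[of ?K "\<lambda>x. x \<bullet> A x"] by auto
  have max: "x \<bullet> A x \<le> e \<bullet> A e" if "x \<in> V" "norm x = 1" for x
    using max0 that by simp
  define m where "m = e \<bullet> A e"
  interpret A: linear A by fact
  have ray: "x \<bullet> A x \<le> m * (norm x)\<^sup>2" if "x \<in> V" for x
  proof (cases "x = 0")
    case False
    have "(x /\<^sub>R norm x) \<bullet> A (x /\<^sub>R norm x) \<le> m"
      unfolding m_def using that False V(1) by (intro max) (auto simp: subspace_scale)
    then have "(x \<bullet> A x) / (norm x)\<^sup>2 \<le> m"
      by (simp add: A.scale power2_eq_square divide_inverse ac_simps)
    then show ?thesis using False by (simp add: divide_simps)
  qed (simp add: A.zero)
  have orth: "A e \<bullet> h = 0" if h: "h \<in> V" "e \<bullet> h = 0" for h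
  proof -
    define q where "q = m * (norm h)\<^sup>2 - h \<bullet> A h"
    \<comment> \<open>Expanding the Rayleigh bound at \<open>e + t *\<^sub>R h\<close> leaves a
      linear term in \<open>t\<close>, of either sign, dominated by a quadratic one.\<close>
    have ineq: "2 * t * (A e \<bullet> h) \<le> t\<^sup>2 * q" for t
    proof -
      have "(e + t *\<^sub>R h) \<bullet> A (e + t *\<^sub>R h) \<le> m * (norm (e + t *\<^sub>R h))\<^sup>2"
        using e h V(1) by (intro ray) (auto simp: subspace_add subspace_scale)
      moreover have "(norm (e + t *\<^sub>R h))\<^sup>2 = 1 + t\<^sup>2 * (norm h)\<^sup>2"
        using e h unfolding power2_norm_eq_inner
        by (simp add: inner_add inner_commute norm_eq_1 power2_eq_square)
      moreover have "(e + t *\<^sub>R h) \<bullet> A (e + t *\<^sub>R h) = m + 2 * t * (A e \<bullet> h) + t\<^sup>2 * (h \<bullet> A h)"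
        using sa[of e h] by (simp add: A.add A.scale inner_add m_def power2_eq_square algebra_simps inner_commute)
      ultimately show ?thesis by (simp add: q_def algebra_simps)
    qed
    show ?thesis
    proof (rule ccontr)
      assume nz: "A e \<bullet> h \<noteq> 0"
      \<comment> \<open>With this \<open>t\<close> the linear term is twice the upper bound for the
        quadratic one; the summand 1 keeps the denominator positive.\<close>
      define t where "t = (A e \<bullet> h) / (\<bar>q\<bar> + 1)"
      have "2 * t * (A e \<bullet> h) = 2 * (A e \<bullet> h)\<^sup>2 / (\<bar>q\<bar> + 1)" by (simp add: t_def power2_eq_square)
      moreover have "t\<^sup>2 * q \<le> (A e \<bullet> h)\<^sup>2 / (\<bar>q\<bar> + 1)"
      proof -
        have "t\<^sup>2 * q \<le> t\<^sup>2 * (\<bar>q\<bar> + 1)" by (intro mult_left_mono) auto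
        also have "\<dots> = (A e \<bullet> h)\<^sup>2 / (\<bar>q\<bar> + 1)" by (simp add: t_def power2_eq_square divide_simps)
        finally show ?thesis .
      qed
      ultimately have "2 * (A e \<bullet> h)\<^sup>2 / (\<bar>q\<bar> + 1) \<le> (A e \<bullet> h)\<^sup>2 / (\<bar>q\<bar> + 1)"
        using ineq[of t] by linarith
      moreover have "(A e \<bullet> h)\<^sup>2 / (\<bar>q\<bar> + 1) > 0" using nz by (intro divide_pos_pos) auto
      ultimately show False by linarith
    qed
  qed
  have "A e - m *\<^sub>R e \<in> V" using e V by (auto simp: subspace_diff subspace_scale)
  moreover have 0: "e \<bullet> (A e - m *\<^sub>R e) = 0" using e by (simp add: inner_diff m_def norm_eq_1)
  ultimately have "A e \<bullet> (A e - m *\<^sub>R e) = 0" using orth by blast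
  then have "(A e - m *\<^sub>R e) \<bullet> (A e - m *\<^sub>R e) = 0" using 0 by (simp add: inner_diff algebra_simps)
  then have "A e = m *\<^sub>R e" by simp
  then show ?thesis using e by blast
qed

text \<open>An orthonormal set of eigenvectors of largest cardinality must span: self-adjointness
  makes the orthogonal complement of its span invariant, so a nonzero complement would supply one
  more eigenvector.\<close>

lemma self_adjoint_eigenbasis:
  fixes A :: "'a::euclidean_space \<Rightarrow> 'a"
  assumes lin: "linear A" and sa: "\<And>x y. A x \<bullet> y = x \<bullet> A y"
  shows "\<exists>S m. onbasis S \<and> (\<forall>c\<in>S. A c = m c *\<^sub>R c)"
proof -
  let ?E = "\<lambda>S. orthonormal S \<and> (\<forall>c\<in>S. \<exists>m. A c = m *\<^sub>R c)"
  have "?E {}" by (simp add: orthonormal_def pairwise_def)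
  moreover have "\<forall>S. ?E S \<longrightarrow> card S < Suc DIM('a)"
    by (auto simp: less_Suc_eq_le intro!: independent_card_le[OF orthonormal_independent])
  ultimately have "\<exists>S. ?E S \<and> (\<forall>S'. ?E S' \<longrightarrow> card S' \<le> card S)"
    by (rule ex_has_greatest_nat)
  then obtain S where S: "?E S" and max: "\<And>S'. ?E S' \<Longrightarrow> card S' \<le> card S"
    by blast
  have "span S = UNIV"
  proof (rule ccontr)
    assume ns: "span S \<noteq> UNIV"
    let ?V = "orthogonal_comp (span S)"
    have "?V \<noteq> {0}"
    proof
      assume "?V = {0}"
      then have "orthogonal_comp ?V = UNIV" using orthogonal_comp_null by simp
      then show False using ns orthogonal_comp_self[OF subspace_span] by blast
    qed
    moreover have "A ` ?V \<subseteq> ?V"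
    proof (clarsimp simp: orthogonal_comp_def)
      fix x y assume x: "\<forall>y\<in>span S. orthogonal y x" and y: "y \<in> span S"
      have "A y \<in> span S"
        using y
      proof (induction rule: span_induct_alt)
        case base
        then show ?case using lin by (simp add: linear_0 span_zero)
      next
        case (step c x y)
        then obtain m where "A x = m *\<^sub>R x" using S by blast
        then show ?case using lin step
          by (simp add: linear_add linear_scale span_add span_mul span_base)
      qed
      then show "orthogonal y (A x)" using x sa by (auto simp: orthogonal_def)
    qed
    ultimately obtain e m where e: "e \<in> ?V" "norm e = 1" "A e = m *\<^sub>R e"
      using self_adjoint_eigenvector[OF lin sa subspace_orthogonal_comp] by blast
    have orth: "orthogonal c e" if "c \<in> S" for c
      using e(1) that by (auto simp: orthogonal_comp_def span_base)
    have "e \<notin> S"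
      using orth[of e] e(2) by (auto simp: orthogonal_def)
    moreover have "?E (insert e S)"
      using S e orth by (auto simp: orthonormal_def pairwise_def orthogonal_commute)
    ultimately show False
      using max[of "insert e S"] S orthonormal_finite by fastforce
  qed
  then have "onbasis S" using S by (simp add: onbasis_def)
  moreover have "\<exists>m. \<forall>c\<in>S. A c = m c *\<^sub>R c" using S by metis
  ultimately show ?thesis by blast
qed

subsection \<open>Determinants and change of variables on Euclidean spaces\<close>

text \<open>The library states the change of variables formula for \<open>real ^ 'n\<close> only; the basis vectors serve as index type.\<close>

typedef (overloaded) ('a::euclidean_space) bidx = "Basis :: 'a set"
  by (rule exI[of _ "SOME i. i \<in> Basis"]) (rule SOME_Basis)

lemma bij_betw_Rep_bidx: "bij_betw Rep_bidx UNIV (Basis :: 'a::euclidean_space set)"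
  by (simp add: bij_betw_def inj_on_def Rep_bidx_inject type_definition.Rep_range[OF type_definition_bidx])

instance bidx :: (euclidean_space) finite
proof
  show "finite (UNIV :: 'a bidx set)"
    using bij_betw_finite[OF bij_betw_Rep_bidx] by simp
qed

text \<open>The change of variables theorem asks for a well-ordered index type. Any injection into
  the naturals induces such an order, so an arbitrary one is chosen.\<close>

definition bidx_nat :: "'a::euclidean_space bidx \<Rightarrow> nat" where
  "bidx_nat = (SOME f. inj f)"

lemma inj_bidx_nat: "inj (bidx_nat :: 'a::euclidean_space bidx \<Rightarrow> nat)"
proof -
  have "\<exists>f :: 'a bidx \<Rightarrow> nat. inj f"
    using finite_imp_inj_to_nat_seg[of "UNIV :: 'a bidx set"] by auto
  then show ?thesis unfolding bidx_nat_def by (rule someI_ex)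
qed

instantiation bidx :: (euclidean_space) wellorder
begin

definition "x \<le> y \<longleftrightarrow> bidx_nat x \<le> bidx_nat y"
definition "x < y \<longleftrightarrow> bidx_nat x < bidx_nat y"

instance
proof
  fix P :: "'a bidx \<Rightarrow> bool" and a
  assume step: "\<And>x. (\<And>y. y < x \<Longrightarrow> P y) \<Longrightarrow> P x"
  show "P a"
  proof (induction a rule: measure_induct_rule[of bidx_nat])
    case (less x)
    show ?case by (rule step, rule less) (simp add: less_bidx_def)
  qed
qed (auto simp: less_eq_bidx_def less_bidx_def inj_eq[OF inj_bidx_nat] dest: antisym)

end

definition to_vec :: "'a::euclidean_space \<Rightarrow> real ^ 'a bidx" where
  "to_vec x = (\<chi> i. x \<bullet> Rep_bidx i)"

definition of_vec :: "real ^ 'a bidx \<Rightarrow> 'a::euclidean_space" where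
  "of_vec v = (\<Sum>i\<in>UNIV. v $ i *\<^sub>R Rep_bidx i)"

lemma sum_bidx: "(\<Sum>i\<in>UNIV. f (Rep_bidx i)) = sum f (Basis :: 'a::euclidean_space set)"
  by (rule sum.reindex_bij_betw[OF bij_betw_Rep_bidx])

lemma prod_bidx: "(\<Prod>i\<in>UNIV. f (Rep_bidx i)) = prod f (Basis :: 'a::euclidean_space set)"
  by (rule prod.reindex_bij_betw[OF bij_betw_Rep_bidx])

lemma Rep_bidx_Basis [simp]: "Rep_bidx i \<in> Basis"
  by (rule Rep_bidx)

lemma of_vec_to_vec [simp]: "of_vec (to_vec x) = x"
  using sum_bidx[of "\<lambda>b. (x \<bullet> b) *\<^sub>R b"] by (simp add: of_vec_def to_vec_def euclidean_representation)

lemma of_vec_inner_Rep [simp]: "of_vec v \<bullet> Rep_bidx i = v $ i"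
proof -
  have "of_vec v \<bullet> Rep_bidx i = (\<Sum>j\<in>UNIV. v $ j * (Rep_bidx j \<bullet> Rep_bidx i))"
    by (simp add: of_vec_def inner_sum_left)
  also have "\<dots> = (\<Sum>j\<in>UNIV. if j = i then v $ j else 0)"
    by (intro sum.cong) (auto simp: inner_Basis Rep_bidx_inject)
  finally show ?thesis by simp
qed

lemma to_vec_of_vec [simp]: "to_vec (of_vec v) = v"
  by (simp add: to_vec_def vec_eq_iff)

lemma linear_to_vec: "linear to_vec"
  by (rule linearI) (auto simp: to_vec_def vec_eq_iff inner_add_left)

lemma linear_of_vec: "linear of_vec"
  by (rule linearI) (auto simp: of_vec_def scaleR_add_left sum.distrib scaleR_sum_right)

lemma inner_to_vec [simp]: "to_vec x \<bullet> to_vec y = x \<bullet> y"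
proof -
  have "to_vec x \<bullet> to_vec y = (\<Sum>i\<in>UNIV. (x \<bullet> Rep_bidx i) * (y \<bullet> Rep_bidx i))"
    by (simp add: to_vec_def inner_vec_def)
  also have "\<dots> = (\<Sum>b\<in>Basis. (x \<bullet> b) * (y \<bullet> b))" by (rule sum_bidx)
  also have "\<dots> = x \<bullet> y" by (rule euclidean_inner[symmetric])
  finally show ?thesis .
qed

lemma measurable_to_vec [measurable]: "to_vec \<in> borel_measurable borel"
  using linear_to_vec by (intro borel_measurable_continuous_onI linear_continuous_on) (simp add: linear_linear)

lemma measurable_of_vec [measurable]: "of_vec \<in> borel_measurable borel"
  using linear_of_vec by (intro borel_measurable_continuous_onI linear_continuous_on) (simp add: linear_linear)

lemma distr_to_vec: "distr lborel borel to_vec = lborel"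
proof (rule lborel_eqI[symmetric])
  fix l u :: "real ^ 'a bidx"
  assume le: "\<And>b. b \<in> Basis \<Longrightarrow> l \<bullet> b \<le> u \<bullet> b"
  have le': "l $ i \<le> u $ i" for i using le[of "axis i 1"] by (simp add: inner_axis axis_in_Basis_iff)
  have eq: "to_vec -` box l u = box (of_vec l) (of_vec u)"
  proof (intro set_eqI)
    fix x
    have "x \<in> box (of_vec l) (of_vec u) \<longleftrightarrow> (\<forall>i. of_vec l \<bullet> Rep_bidx i < x \<bullet> Rep_bidx i \<and> x \<bullet> Rep_bidx i < of_vec u \<bullet> Rep_bidx i)"
      using bij_betw_Rep_bidx unfolding mem_box bij_betw_def by (metis rangeI rangeE)
    then show "x \<in> to_vec -` box l u \<longleftrightarrow> x \<in> box (of_vec l) (of_vec u)"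
      by (simp add: mem_box_cart to_vec_def)
  qed
  have "emeasure (distr lborel borel to_vec) (box l u) = emeasure lborel (box (of_vec l) (of_vec u :: 'a))"
    by (subst emeasure_distr) (auto simp: eq)
  also have "\<dots> = (\<Prod>b\<in>Basis. (of_vec u - of_vec l :: 'a) \<bullet> b)"
  proof (rule emeasure_lborel_box)
    fix b :: 'a assume "b \<in> Basis"
    then obtain i where "b = Rep_bidx i" by (metis Abs_bidx_inverse)
    then show "of_vec l \<bullet> b \<le> of_vec u \<bullet> b" using le' by simp
  qed
  also have "(\<Prod>b\<in>Basis. (of_vec u - of_vec l :: 'a) \<bullet> b) = (\<Prod>i\<in>UNIV. u $ i - l $ i)"
    by (subst prod_bidx[symmetric]) (simp add: inner_diff_left)
  also have "\<dots> = (\<Prod>b\<in>Basis. (u - l) \<bullet> b)"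
  proof -
    have "bij_betw (\<lambda>i. axis i (1::real)) UNIV (Basis :: (real ^ 'a bidx) set)"
      by (auto simp: bij_betw_def inj_on_def axis_eq_axis Basis_vec_def)
    from prod.reindex_bij_betw[OF this, of "\<lambda>b. (u - l) \<bullet> b"] show ?thesis
      by (simp add: inner_axis)
  qed
  finally show "emeasure (distr lborel borel to_vec) (box l u) = ennreal (\<Prod>b\<in>Basis. (u - l) \<bullet> b)" .
qed simp

lemma distr_of_vec: "distr lborel borel of_vec = (lborel :: 'a::euclidean_space measure)"
proof -
  have "distr lborel borel of_vec = distr (distr lborel borel (to_vec :: 'a \<Rightarrow> _)) borel of_vec"
    by (simp add: distr_to_vec)
  also have "\<dots> = lborel"
    by (subst distr_distr) (auto simp: o_def distr_id2)
  finally show ?thesis .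
qed

lemma nn_integral_of_vec:
  assumes "f \<in> borel_measurable borel"
  shows "(\<integral>\<^sup>+x. f (of_vec x) \<partial>lborel) = (\<integral>\<^sup>+x. f x \<partial>lborel)"
proof -
  have "(\<integral>\<^sup>+x. f x \<partial>distr lborel borel of_vec) = (\<integral>\<^sup>+x. f (of_vec x) \<partial>lborel)"
    by (rule nn_integral_distr) (use assms in simp_all)
  then show ?thesis unfolding distr_of_vec by (rule sym)
qed

definition ldet :: "('a::euclidean_space \<Rightarrow> 'a) \<Rightarrow> real" where
  "ldet f = det (matrix (to_vec \<circ> f \<circ> of_vec))"

lemma linear_conj_vec: "linear f \<Longrightarrow> linear (to_vec \<circ> f \<circ> of_vec)"
  by (intro linear_compose linear_of_vec linear_to_vec)

lemma ldet_compose: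
  assumes "linear f" "linear g"
  shows "ldet (f \<circ> g) = ldet f * ldet g"
proof -
  have "to_vec \<circ> (f \<circ> g) \<circ> of_vec = (to_vec \<circ> f \<circ> of_vec) \<circ> (to_vec \<circ> g \<circ> of_vec)"
    by (auto simp: fun_eq_iff)
  then show ?thesis
    using assms by (simp add: ldet_def matrix_compose linear_conj_vec det_mul)
qed

lemma orthogonal_transformation_conj_vec:
  assumes "orthogonal_transformation f"
  shows "orthogonal_transformation (to_vec \<circ> f \<circ> of_vec)"
proof -
  have "of_vec v \<bullet> of_vec w = v \<bullet> w" for v w :: "real ^ 'a bidx"
    using inner_to_vec[of "of_vec v" "of_vec w"] by simp
  then show ?thesis
    using assms linear_conj_vec[of f] by (simp add: orthogonal_transformation_def)
qed

lemma ldet_orthogonal: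
  assumes "orthogonal_transformation f"
  shows "ldet f \<noteq> 0"
proof -
  have "orthogonal_matrix (matrix (to_vec \<circ> f \<circ> of_vec))"
    using orthogonal_transformation_conj_vec[OF assms] by (simp add: orthogonal_transformation_matrix)
  then show ?thesis using det_orthogonal_matrix by (fastforce simp: ldet_def)
qed

lemma onbasis_rotation:
  fixes S :: "'a::euclidean_space set"
  assumes S: "onbasis S"
  obtains T \<sigma> where "orthogonal_transformation T" "bij_betw \<sigma> (Basis :: 'a set) S"
    "\<And>b. b \<in> Basis \<Longrightarrow> T b = \<sigma> b"
proof -
  have fin: "finite S" using S orthonormal_finite by (auto simp: onbasis_def)
  obtain \<sigma> where \<sigma>: "bij_betw \<sigma> (Basis :: 'a set) S"
    using onbasis_card[OF S] fin finite_Basis by (metis finite_same_card_bij)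
  define T where "T x = (\<Sum>b\<in>Basis. (x \<bullet> b) *\<^sub>R \<sigma> b)" for x
  have "linear T"
    by (rule linearI) (auto simp: T_def inner_add_left scaleR_add_left sum.distrib scaleR_sum_right)
  have on: "\<sigma> b \<bullet> \<sigma> b' = (if b = b' then 1 else 0)" if "b \<in> Basis" "b' \<in> Basis" for b b'
  proof -
    have "\<sigma> b \<in> S" "\<sigma> b' \<in> S" "\<sigma> b = \<sigma> b' \<longleftrightarrow> b = b'"
      using \<sigma> that by (auto simp: bij_betw_def inj_on_eq_iff)
    then show ?thesis using S by (auto simp: onbasis_def orthonormal_inner)
  qed
  have Tb: "T b = \<sigma> b" if "b \<in> Basis" for b
    using that unfolding T_def by (subst sum.remove[of _ b]) (auto simp: inner_Basis intro!: sum.neutral split: if_splits)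
  have "T x \<bullet> T y = x \<bullet> y" for x y
  proof -
    have "T x \<bullet> T y = (\<Sum>b\<in>Basis. \<Sum>b'\<in>Basis. (x \<bullet> b) * (y \<bullet> b') * (\<sigma> b \<bullet> \<sigma> b'))"
      unfolding T_def inner_sum_left inner_sum_right by (subst sum.swap) (simp add: sum_distrib_left mult_ac)
    also have "\<dots> = (\<Sum>b\<in>Basis. \<Sum>b'\<in>Basis. if b = b' then (x \<bullet> b) * (y \<bullet> b') else 0)"
      by (intro sum.cong) (auto simp: on)
    also have "\<dots> = x \<bullet> y" by (simp add: euclidean_inner[of x y])
    finally show ?thesis .
  qed
  then have "orthogonal_transformation T"
    using \<open>linear T\<close> by (simp add: orthogonal_transformation_def)
  then show ?thesis using that \<sigma> Tb by blast
qed

text \<open>The rotation \<open>T\<close> carrying the standard basis to \<open>S\<close> satisfies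
  \<open>A \<circ> T = T \<circ> D\<close> with \<open>D\<close> diagonal, and the nonzero factor
  \<open>ldet T\<close> cancels.\<close>

lemma ldet_eigenbasis:
  fixes A :: "'a::euclidean_space \<Rightarrow> 'a"
  assumes lin: "linear A" and S: "onbasis S" and eig: "\<And>c. c \<in> S \<Longrightarrow> A c = m c *\<^sub>R c"
  shows "ldet A = prod m S"
proof -
  obtain T \<sigma> where T: "orthogonal_transformation T" and \<sigma>: "bij_betw \<sigma> (Basis :: 'a set) S"
    and Tb: "\<And>b. b \<in> Basis \<Longrightarrow> T b = \<sigma> b"
    using onbasis_rotation[OF S] by blast
  have linT: "linear T" using T orthogonal_transformation_linear by blast
  define D where "D x = (\<Sum>b\<in>Basis. (m (\<sigma> b) * (x \<bullet> b)) *\<^sub>R b)" for x :: 'a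
  have linD: "linear D"
    by (rule linearI) (auto simp: D_def inner_add_left scaleR_add_left distrib_left sum.distrib scaleR_sum_right mult.left_commute)
  have Db: "D b = m (\<sigma> b) *\<^sub>R b" if "b \<in> Basis" for b
    using that unfolding D_def by (subst sum.remove[of _ b]) (auto simp: inner_Basis intro!: sum.neutral split: if_splits)
  have "A \<circ> T = T \<circ> D"
  proof (rule linear_eq_stdbasis)
    show "(A \<circ> T) b = (T \<circ> D) b" if "b \<in> Basis" for b
      using that \<sigma> eig by (simp add: Tb Db linear_scale[OF linT] bij_betw_apply)
  qed (rule linear_compose[OF linT lin] linear_compose[OF linD linT])+
  then have "ldet A * ldet T = ldet T * ldet D"
    by (metis ldet_compose lin linT linD)
  then have "ldet A = ldet D" using ldet_orthogonal[OF T] by simp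
  also have "ldet D = (\<Prod>i\<in>UNIV. m (\<sigma> (Rep_bidx i)))"
  proof -
    have 1: "D (of_vec (axis j 1)) = m (\<sigma> (Rep_bidx j)) *\<^sub>R Rep_bidx j" for j
    proof -
      have "of_vec (axis j 1) = (\<Sum>i\<in>UNIV. if i = j then Rep_bidx i else (0::'a))"
        unfolding of_vec_def by (intro sum.cong) (auto simp: axis_def)
      then show ?thesis by (simp add: Db)
    qed
    have "matrix (to_vec \<circ> D \<circ> of_vec) $ i $ j = (if i = j then m (\<sigma> (Rep_bidx i)) else 0)" for i j
      by (auto simp: matrix_def 1 to_vec_def inner_Basis Rep_bidx_inject)
    then show ?thesis unfolding ldet_def by (subst det_diagonal) auto
  qed
  also have "\<dots> = (\<Prod>b\<in>Basis. m (\<sigma> b))" by (rule prod_bidx)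
  also have "\<dots> = prod m S" by (rule prod.reindex_bij_betw[OF \<sigma>])
  finally show ?thesis .
qed

lemma measure_lebesgue_eq_lborel_compact: "compact S \<Longrightarrow> measure lebesgue S = measure lborel S"
  by (simp add: measure_completion borel_compact)

lemma measure_of_vec_image:
  assumes "compact S"
  shows "measure lborel (to_vec ` S) = measure lborel S"
proof -
  have "to_vec ` S = of_vec -` S" by (auto simp: image_iff) (metis to_vec_of_vec)
  then have "measure lborel (to_vec ` S) = measure (distr lborel borel of_vec) S"
    using assms by (subst measure_distr) (auto simp: borel_compact)
  then show ?thesis by (simp add: distr_of_vec)
qed

lemma measure_linear_image_ldet:
  fixes f :: "'a::euclidean_space \<Rightarrow> 'a"
  assumes lin: "linear f" and S: "compact S"
  shows "measure lebesgue (f ` S) = \<bar>ldet f\<bar> * measure lebesgue S"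
proof -
  have cf: "compact (f ` S)"
    using S lin by (intro compact_continuous_image linear_continuous_on) (simp_all add: linear_linear)
  have cv: "compact (to_vec ` S)"
    using S linear_to_vec by (intro compact_continuous_image linear_continuous_on) (simp_all add: linear_linear)
  have "to_vec ` f ` S = (to_vec \<circ> f \<circ> of_vec) ` to_vec ` S"
    by (auto simp: image_iff)
  then have "measure lebesgue (to_vec ` f ` S) = \<bar>ldet f\<bar> * measure lebesgue (to_vec ` S)"
    unfolding ldet_def using measure_linear_image[OF linear_conj_vec[OF lin] lmeasurable_compact[OF cv]] by simp
  moreover have "compact (to_vec ` f ` S)"
    using linear_continuous_on[of to_vec "f ` S"] linear_to_vec
    by (intro compact_continuous_image cf) (simp add: linear_linear)
  ultimately show ?thesis
    using S cf cv by (simp add: measure_lebesgue_eq_lborel_compact measure_of_vec_image)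
qed

lemma distr_lborel_orthogonal:
  fixes T :: "'a::euclidean_space \<Rightarrow> 'a"
  assumes T: "orthogonal_transformation T"
  shows "distr lborel borel T = lborel"
proof -
  let ?g = "to_vec \<circ> T \<circ> of_vec"
  have g: "orthogonal_transformation ?g" using orthogonal_transformation_conj_vec[OF T] .
  have meas: "?g \<in> borel_measurable borel"
    using orthogonal_transformation_linear[OF g]
    by (intro borel_measurable_continuous_onI linear_continuous_on) (simp add: linear_linear)
  have "distr lborel borel ?g = lborel"
  proof (rule lborel_eqI[symmetric])
    fix l u :: "real ^ 'a bidx"
    assume le: "\<And>b. b \<in> Basis \<Longrightarrow> l \<bullet> b \<le> u \<bullet> b"
    have bij: "bij ?g" using g by (rule orthogonal_transformation_bij)
    have og: "orthogonal_transformation (inv ?g)" using g by (rule orthogonal_transformation_inv)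
    have vi: "?g -` box l u = inv ?g ` box l u" using bij by (rule bij_vimage_eq_inv_image)
    have m: "inv ?g ` box l u \<in> lmeasurable" "measure lebesgue (inv ?g ` box l u) = measure lebesgue (box l u)"
      using measurable_orthogonal_image[OF og] measure_orthogonal_image[OF og] by auto
    have b: "?g -` box l u \<in> sets borel" using meas by (metis borel_open measurable_sets_borel open_box)
    have "emeasure (distr lborel borel ?g) (box l u) = emeasure lborel (?g -` box l u)"
      using meas by (subst emeasure_distr) auto
    also have "\<dots> = emeasure lebesgue (?g -` box l u)" using b by (simp add: emeasure_completion)
    also have "\<dots> = ennreal (measure lebesgue (box l u))"
      using m unfolding vi by (metis emeasure_eq_measure2)
    also have "\<dots> = (\<Prod>b\<in>Basis. (u - l) \<bullet> b)"
      using le by (simp add: measure_lborel_box_eq inner_diff_left)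
    finally show "emeasure (distr lborel borel ?g) (box l u) = (\<Prod>b\<in>Basis. (u - l) \<bullet> b)" .
  qed simp
  then have "distr (distr lborel borel ?g) borel of_vec = distr lborel borel of_vec" by simp
  then have 1: "distr lborel borel (of_vec \<circ> ?g) = lborel"
    using meas by (simp add: distr_distr distr_of_vec)
  have "distr lborel borel T = distr (distr lborel borel of_vec) borel T" by (simp add: distr_of_vec)
  also have "\<dots> = distr lborel borel (T \<circ> of_vec)"
    using orthogonal_transformation_linear[OF T]
    by (intro distr_distr measurable_of_vec borel_measurable_continuous_onI linear_continuous_on) (auto simp add: linear_linear)
  also have "T \<circ> of_vec = of_vec \<circ> ?g" by (simp add: fun_eq_iff)
  finally show ?thesis using 1 by argo
qed

text \<open>Rotation invariance of Lebesgue measure reduces an arbitrary orthonormal basis to the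
  standard one, where the measure is a product.\<close>

lemma nn_integral_onbasis_prod:
  fixes S :: "'a::euclidean_space set"
  assumes S: "onbasis S" and f: "\<And>c. c \<in> S \<Longrightarrow> f c \<in> borel_measurable borel"
  shows "(\<integral>\<^sup>+x. (\<Prod>c\<in>S. f c (x \<bullet> c)) \<partial>lborel) = (\<Prod>c\<in>S. (\<integral>\<^sup>+t. f c t \<partial>lborel))"
proof -
  obtain T \<sigma> where T: "orthogonal_transformation T" and \<sigma>: "bij_betw \<sigma> (Basis :: 'a set) S"
    and Tb: "\<And>b. b \<in> Basis \<Longrightarrow> T b = \<sigma> b"
    using onbasis_rotation[OF S] by blast
  have [measurable]: "T \<in> borel_measurable borel"
    using orthogonal_transformation_linear[OF T]
    by (intro borel_measurable_continuous_onI linear_continuous_on) (simp add: linear_linear)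
  have [measurable]: "(\<lambda>x. \<Prod>c\<in>S. f c (x \<bullet> c)) \<in> borel_measurable borel"
    using f by (intro borel_measurable_prod_ennreal) (auto intro!: measurable_compose[where N=borel])
  have "(\<integral>\<^sup>+x. (\<Prod>c\<in>S. f c (x \<bullet> c)) \<partial>lborel) = (\<integral>\<^sup>+x. (\<Prod>c\<in>S. f c (T x \<bullet> c)) \<partial>lborel)"
    by (subst distr_lborel_orthogonal[OF T, symmetric]) (simp add: nn_integral_distr)
  also have "\<dots> = (\<integral>\<^sup>+x. (\<Prod>b\<in>Basis. f (\<sigma> b) (x \<bullet> b)) \<partial>lborel)"
  proof (intro nn_integral_cong)
    fix x
    have "(\<Prod>c\<in>S. f c (T x \<bullet> c)) = (\<Prod>b\<in>Basis. f (\<sigma> b) (T x \<bullet> \<sigma> b))"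
      by (rule prod.reindex_bij_betw[OF \<sigma>, symmetric])
    also have "\<dots> = (\<Prod>b\<in>Basis. f (\<sigma> b) (x \<bullet> b))"
      using T by (intro prod.cong) (auto simp: Tb[symmetric] orthogonal_transformation_def)
    finally show "(\<Prod>c\<in>S. f c (T x \<bullet> c)) = (\<Prod>b\<in>Basis. f (\<sigma> b) (x \<bullet> b))" .
  qed
  also have "\<dots> = (\<Prod>b\<in>Basis. \<integral>\<^sup>+t. f (\<sigma> b) t \<partial>lborel)"
    using f \<sigma> by (intro nn_integral_lborel_prod) (auto simp: bij_betw_apply)
  also have "\<dots> = (\<Prod>c\<in>S. (\<integral>\<^sup>+t. f c t \<partial>lborel))"
    by (rule prod.reindex_bij_betw[OF \<sigma>])
  finally show ?thesis .
qed

text \<open>An inequality suffices for the transport: \<open>g\<close> is injective but may miss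
  part of the space, and since \<open>H\<close> is nonnegative its integral over
  \<open>range g\<close> is at most the full one. An infinite right-hand side is trivial, so
  \<open>H\<close> may be taken integrable.\<close>

lemma nn_integral_change_of_variables_le_cart:
  fixes g :: "real^'n::{finite,wellorder} \<Rightarrow> real^'n::_" and H G :: "real^'n::_ \<Rightarrow> real"
  assumes der: "\<And>x. (g has_derivative g' x) (at x)" and inj: "inj g"
    and [measurable]: "H \<in> borel_measurable borel" "G \<in> borel_measurable borel"
    and nonneg: "\<And>x. 0 \<le> H x" and le: "\<And>x. G x \<le> \<bar>det (matrix (g' x))\<bar> * H (g x)"
  shows "(\<integral>\<^sup>+x. ennreal (G x) \<partial>lborel) \<le> (\<integral>\<^sup>+x. ennreal (H x) \<partial>lborel)"
proof (cases "(\<integral>\<^sup>+x. ennreal (H x) \<partial>lborel) = \<infinity>")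
  case False
  \<comment> \<open>The change of variables theorem speaks of functions into a Cartesian power of
    the reals, hence the detour through \<open>real^1\<close>.\<close>
  define f :: "real^'n::_ \<Rightarrow> real^1" where "f x = vec (H x)" for x
  have bl: "bounded_linear (\<lambda>x::real^1. x $ 1)" by (rule bounded_linear_vec_nth)
  have bv: "bounded_linear (vec :: real \<Rightarrow> real^1)"
    by (simp add: linear_vec linear_conv_bounded_linear[symmetric])
  have iH: "integrable lborel H"
    using False nonneg by (intro integrableI_nonneg) (auto simp: less_top)
  then have iH': "integrable lebesgue H" by (simp add: integrable_completion)
  have cont: "continuous_on UNIV g"
    using der has_derivative_continuous continuous_at_imp_continuous_on by blast
  \<comment> \<open>Invariance of domain is what makes the range measurable.\<close>
  have "open (range g)" using invariance_of_domain[OF cont] inj by auto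
  then have rg: "range g \<in> sets lebesgue" by (simp add: borel_open)
  have "integrable lebesgue f" unfolding f_def
    using integrable_bounded_linear[OF bv iH'] .
  then have "f absolutely_integrable_on UNIV" by (simp add: set_integrable_def)
  then have fr: "f absolutely_integrable_on (range g)"
    by (rule set_integrable_subset) (use rg in auto)
  let ?D = "\<lambda>x. \<bar>det (matrix (g' x))\<bar> *\<^sub>R f (g x)"
  have D: "?D absolutely_integrable_on UNIV \<and> integral UNIV ?D = integral (range g) f"
    using has_absolute_integral_change_of_variables[of UNIV g g' f "integral (range g) f"] der inj fr by auto
  let ?d = "\<lambda>x. \<bar>det (matrix (g' x))\<bar> * H (g x)"
  have deq: "(\<lambda>x. x $ 1) \<circ> ?D = ?d" by (auto simp: f_def fun_eq_iff)
  have d: "?d absolutely_integrable_on UNIV"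
    using absolutely_integrable_linear[OF conjunct1[OF D] bl] unfolding deq .
  have "integral UNIV ?d = integral (range g) f $ 1"
    using integral_linear[OF set_lebesgue_integral_eq_integral(1)[OF conjunct1[OF D]] bl] conjunct2[OF D]
    unfolding deq by simp
  also have "\<dots> = integral (range g) H"
    using integral_linear[OF _ bl, of f "range g"] fr set_lebesgue_integral_eq_integral(1)[OF fr]
    by (simp add: f_def o_def)
  also have "\<dots> \<le> integral UNIV H"
  proof (rule integral_subset_le)
    have "H absolutely_integrable_on range g"
      by (rule set_integrable_subset[of _ UNIV]) (use rg iH' in \<open>auto simp: set_integrable_def\<close>)
    then show "H integrable_on range g" using set_lebesgue_integral_eq_integral(1) by blast
    show "H integrable_on UNIV" using iH by (rule integrable_on_lborel)
  qed (use nonneg in auto)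
  also have "\<dots> = (\<integral>x. H x \<partial>lborel)" using iH by (rule integral_lborel)
  finally have le2: "integral UNIV ?d \<le> (\<integral>x. H x \<partial>lborel)" .
  have dl: "integrable lebesgue ?d" using d by (simp add: set_integrable_def)
  have "(\<integral>\<^sup>+x. ennreal (G x) \<partial>lborel) = (\<integral>\<^sup>+x. ennreal (G x) \<partial>lebesgue)"
    by (simp add: nn_integral_completion)
  also have "\<dots> \<le> (\<integral>\<^sup>+x. ennreal (?d x) \<partial>lebesgue)"
    by (intro nn_integral_mono ennreal_leI le)
  also have "\<dots> = ennreal (\<integral>x. ?d x \<partial>lebesgue)"
    by (rule nn_integral_eq_integral[OF dl]) (simp add: nonneg)
  also have "(\<integral>x. ?d x \<partial>lebesgue) = integral UNIV ?d"
    using set_lebesgue_integral_eq_integral(2)[OF d] by (simp add: set_lebesgue_integral_def)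
  also have "ennreal (integral UNIV ?d) \<le> ennreal (\<integral>x. H x \<partial>lborel)" by (intro ennreal_leI le2)
  also have "\<dots> = (\<integral>\<^sup>+x. ennreal (H x) \<partial>lborel)"
    using nn_integral_eq_integral[OF iH] nonneg by simp
  finally show ?thesis .
qed simp

lemma nn_integral_change_of_variables_le:
  fixes g :: "'a::euclidean_space \<Rightarrow> 'a"
  assumes der: "\<And>x. (g has_derivative g' x) (at x)" and inj: "inj g"
    and [measurable]: "H \<in> borel_measurable borel" "G \<in> borel_measurable borel"
    and nonneg: "\<And>x. 0 \<le> H x" and le: "\<And>x. G x \<le> \<bar>ldet (g' x)\<bar> * H (g x)"
  shows "(\<integral>\<^sup>+x. ennreal (G x) \<partial>lborel) \<le> (\<integral>\<^sup>+x. ennreal (H x) \<partial>lborel)"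
proof -
  have "(\<integral>\<^sup>+x. ennreal (G (of_vec x)) \<partial>lborel) \<le> (\<integral>\<^sup>+x. ennreal (H (of_vec x)) \<partial>lborel)"
  proof (rule nn_integral_change_of_variables_le_cart)
    show "(to_vec \<circ> g \<circ> of_vec has_derivative to_vec \<circ> g' (of_vec x) \<circ> of_vec) (at x)" for x
      using linear_imp_has_derivative[OF linear_to_vec] linear_imp_has_derivative[OF linear_of_vec] der
      by (intro diff_chain_at) auto
    show "inj (to_vec \<circ> g \<circ> of_vec)"
      using inj by (intro inj_compose) (auto intro: inj_on_inverseI[of _ of_vec] inj_on_inverseI[of _ to_vec])
    show "G (of_vec x) \<le> \<bar>det (matrix (to_vec \<circ> g' (of_vec x) \<circ> of_vec))\<bar> * H (of_vec ((to_vec \<circ> g \<circ> of_vec) x))" for x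
      using le[of "of_vec x"] by (simp add: ldet_def)
    show "(\<lambda>x. H (of_vec x)) \<in> borel_measurable borel" "(\<lambda>x. G (of_vec x)) \<in> borel_measurable borel"
      by measurable
  qed (rule nonneg)
  then show ?thesis
    using nn_integral_of_vec[of "\<lambda>x. ennreal (G x)"] nn_integral_of_vec[of "\<lambda>x. ennreal (H x)"] by simp
qed

subsection \<open>Reverse Brascamp--Lieb inequality\<close>

text \<open>Concavity of the logarithm, applied to each eigenvalue. For a unit eigenvector
  \<open>c\<close> the frame identity makes \<open>lam i * (w i \<bullet> c)^2\<close> a probability
  distribution in \<open>i\<close>, and the eigenvalue is the mean of the \<open>t i\<close> under
  it. Summing the logarithmic bounds over an eigenbasis turns these weights into
  \<open>lam i * (norm (w i))^2\<close> by Parseval.\<close>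

lemma ldet_weighted_frame_ge:
  fixes w :: "'i \<Rightarrow> 'a::euclidean_space"
  assumes fin: "finite I" and lam: "\<And>i. i \<in> I \<Longrightarrow> 0 < lam i" and t: "\<And>i. i \<in> I \<Longrightarrow> 0 < t i"
    and frame: "\<And>x. (\<Sum>i\<in>I. (lam i * (w i \<bullet> x)) *\<^sub>R w i) = x"
  shows "(\<Prod>i\<in>I. t i powr (lam i * (norm (w i))\<^sup>2)) \<le> ldet (\<lambda>x. \<Sum>i\<in>I. (lam i * t i * (w i \<bullet> x)) *\<^sub>R w i)"
proof -
  define A where "A x = (\<Sum>i\<in>I. (lam i * t i * (w i \<bullet> x)) *\<^sub>R w i)" for x
  have linA: "linear A"
    by (rule linearI) (auto simp: A_def inner_add_right distrib_left scaleR_add_left sum.distrib scaleR_sum_right mult_ac)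
  have quad: "A x \<bullet> y = (\<Sum>i\<in>I. lam i * t i * (w i \<bullet> x) * (w i \<bullet> y))" for x y
    by (simp add: A_def inner_sum_left)
  have sa: "A x \<bullet> y = x \<bullet> A y" for x y
    unfolding inner_commute[of x "A y"] quad by (intro sum.cong) auto
  have norms: "(\<Sum>i\<in>I. lam i * (w i \<bullet> x)\<^sup>2) = x \<bullet> x" for x
  proof -
    have "x \<bullet> x = (\<Sum>i\<in>I. (lam i * (w i \<bullet> x)) *\<^sub>R w i) \<bullet> x" by (simp only: frame)
    then show ?thesis by (simp add: inner_sum_left power2_eq_square mult.assoc)
  qed
  obtain S m where S: "onbasis S" and eig: "\<And>c. c \<in> S \<Longrightarrow> A c = m c *\<^sub>R c"
    using self_adjoint_eigenbasis[OF linA sa] by blast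
  have finS: "finite S" using S orthonormal_finite by (auto simp: onbasis_def)
  have key: "m c > 0 \<and> (\<Sum>i\<in>I. lam i * (w i \<bullet> c)\<^sup>2 * ln (t i)) \<le> ln (m c)" if c: "c \<in> S" for c
  proof -
    have cc: "c \<bullet> c = 1" using S c orthonormal_inner[of S c c] by (simp add: onbasis_def)
    define p where "p i = lam i * (w i \<bullet> c)\<^sup>2" for i
    have p0: "0 \<le> p i" if "i \<in> I" for i using lam[OF that] by (simp add: p_def)
    have p1: "sum p I = 1" using norms[of c] cc by (simp add: p_def)
    have mc: "m c = (\<Sum>i\<in>I. p i * t i)"
      using quad[of c c] eig[OF c] cc by (simp add: p_def power2_eq_square mult_ac)
    have mpos: "m c > 0"
    proof (rule ccontr)
      assume "\<not> m c > 0"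
      moreover have "m c \<ge> 0" unfolding mc using p0 t by (intro sum_nonneg) (simp add: less_imp_le)
      ultimately have "(\<Sum>i\<in>I. p i * t i) = 0" using mc by simp
      then have "\<forall>i\<in>I. p i * t i = 0"
        using p0 t fin by (subst (asm) sum_nonneg_eq_0_iff) (auto simp: less_imp_le)
      then have "\<forall>i\<in>I. p i = 0" using t by fastforce
      then show False using p1 by simp
    qed
    \<comment> \<open>Jensen's inequality through the tangent line \<open>ln x \<le> x - 1\<close>
      at \<open>x = t i / m c\<close>; the right-hand side averages to 0.\<close>
    have "(\<Sum>i\<in>I. p i * (ln (t i) - ln (m c))) \<le> (\<Sum>i\<in>I. p i * (t i / m c - 1))"
    proof (intro sum_mono mult_left_mono p0)
      fix i assume "i \<in> I"
      then show "ln (t i) - ln (m c) \<le> t i / m c - 1"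
        using t[of i] mpos ln_le_minus_one[of "t i / m c"] by (simp add: ln_div)
    qed
    also have "\<dots> = (\<Sum>i\<in>I. p i * t i) / m c - sum p I"
      by (simp add: right_diff_distrib sum_subtractf sum_divide_distrib)
    also have "\<dots> = 0" using p1 mc mpos by simp
    finally have "(\<Sum>i\<in>I. p i * ln (t i)) - sum p I * ln (m c) \<le> 0"
      by (simp add: right_diff_distrib sum_subtractf sum_distrib_right)
    then show ?thesis using mpos p1 by (simp add: p_def)
  qed
  have "(\<Prod>i\<in>I. t i powr (lam i * (norm (w i))\<^sup>2)) = exp (\<Sum>i\<in>I. lam i * (norm (w i))\<^sup>2 * ln (t i))"
    unfolding exp_sum[OF fin] by (intro prod.cong refl) (use t in \<open>force simp: powr_def\<close>)
  also have "(\<Sum>i\<in>I. lam i * (norm (w i))\<^sup>2 * ln (t i)) = (\<Sum>i\<in>I. \<Sum>c\<in>S. lam i * (w i \<bullet> c)\<^sup>2 * ln (t i))"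
  proof (intro sum.cong refl)
    fix i
    have "(norm (w i))\<^sup>2 = (\<Sum>c\<in>S. (w i \<bullet> c)\<^sup>2)"
      unfolding power2_norm_eq_inner using onbasis_parseval[OF S, of "w i" "w i"] by (simp add: power2_eq_square)
    then show "lam i * (norm (w i))\<^sup>2 * ln (t i) = (\<Sum>c\<in>S. lam i * (w i \<bullet> c)\<^sup>2 * ln (t i))"
      by (simp add: sum_distrib_left sum_distrib_right)
  qed
  also have "\<dots> = (\<Sum>c\<in>S. \<Sum>i\<in>I. lam i * (w i \<bullet> c)\<^sup>2 * ln (t i))" by (rule sum.swap)
  also have "exp \<dots> \<le> exp (\<Sum>c\<in>S. ln (m c))" using key by (simp add: sum_mono)
  also have "\<dots> = prod m S" unfolding exp_sum[OF finS] using key by (intro prod.cong) auto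
  also have "\<dots> = ldet A" using ldet_eigenbasis[OF linA S eig] by simp
  finally show ?thesis unfolding A_def .
qed

text \<open>Barthe's transport proof of the reverse Brascamp--Lieb inequality: \<open>g\<close> below is the
  gradient of a convex function, and the determinant of its derivative dominates the geometric mean.\<close>

lemma reverse_brascamp_lieb_transport:
  fixes w :: "'i \<Rightarrow> 'a::euclidean_space"
  assumes fin: "finite I" and lam: "\<And>i. i \<in> I \<Longrightarrow> 0 < lam i"
    and frame: "\<And>x. (\<Sum>i\<in>I. (lam i * (w i \<bullet> x)) *\<^sub>R w i) = x"
    and T: "\<And>i t. i \<in> I \<Longrightarrow> (T i has_real_derivative T' i t) (at t)"
    and T': "\<And>i t. i \<in> I \<Longrightarrow> 0 < T' i t"
    and [measurable]: "H \<in> borel_measurable borel" "G \<in> borel_measurable borel" and H: "\<And>x. 0 \<le> H x"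
    and GH: "\<And>y. G y \<le> (\<Prod>i\<in>I. T' i (w i \<bullet> y) powr (lam i * (norm (w i))\<^sup>2)) * H (\<Sum>i\<in>I. (lam i * T i (w i \<bullet> y)) *\<^sub>R w i)"
  shows "(\<integral>\<^sup>+y. ennreal (G y) \<partial>lborel) \<le> (\<integral>\<^sup>+x. ennreal (H x) \<partial>lborel)"
proof (rule nn_integral_change_of_variables_le)
  define g where "g y = (\<Sum>i\<in>I. (lam i * T i (w i \<bullet> y)) *\<^sub>R w i)" for y
  let ?g' = "\<lambda>y h. \<Sum>i\<in>I. (lam i * T' i (w i \<bullet> y) * (w i \<bullet> h)) *\<^sub>R w i"
  have der: "((\<lambda>y. T i (w i \<bullet> y)) has_derivative (\<lambda>h. T' i (w i \<bullet> y) * (w i \<bullet> h))) (at y)" if "i \<in> I" for i y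
  proof -
    have 1: "((\<lambda>y. w i \<bullet> y) has_derivative (\<lambda>h. w i \<bullet> h)) (at y)"
      by (auto intro!: derivative_eq_intros)
    have 2: "(T i has_derivative (*) (T' i (w i \<bullet> y))) (at (w i \<bullet> y))"
      using T[OF that] by (simp add: has_field_derivative_def)
    show ?thesis using has_derivative_compose[OF 1 2] .
  qed
  show "(g has_derivative ?g' y) (at y)" for y
    unfolding g_def
  proof (rule has_derivative_sum)
    fix i assume "i \<in> I"
    from has_derivative_scaleR_left[OF has_derivative_mult_right[OF der[OF this, of y], of "lam i"], of "w i"]
    show "((\<lambda>y. (lam i * T i (w i \<bullet> y)) *\<^sub>R w i) has_derivative
        (\<lambda>h. (lam i * T' i (w i \<bullet> y) * (w i \<bullet> h)) *\<^sub>R w i)) (at y)"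
      by (simp add: mult.assoc)
  qed
  have mono: "T i a < T i b" if "i \<in> I" "a < b" for i a b
    using DERIV_pos_imp_increasing[OF that(2), of "T i"] T[OF that(1)] T'[OF that(1)] by blast
  show "inj g"
  proof (rule injI)
    fix y z assume eq: "g y = g z"
    \<comment> \<open>Strict monotonicity of \<open>g\<close>: each summand is nonnegative because
      \<open>T i\<close> increases, and if all of them vanish then \<open>y\<close> and
      \<open>z\<close> have the same products with every \<open>w i\<close>, so the frame identity
      identifies them.\<close>
    have "(g y - g z) \<bullet> (y - z) = (\<Sum>i\<in>I. lam i * ((T i (w i \<bullet> y) - T i (w i \<bullet> z)) * (w i \<bullet> y - w i \<bullet> z)))"
      by (simp add: g_def sum_subtractf[symmetric] scaleR_diff_left[symmetric] inner_sum_left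
          inner_diff_right right_diff_distrib[symmetric] mult.assoc)
    then have 0: "(\<Sum>i\<in>I. lam i * ((T i (w i \<bullet> y) - T i (w i \<bullet> z)) * (w i \<bullet> y - w i \<bullet> z))) = 0"
      using eq by simp
    have pos: "0 \<le> (T i a - T i b) * (a - b)" and zero: "(T i a - T i b) * (a - b) = 0 \<Longrightarrow> a = b"
      if "i \<in> I" for i a b
      using mono[OF that, of a b] mono[OF that, of b a]
      by (cases a b rule: linorder_cases; auto simp: mult_nonneg_nonneg mult_nonpos_nonpos)+
    have "\<forall>i\<in>I. lam i * ((T i (w i \<bullet> y) - T i (w i \<bullet> z)) * (w i \<bullet> y - w i \<bullet> z)) = 0"
      using 0 pos lam fin by (subst (asm) sum_nonneg_eq_0_iff) (auto simp: less_imp_le)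
    then have "\<forall>i\<in>I. w i \<bullet> y = w i \<bullet> z" using zero lam by (metis less_irrefl mult_eq_0_iff)
    then have "(\<Sum>i\<in>I. (lam i * (w i \<bullet> (y - z))) *\<^sub>R w i) = 0" by (simp add: inner_diff_right)
    then show "y = z" unfolding frame by simp
  qed
  show "G y \<le> \<bar>ldet (?g' y)\<bar> * H (g y)" for y
  proof -
    have "(\<Prod>i\<in>I. T' i (w i \<bullet> y) powr (lam i * (norm (w i))\<^sup>2)) \<le> \<bar>ldet (?g' y)\<bar>"
      using ldet_weighted_frame_ge[OF fin lam, where t = "\<lambda>i. T' i (w i \<bullet> y)" and w = w] T' frame by fastforce
    then show ?thesis using GH[of y] H[of "g y"] unfolding g_def by (meson mult_right_mono order_trans)
  qed
qed (use H in auto)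

text \<open>Jensen's inequality for \<open>x * ln x\<close>, again through the tangent line of the
  logarithm. Total weight below \<open>L\<close> is allowed because vectors with zero projection are
  discarded in the symmetric case; a smaller total weight only raises the mean of the
  \<open>x i\<close>.\<close>

lemma prod_powr_self_ge:
  fixes x lam :: "'i \<Rightarrow> real"
  assumes fin: "finite I" and lam: "\<And>i. i \<in> I \<Longrightarrow> 0 < lam i" and x: "\<And>i. i \<in> I \<Longrightarrow> 0 < x i"
    and n: "(\<Sum>i\<in>I. lam i * x i) = n" "0 < n" and L: "sum lam I \<le> L" "0 < L"
  shows "(n / L) powr n \<le> (\<Prod>i\<in>I. x i powr (lam i * x i))"
proof -
  have "(\<Sum>i\<in>I. lam i * x i * (1 - n / (L * x i))) \<le> (\<Sum>i\<in>I. lam i * x i * (ln (x i) - ln (n / L)))"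
  proof (intro sum_mono mult_left_mono)
    fix i assume i: "i \<in> I"
    have "ln (n / (L * x i)) \<le> n / (L * x i) - 1"
      using n L x[OF i] by (intro ln_le_minus_one) auto
    moreover have "ln (n / (L * x i)) = ln (n / L) - ln (x i)"
      using n L x[OF i] by (simp add: ln_div ln_mult)
    ultimately show "1 - n / (L * x i) \<le> ln (x i) - ln (n / L)" by linarith
    show "0 \<le> lam i * x i" using lam[OF i] x[OF i] by simp
  qed
  also have "(\<Sum>i\<in>I. lam i * x i * (1 - n / (L * x i))) = (\<Sum>i\<in>I. lam i * x i - n / L * lam i)"
  proof (intro sum.cong refl)
    fix i assume "i \<in> I"
    then show "lam i * x i * (1 - n / (L * x i)) = lam i * x i - n / L * lam i"
      using x[of i] L by (simp add: field_simps)
  qed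
  also have "\<dots> = n - n / L * sum lam I" by (simp add: sum_subtractf n(1) sum_distrib_left)
  finally have 1: "n - n / L * sum lam I \<le> (\<Sum>i\<in>I. lam i * x i * (ln (x i) - ln (n / L)))" .
  have "n / L * sum lam I \<le> n / L * L" using n L by (intro mult_left_mono) auto
  also have "\<dots> = n" using L by simp
  finally have "0 \<le> (\<Sum>i\<in>I. lam i * x i * (ln (x i) - ln (n / L)))" using 1 by linarith
  also have "\<dots> = (\<Sum>i\<in>I. lam i * x i * ln (x i)) - (\<Sum>i\<in>I. lam i * x i) * ln (n / L)"
    by (simp add: right_diff_distrib sum_subtractf sum_distrib_right)
  finally have "n * ln (n / L) \<le> (\<Sum>i\<in>I. lam i * x i * ln (x i))" using n by simp
  then have "exp (n * ln (n / L)) \<le> exp (\<Sum>i\<in>I. lam i * x i * ln (x i))" by simp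
  also have "\<dots> = (\<Prod>i\<in>I. x i powr (lam i * x i))"
    unfolding exp_sum[OF fin] by (intro prod.cong refl) (use x in \<open>force simp: powr_def\<close>)
  finally show ?thesis using n L by (simp add: powr_def)
qed

section \<open>Gaussian transport along a frame of arbitrary lengths\<close>

abbreviation "gauss \<equiv> std_normal_density"

lemma gauss_pos: "0 < gauss t"
  by (simp add: normal_density_pos)

lemma nn_integral_gauss: "(\<integral>\<^sup>+t. ennreal (gauss t) \<partial>lborel) = 1"
proof -
  have "emeasure (density lborel gauss) UNIV = 1"
    using prob_space.emeasure_space_1[OF prob_space_normal_density[of 1 0]] by simp
  then show ?thesis by (simp add: emeasure_density)
qed

text \<open>Common core of both volume bounds. \<open>T\<close> pushes the Gaussian to the density
  proportional to \<open>exp (- \<tau> t)\<close>, and \<open>\<kappa>\<close> is the mass of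
  \<open>exp (- \<tau> t)\<close> on the range of \<open>T\<close>: 1 for the one-sided and 2 for
  the two-sided exponential. On the directions in \<open>C\<close> the map is the identity, so the
  Gaussian factors survive there. The integrand \<open>G\<close> pulled back is a constant times the
  standard Gaussian density, and that constant is the bound.\<close>

lemma gaussian_transport:
  fixes w :: "'i \<Rightarrow> 'a::euclidean_space" and C :: "'a set"
  assumes fin: "finite I" and lam: "\<And>i. i \<in> I \<Longrightarrow> 0 < lam i" and w: "\<And>i. i \<in> I \<Longrightarrow> w i \<noteq> 0"
    and C: "orthonormal C"
    and frame: "\<And>x. (\<Sum>i\<in>I. (lam i * (w i \<bullet> x)) *\<^sub>R w i) + (\<Sum>c\<in>C. (c \<bullet> x) *\<^sub>R c) = x"
    and T: "\<And>t. (T has_real_derivative T' t) (at t)" and T': "\<And>t. 0 < T' t"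
    and \<kappa>: "0 < \<kappa>" and \<tau>: "\<And>t. T' t * exp (- \<tau> (T t)) = \<kappa> * gauss t"
    and [measurable]: "H \<in> borel_measurable borel" and H0: "\<And>x. 0 \<le> H x"
    and H: "\<And>y \<theta>. (\<And>i. \<theta> i \<in> range T) \<Longrightarrow>
      exp (- (\<Sum>i\<in>I. lam i * (norm (w i))\<^sup>2 * \<tau> (\<theta> i))) * (\<Prod>c\<in>C. gauss (c \<bullet> y))
      \<le> H ((\<Sum>i\<in>I. (lam i * (norm (w i))\<^sup>2 * \<theta> i) *\<^sub>R w i) + (\<Sum>c\<in>C. (c \<bullet> y) *\<^sub>R c))"
    and n: "(\<Sum>i\<in>I. lam i * (norm (w i))\<^sup>2) = n" "0 < n" and L: "sum lam I \<le> L" "0 < L"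
  shows "ennreal (\<kappa> powr n * (n / L) powr (n / 2)) \<le> (\<integral>\<^sup>+x. ennreal (H x) \<partial>lborel)"
proof -
  have finC: "finite C" using C by (rule orthonormal_finite)
  define r where "r i = norm (w i)" for i
  have r: "0 < r i" if "i \<in> I" for i using w[OF that] by (simp add: r_def)
  define W where "W = case_sum w (\<lambda>c::'a. c)"
  define M where "M = case_sum lam (\<lambda>c::'a. 1)"
  \<comment> \<open>For a vector of length \<open>r i\<close> the unit-vector map is conjugated by
    the length: argument divided by \<open>r i\<close>, value multiplied by its square. The
    derivative then carries one factor \<open>r i\<close>, which is the source of the product in
    \<open>K\<close>.\<close>
  define TT where "TT j t = (case j of Inl i \<Rightarrow> (r i)\<^sup>2 * T (t / r i) | Inr (c::'a) \<Rightarrow> t)" for j t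
  define TT' where "TT' j t = (case j of Inl i \<Rightarrow> r i * T' (t / r i) | Inr (c::'a) \<Rightarrow> 1)" for j t
  define K where "K = \<kappa> powr n * (\<Prod>i\<in>I. r i powr (lam i * (r i)\<^sup>2))"
  define G where "G y = K * (\<Prod>b\<in>Basis. gauss (y \<bullet> b))" for y :: 'a
  have norms: "(\<Sum>i\<in>I. lam i * (w i \<bullet> x)\<^sup>2) + (\<Sum>c\<in>C. (c \<bullet> x)\<^sup>2) = x \<bullet> x" for x
  proof -
    have "x \<bullet> x = ((\<Sum>i\<in>I. (lam i * (w i \<bullet> x)) *\<^sub>R w i) + (\<Sum>c\<in>C. (c \<bullet> x) *\<^sub>R c)) \<bullet> x"
      by (simp only: frame)
    then show ?thesis by (simp add: inner_add_left inner_sum_left power2_eq_square mult.assoc)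
  qed
  \<comment> \<open>Trace of the frame identity: it matches the normalising constants of the
    one-dimensional Gaussians with that of the full Gaussian.\<close>
  have trace: "n + card C = DIM('a)"
  proof -
    have "(\<Sum>b\<in>Basis. (\<Sum>i\<in>I. lam i * (w i \<bullet> b)\<^sup>2) + (\<Sum>c\<in>C. (c \<bullet> b)\<^sup>2)) = real DIM('a)"
      unfolding norms by (simp add: inner_Basis)
    also have "(\<Sum>b\<in>Basis. (\<Sum>i\<in>I. lam i * (w i \<bullet> b)\<^sup>2) + (\<Sum>c\<in>C. (c \<bullet> b)\<^sup>2)) =
        (\<Sum>i\<in>I. lam i * (w i \<bullet> w i)) + (\<Sum>c\<in>C. c \<bullet> c)"
      unfolding sum.distrib
      by (subst sum.swap, subst (2) sum.swap)
         (simp add: sum_distrib_left[symmetric] power2_eq_square euclidean_inner[symmetric])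
    finally show ?thesis
      using n(1) C by (simp add: orthonormal_def norm_eq_1 power2_norm_eq_inner)
  qed
  have gexp: "gauss t = exp (- t\<^sup>2 / 2 - ln (sqrt (2 * pi)))" for t
    by (simp add: std_normal_density_def exp_diff)
  \<comment> \<open>Argument and exponent are matched so that the squared lengths cancel in the
    quadratic part, leaving \<open>lam i * (w i \<bullet> y)^2\<close>, to which the frame identity
    applies.\<close>
  have gauss_prod: "(\<Prod>i\<in>I. gauss ((w i \<bullet> y) / r i) powr (lam i * (r i)\<^sup>2)) * (\<Prod>c\<in>C. gauss (c \<bullet> y)) = (\<Prod>b\<in>Basis. gauss (y \<bullet> b))" for y
  proof -
    let ?k = "ln (sqrt (2 * pi))"
    have "(\<Prod>i\<in>I. gauss ((w i \<bullet> y) / r i) powr (lam i * (r i)\<^sup>2)) =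
        exp (\<Sum>i\<in>I. - (lam i * (w i \<bullet> y)\<^sup>2) / 2 - lam i * (r i)\<^sup>2 * ?k)"
      unfolding exp_sum[OF fin]
    proof (intro prod.cong refl)
      fix i assume "i \<in> I"
      then have "r i \<noteq> 0" using r by fastforce
      then have "lam i * (r i)\<^sup>2 * (- ((w i \<bullet> y) / r i)\<^sup>2 / 2 - ?k) = - (lam i * (w i \<bullet> y)\<^sup>2) / 2 - lam i * (r i)\<^sup>2 * ?k"
        by (simp add: right_diff_distrib power_divide)
      then show "gauss ((w i \<bullet> y) / r i) powr (lam i * (r i)\<^sup>2) = exp (- (lam i * (w i \<bullet> y)\<^sup>2) / 2 - lam i * (r i)\<^sup>2 * ?k)"
        unfolding gexp powr_def by (simp del: right_diff_distrib)
    qed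
    also have "(\<Sum>i\<in>I. - (lam i * (w i \<bullet> y)\<^sup>2) / 2 - lam i * (r i)\<^sup>2 * ?k) = - (\<Sum>i\<in>I. lam i * (w i \<bullet> y)\<^sup>2) / 2 - n * ?k"
      using n(1) by (simp add: sum_subtractf sum_negf sum_divide_distrib[symmetric] sum_distrib_right[symmetric] r_def)
    finally have 1: "(\<Prod>i\<in>I. gauss ((w i \<bullet> y) / r i) powr (lam i * (r i)\<^sup>2)) = exp (- (\<Sum>i\<in>I. lam i * (w i \<bullet> y)\<^sup>2) / 2 - n * ?k)" .
    have 2: "(\<Prod>c\<in>C. gauss (c \<bullet> y)) = exp (- (\<Sum>c\<in>C. (c \<bullet> y)\<^sup>2) / 2 - card C * ?k)"
      unfolding gexp exp_sum[OF finC, symmetric] by (simp add: sum_subtractf sum_negf sum_divide_distrib[symmetric])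
    have 3: "(\<Prod>b\<in>Basis. gauss (y \<bullet> b)) = exp (- (y \<bullet> y) / 2 - DIM('a) * ?k)"
      unfolding gexp exp_sum[OF finite_Basis, symmetric]
      by (simp add: sum_subtractf sum_negf sum_divide_distrib[symmetric] euclidean_inner[of y y] power2_eq_square)
    show ?thesis
      unfolding 1 2 3 exp_add[symmetric] norms[of y, symmetric] trace[symmetric] by (simp add: field_simps)
  qed
  have "(\<integral>\<^sup>+y. ennreal (G y) \<partial>lborel) \<le> (\<integral>\<^sup>+x. ennreal (H x) \<partial>lborel)"
  proof (rule reverse_brascamp_lieb_transport[where I = "I <+> C" and lam = M and w = W and T = TT and T' = TT'])
    show "finite (I <+> C)" using fin finC by simp
    show "0 < M j" if "j \<in> I <+> C" for j using that lam by (auto simp: M_def)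
    show "(\<Sum>j\<in>I <+> C. (M j * (W j \<bullet> x)) *\<^sub>R W j) = x" for x
      using frame[of x] fin finC by (simp add: sum.Plus M_def W_def o_def)
    show "(TT j has_real_derivative TT' j t) (at t)" if j: "j \<in> I <+> C" for j t
    proof (cases j)
      case (Inl i)
      then have ri: "0 < r i" using j r by auto
      have "((\<lambda>t. (r i)\<^sup>2 * T (t / r i)) has_real_derivative (r i)\<^sup>2 * (T' (t / r i) * (1 / r i))) (at t)"
        using ri by (intro DERIV_cmult DERIV_chain2[of T, OF T]) (auto intro!: derivative_eq_intros)
      moreover have "(r i)\<^sup>2 * (T' (t / r i) * (1 / r i)) = r i * T' (t / r i)"
        using ri by (simp add: power2_eq_square)
      ultimately show ?thesis by (simp add: TT_def[abs_def] TT'_def Inl)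
    qed (auto simp: TT_def[abs_def] TT'_def)
    show "0 < TT' j t" if "j \<in> I <+> C" for j t using that r T' by (auto simp: TT'_def)
    show "G \<in> borel_measurable borel" unfolding G_def[abs_def] by measurable
    show "G y \<le> (\<Prod>j\<in>I <+> C. TT' j (W j \<bullet> y) powr (M j * (norm (W j))\<^sup>2)) *
        H (\<Sum>j\<in>I <+> C. (M j * TT j (W j \<bullet> y)) *\<^sub>R W j)" for y
    proof -
      define \<theta> where "\<theta> i = T ((w i \<bullet> y) / r i)" for i
      define x where "x = (\<Sum>j\<in>I <+> C. (M j * TT j (W j \<bullet> y)) *\<^sub>R W j)"
      define P where "P = (\<Prod>j\<in>I <+> C. TT' j (W j \<bullet> y) powr (M j * (norm (W j))\<^sup>2))"
      have x: "x = (\<Sum>i\<in>I. (lam i * (norm (w i))\<^sup>2 * \<theta> i) *\<^sub>R w i) + (\<Sum>c\<in>C. (c \<bullet> y) *\<^sub>R c)"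
        using fin finC by (simp add: x_def sum.Plus M_def W_def TT_def \<theta>_def r_def o_def mult.assoc)
      have P: "P = (\<Prod>i\<in>I. (r i * T' ((w i \<bullet> y) / r i)) powr (lam i * (r i)\<^sup>2))"
        using fin finC by (simp add: P_def prod.Plus M_def W_def TT'_def r_def o_def)
      have Ppos: "0 \<le> P" unfolding P by (intro prod_nonneg) simp
      have "G y = K * ((\<Prod>i\<in>I. gauss ((w i \<bullet> y) / r i) powr (lam i * (r i)\<^sup>2)) * (\<Prod>c\<in>C. gauss (c \<bullet> y)))"
        unfolding G_def gauss_prod ..
      also have "K = (\<Prod>i\<in>I. (\<kappa> * r i) powr (lam i * (r i)\<^sup>2))"
      proof -
        have "\<kappa> powr n = (\<Prod>i\<in>I. \<kappa> powr (lam i * (r i)\<^sup>2))"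
          using \<kappa> n(1) by (simp add: powr_sum[symmetric] fin r_def)
        then have "K = (\<Prod>i\<in>I. \<kappa> powr (lam i * (r i)\<^sup>2) * r i powr (lam i * (r i)\<^sup>2))"
          unfolding K_def prod.distrib by simp
        then show ?thesis using \<kappa> r by (simp add: powr_mult less_imp_le)
      qed
      also have "(\<Prod>i\<in>I. (\<kappa> * r i) powr (lam i * (r i)\<^sup>2)) * ((\<Prod>i\<in>I. gauss ((w i \<bullet> y) / r i) powr (lam i * (r i)\<^sup>2)) * (\<Prod>c\<in>C. gauss (c \<bullet> y)))
        = (\<Prod>i\<in>I. (r i * (\<kappa> * gauss ((w i \<bullet> y) / r i))) powr (lam i * (r i)\<^sup>2)) * (\<Prod>c\<in>C. gauss (c \<bullet> y))"
        unfolding mult.assoc[symmetric] prod.distrib[symmetric]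
        by (intro arg_cong2[of _ _ _ _ "(*)"] prod.cong refl, subst powr_mult[symmetric])
           (use r \<kappa> gauss_pos in \<open>auto simp: mult_ac less_imp_le\<close>)
      also have "(\<Prod>i\<in>I. (r i * (\<kappa> * gauss ((w i \<bullet> y) / r i))) powr (lam i * (r i)\<^sup>2)) =
          P * exp (- (\<Sum>i\<in>I. lam i * (norm (w i))\<^sup>2 * \<tau> (\<theta> i)))"
        unfolding P sum_negf[symmetric] exp_sum[OF fin] prod.distrib[symmetric]
      proof (intro prod.cong refl)
        fix i assume i: "i \<in> I"
        have "r i * (\<kappa> * gauss ((w i \<bullet> y) / r i)) = (r i * T' ((w i \<bullet> y) / r i)) * exp (- \<tau> (\<theta> i))"
          unfolding \<tau>[symmetric] \<theta>_def by simp
        then show "(r i * (\<kappa> * gauss ((w i \<bullet> y) / r i))) powr (lam i * (r i)\<^sup>2) =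
            (r i * T' ((w i \<bullet> y) / r i)) powr (lam i * (r i)\<^sup>2) * exp (- (lam i * (norm (w i))\<^sup>2 * \<tau> (\<theta> i)))"
          using r[OF i] less_imp_neq[OF r[OF i]] T' by (simp add: powr_mult less_imp_le) (simp add: powr_def r_def)
      qed
      also have "P * exp (- (\<Sum>i\<in>I. lam i * (norm (w i))\<^sup>2 * \<tau> (\<theta> i))) * (\<Prod>c\<in>C. gauss (c \<bullet> y)) \<le> P * H x"
        unfolding x mult.assoc[of P] by (intro mult_left_mono H Ppos) (auto simp: \<theta>_def)
      finally show ?thesis unfolding P_def x_def .
    qed
  qed (use H0 in auto)
  moreover have "(\<integral>\<^sup>+y. ennreal (G y) \<partial>lborel) = ennreal K"
  proof -
    have K0: "0 \<le> K" unfolding K_def by (intro mult_nonneg_nonneg prod_nonneg) auto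
    have "(\<integral>\<^sup>+y. ennreal (G y) \<partial>lborel) = (\<integral>\<^sup>+y. ennreal K * (\<Prod>b\<in>Basis. ennreal (gauss (y \<bullet> b))) \<partial>(lborel :: 'a measure))"
      unfolding G_def by (intro nn_integral_cong) (simp add: ennreal_mult K0 prod_nonneg prod_ennreal)
    also have "\<dots> = ennreal K * (\<integral>\<^sup>+y. (\<Prod>b\<in>Basis. ennreal (gauss (y \<bullet> b))) \<partial>(lborel :: 'a measure))"
      by (rule nn_integral_cmult) measurable
    also have "(\<integral>\<^sup>+y. (\<Prod>b\<in>Basis. ennreal (gauss (y \<bullet> b))) \<partial>(lborel :: 'a measure)) = 1"
      by (subst nn_integral_onbasis_prod[OF onbasis_Basis, of "\<lambda>b t. ennreal (gauss t)"]) (simp_all add: nn_integral_gauss)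
    finally show ?thesis by simp
  qed
  moreover have "\<kappa> powr n * (n / L) powr (n / 2) \<le> K"
  proof -
    \<comment> \<open>The convexity bound is used for squared lengths, since these are what sums to
      \<open>n\<close>; the square root afterwards halves the exponent.\<close>
    have "(n / L) powr n \<le> (\<Prod>i\<in>I. ((r i)\<^sup>2) powr (lam i * (r i)\<^sup>2))"
      using prod_powr_self_ge[OF fin lam, where x = "\<lambda>i. (r i)\<^sup>2" and n = n and L = L] r n L by (simp add: r_def less_imp_le)
    then have "((n / L) powr n) powr (1/2) \<le> (\<Prod>i\<in>I. ((r i)\<^sup>2) powr (lam i * (r i)\<^sup>2)) powr (1/2)"
      by (intro powr_mono2) auto
    also have "\<dots> = (\<Prod>i\<in>I. r i powr (lam i * (r i)\<^sup>2))"
    proof -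
      have "(\<Prod>i\<in>I. ((r i)\<^sup>2) powr (lam i * (r i)\<^sup>2)) = (\<Prod>i\<in>I. r i powr (lam i * (r i)\<^sup>2))\<^sup>2"
        unfolding prod_power_distrib
      proof (intro prod.cong refl)
        fix i assume "i \<in> I"
        from r[OF this] show "((r i)\<^sup>2) powr (lam i * (r i)\<^sup>2) = (r i powr (lam i * (r i)\<^sup>2))\<^sup>2"
          by (simp add: power2_eq_square powr_mult)
      qed
      then show ?thesis by (simp add: powr_half_sqrt prod_nonneg)
    qed
    finally show ?thesis unfolding K_def using \<kappa> by (simp add: powr_powr)
  qed
  ultimately show ?thesis by (metis ennreal_leI order_trans)
qed

subsection \<open>Transporting the Gaussian to exponential densities\<close>

text \<open>The standard normal distribution function, from which both transport maps are
  built.\<close>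

definition gcdf :: "real \<Rightarrow> real" where
  "gcdf t = (LINT u|lborel. indicator {..t} u * gauss u)"

lemma integrable_gauss: "integrable lborel gauss"
  by (rule integrable_normal_density) simp

lemma lborel_integral_gauss: "(LINT u|lborel. gauss u) = 1"
  using integral_std_normal_moment_even[of 0] by simp

lemma integrable_gauss_indicator: "A \<in> sets borel \<Longrightarrow> integrable lborel (\<lambda>u. indicator A u * gauss u)"
  using integrable_mult_indicator[OF _ integrable_gauss, of A] by simp

lemma gcdf_diff:
  assumes "a \<le> b" shows "gcdf b - gcdf a = integral {a..b} gauss"
proof -
  have "gcdf b - gcdf a = (LINT u|lborel. indicator {..b} u * gauss u - indicator {..a} u * gauss u)"
    unfolding gcdf_def by (subst Bochner_Integration.integral_diff) (auto intro!: integrable_gauss_indicator)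
  also have "\<dots> = (LINT u|lborel. indicator {a<..b} u * gauss u)"
    using assms by (intro Bochner_Integration.integral_cong) (auto simp: indicator_def)
  also have "\<dots> = (LINT u|lborel. indicator {a..b} u * gauss u)"
  proof (rule integral_cong_AE)
    show "AE u in lborel. indicator {a<..b} u * gauss u = indicator {a..b} u * gauss u"
      using AE_lborel_singleton[of a] by eventually_elim (auto simp: indicator_def)
  qed auto
  also have "\<dots> = integral {a..b} gauss"
    using set_borel_integral_eq_integral(2)[of "{a..b}" gauss] integrable_gauss_indicator[of "{a..b}"]
    by (simp add: set_lebesgue_integral_def set_integrable_def)
  finally show ?thesis .
qed

lemma DERIV_gcdf: "(gcdf has_real_derivative gauss t) (at t)"
proof -
  have cont: "continuous_on {t-1..t+1} gauss"
    unfolding std_normal_density_def[abs_def] by (intro continuous_intros) auto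
  have "((\<lambda>x. integral {t-1..x} gauss) has_real_derivative gauss t) (at t within {t-1..t+1})"
    using cont by (intro integral_has_real_derivative) auto
  then have "((\<lambda>x. integral {t-1..x} gauss) has_real_derivative gauss t) (at t)"
    by (simp add: at_within_Icc_at)
  then have "((\<lambda>x. gcdf (t-1) + integral {t-1..x} gauss) has_real_derivative gauss t) (at t)"
    by (auto intro!: derivative_eq_intros)
  moreover have "\<forall>\<^sub>F x in nhds t. gcdf x = gcdf (t-1) + integral {t-1..x} gauss"
  proof -
    have "\<forall>\<^sub>F x in nhds t. x \<in> {t-1<..}" by (intro eventually_nhds_in_open) auto
    then show ?thesis by eventually_elim (simp add: gcdf_diff[symmetric])
  qed
  ultimately show ?thesis
    by (subst DERIV_cong_ev[OF refl _ refl]) auto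
qed

lemma gcdf_strict_mono: "a < b \<Longrightarrow> gcdf a < gcdf b"
  using DERIV_pos_imp_increasing[of a b gcdf] DERIV_gcdf gauss_pos by blast

lemma gcdf_bounds: "0 < gcdf t" "gcdf t < 1"
proof -
  have 0: "0 \<le> gcdf u" for u unfolding gcdf_def by (intro integral_nonneg_AE) auto
  have 1: "gcdf u \<le> 1" for u
  proof -
    have "gcdf u \<le> (LINT u|lborel. gauss u)" unfolding gcdf_def
      by (intro integral_mono integrable_gauss integrable_gauss_indicator) (auto simp: indicator_def)
    then show ?thesis by (simp add: lborel_integral_gauss)
  qed
  show "0 < gcdf t" using 0[of "t - 1"] gcdf_strict_mono[of "t - 1" t] by simp
  show "gcdf t < 1" using 1[of "t + 1"] gcdf_strict_mono[of t "t + 1"] by simp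
qed

lemma gcdf_0: "gcdf 0 = 1 / 2"
proof -
  have "gcdf 0 = (LINT u|lborel. indicator {..0} (- u) * gauss (- u))"
    unfolding gcdf_def using lborel_integral_real_affine[of "-1" "\<lambda>u. indicator {..0} u * gauss u" 0] by simp
  also have "\<dots> = (LINT u|lborel. indicator {0..} u * gauss u)"
    by (intro Bochner_Integration.integral_cong) (auto simp: indicator_def std_normal_density_def)
  finally have "2 * gcdf 0 = (LINT u|lborel. indicator {..0} u * gauss u) + (LINT u|lborel. indicator {0..} u * gauss u)"
    unfolding gcdf_def by simp
  also have "\<dots> = (LINT u|lborel. indicator {..0} u * gauss u + indicator {0..} u * gauss u)"
    by (subst Bochner_Integration.integral_add) (auto intro!: integrable_gauss_indicator)
  also have "\<dots> = (LINT u|lborel. gauss u)"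
  proof (rule integral_cong_AE)
    show "AE u in lborel. indicator {..0} u * gauss u + indicator {0..} u * gauss u = gauss u"
      using AE_lborel_singleton[of 0] by eventually_elim (auto simp: indicator_def)
  qed auto
  finally show ?thesis by (simp add: lborel_integral_gauss)
qed

text \<open>\<open>T\<close> matches tails: \<open>exp (- T t) = 1 - gcdf t\<close>, so
  differentiating gives the density identity. Positivity of \<open>T\<close> is what later keeps
  transported points inside a cone.\<close>

lemma exponential_transport:
  obtains T T' :: "real \<Rightarrow> real" where "\<And>t. (T has_real_derivative T' t) (at t)" "\<And>t. 0 < T' t"
    "\<And>t. 0 < T t" "\<And>t. T' t * exp (- T t) = gauss t"
proof
  fix t
  let ?T = "\<lambda>t. - ln (1 - gcdf t)" and ?T' = "\<lambda>t. gauss t / (1 - gcdf t)"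
  have b: "0 < gcdf t" "gcdf t < 1" by (rule gcdf_bounds)+
  show "(?T has_real_derivative ?T' t) (at t)"
    using b by (auto intro!: derivative_eq_intros DERIV_gcdf simp: field_simps)
  show "0 < ?T' t" using b gauss_pos[of t] by simp
  show "0 < ?T t" using b by simp
  show "?T' t * exp (- ?T t) = gauss t" using b by simp
qed

text \<open>Tails are matched with those of the probability density
  \<open>exp (- \<bar>t\<bar>) / 2\<close>, separately on the two half-lines; the normalisation
  produces the factor 2.\<close>

lemma laplace_transport:
  obtains T T' :: "real \<Rightarrow> real" where "\<And>t. (T has_real_derivative T' t) (at t)" "\<And>t. 0 < T' t"
    "\<And>t. T' t * exp (- \<bar>T t\<bar>) = 2 * gauss t"
proof
  define T where "T t = (if t \<in> {0..} then - ln (2 * (1 - gcdf t)) else ln (2 * gcdf t))" for t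
  define T' where "T' t = (if t \<in> {0..} then gauss t / (1 - gcdf t) else gauss t / gcdf t)" for t
  fix t
  have b: "0 < gcdf t" "gcdf t < 1" by (rule gcdf_bounds)+
  have d1: "((\<lambda>t. - ln (2 * (1 - gcdf t))) has_real_derivative gauss t / (1 - gcdf t)) (at t within S)" for S
    using b by (auto intro!: derivative_eq_intros DERIV_subset[OF DERIV_gcdf] simp: field_simps)
  have d2: "((\<lambda>t. ln (2 * gcdf t)) has_real_derivative gauss t / gcdf t) (at t within S)" for S
    using b by (auto intro!: derivative_eq_intros DERIV_subset[OF DERIV_gcdf] simp: field_simps)
  have cl: "closure {..<0::real} = {..0}" "closure {0::real..} = {0..}"
    by (simp_all add: closure_closed)
  \<comment> \<open>The branches fit at 0 because \<open>gcdf 0 = 1 / 2\<close>: both values are 0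
    and both derivatives are \<open>2 * gauss 0\<close>.\<close>
  have "((\<lambda>t. if t \<in> {0..} then - ln (2 * (1 - gcdf t)) else ln (2 * gcdf t)) has_derivative
      (if t \<in> {0..} then (*) (gauss t / (1 - gcdf t)) else (*) (gauss t / gcdf t))) (at t within {0..} \<union> {..<0})"
    by (rule has_derivative_If_within_closures[where f' = "\<lambda>t. (*) (gauss t / (1 - gcdf t))" and g' = "\<lambda>t. (*) (gauss t / gcdf t)"])
       (use d1 d2 in \<open>auto simp: has_field_derivative_def cl gcdf_0\<close>)
  moreover have "{0..} \<union> {..<0} = (UNIV :: real set)" by auto
  ultimately show "(T has_real_derivative T' t) (at t)"
    unfolding has_field_derivative_def T_def[abs_def] T'_def by (simp split: if_splits)
  show "0 < T' t" using b gauss_pos[of t] by (simp add: T'_def)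
  have half: "0 \<le> t \<Longrightarrow> 1 / 2 \<le> gcdf t" "t < 0 \<Longrightarrow> gcdf t < 1 / 2"
    using gcdf_0 gcdf_strict_mono[of 0 t] gcdf_strict_mono[of t 0] by (cases "t = 0"; simp)+
  show "T' t * exp (- \<bar>T t\<bar>) = 2 * gauss t"
  proof (cases "0 \<le> t")
    case True
    then have "T t \<ge> 0" using half b by (simp add: T_def)
    then show ?thesis using True b by (simp add: T_def T'_def field_simps)
  next
    case False
    then have "T t \<le> 0" using half b by (simp add: T_def)
    then show ?thesis using False b by (simp add: T_def T'_def)
  qed
qed

subsection \<open>Decomposition of the identity in Loewner position\<close>

lemma orth_proj_unique:
  assumes "subspace F" "y \<in> F" "\<And>z. z \<in> F \<Longrightarrow> (x - y) \<bullet> z = 0"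
  shows "orth_proj F x = y"
  unfolding orth_proj_def
proof (rule the_equality)
  fix y' assume y': "y' \<in> F \<and> (\<forall>z\<in>F. (x - y') \<bullet> z = 0)"
  have "y' - y \<in> F" using y' assms(1,2) by (simp add: subspace_diff)
  then have "(x - y) \<bullet> (y' - y) - (x - y') \<bullet> (y' - y) = 0" using assms(3) y' by simp
  then have "(y' - y) \<bullet> (y' - y) = 0" by (simp add: inner_diff_left)
  then show "y' = y" by simp
qed (use assms in auto)

lemma orth_proj:
  assumes "subspace F"
  shows orth_proj_in: "orth_proj F x \<in> F"
    and orth_proj_orthogonal: "z \<in> F \<Longrightarrow> (x - orth_proj F x) \<bullet> z = 0"
proof -
  obtain y w where yw: "y \<in> span F" "\<And>w'. w' \<in> span F \<Longrightarrow> orthogonal w w'" "x = y + w"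
    using orthogonal_subspace_decomp_exists[of F x] by metis
  have sp: "span F = F" using assms by simp
  have "orth_proj F x = y"
    using assms yw by (intro orth_proj_unique) (auto simp: sp orthogonal_def)
  then show "orth_proj F x \<in> F" "z \<in> F \<Longrightarrow> (x - orth_proj F x) \<bullet> z = 0"
    using yw unfolding sp by (auto simp: orthogonal_def)
qed

lemma linear_orth_proj:
  assumes "subspace F"
  shows "linear (orth_proj F)"
proof (rule linearI)
  note P = orth_proj[OF assms]
  show "orth_proj F (x + y) = orth_proj F x + orth_proj F y" for x y
  proof (rule orth_proj_unique[OF assms])
    fix z assume "z \<in> F"
    then have "(x - orth_proj F x) \<bullet> z + (y - orth_proj F y) \<bullet> z = 0" by (simp add: P)
    then show "(x + y - (orth_proj F x + orth_proj F y)) \<bullet> z = 0" by (simp add: inner_simps)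
  qed (simp add: P subspace_add assms)
  show "orth_proj F (c *\<^sub>R x) = c *\<^sub>R orth_proj F x" for c x
  proof (rule orth_proj_unique[OF assms])
    fix z assume "z \<in> F"
    then have "c * ((x - orth_proj F x) \<bullet> z) = 0" by (simp add: P)
    then show "(c *\<^sub>R x - c *\<^sub>R orth_proj F x) \<bullet> z = 0" by (simp add: inner_simps right_diff_distrib)
  qed (simp add: P subspace_scale assms)
qed

lemma orth_proj_inner:
  assumes "subspace F"
  shows "orth_proj F x \<bullet> y = orth_proj F x \<bullet> orth_proj F y"
  using orth_proj_orthogonal[OF assms orth_proj_in[OF assms, of x], of y]
  by (simp add: inner_diff_left inner_commute[of "orth_proj F x"])

lemma orth_proj_self_adjoint:
  "subspace F \<Longrightarrow> orth_proj F x \<bullet> y = x \<bullet> orth_proj F y"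
  using orth_proj_inner[of F x y] orth_proj_inner[of F y x] by (simp add: inner_commute)

lemma orth_proj_id: "subspace F \<Longrightarrow> x \<in> F \<Longrightarrow> orth_proj F x = x"
  by (rule orth_proj_unique) auto

lemma orth_proj_comp_eq_0:
  assumes "subspace F" "x \<in> orthogonal_comp F" shows "orth_proj F x = 0"
  using assms subspace_0 by (intro orth_proj_unique) (auto simp: orthogonal_comp_def orthogonal_def inner_commute)

lemma orth_proj_orthogonal_comp:
  assumes "subspace F"
  shows "orth_proj (orthogonal_comp F) x = x - orth_proj F x"
proof (rule orth_proj_unique[OF subspace_orthogonal_comp])
  show "x - orth_proj F x \<in> orthogonal_comp F"
    using orth_proj_orthogonal[OF assms] by (auto simp: orthogonal_comp_def orthogonal_def inner_commute)
  show "(x - (x - orth_proj F x)) \<bullet> z = 0" if "z \<in> orthogonal_comp F" for z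
    using that orth_proj_in[OF assms, of x] by (auto simp: orthogonal_comp_def orthogonal_def)
qed

lemma norm_orth_proj_le: "subspace F \<Longrightarrow> norm (orth_proj F x) \<le> norm x"
proof -
  assume F: "subspace F"
  have "(norm (orth_proj F x))\<^sup>2 = orth_proj F x \<bullet> x"
    using orth_proj_inner[OF F, of x x] by (simp add: power2_norm_eq_inner)
  also have "\<dots> \<le> norm (orth_proj F x) * norm x" by (rule norm_cauchy_schwarz)
  finally show ?thesis by (cases "orth_proj F x = 0") (simp_all add: power2_eq_square)
qed

section \<open>First-order optimality and the decomposition of the projection\<close>

lemma eventually_at_right_0_mult_less:
  fixes a b :: real assumes "0 < b" shows "\<forall>\<^sub>F h in at_right 0. h * a < b"
proof -
  have "((\<lambda>h. h * a) \<longlongrightarrow> 0 * a) (at_right 0)" by (intro tendsto_intros)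
  then show ?thesis using assms by (auto dest: order_tendstoD(2))
qed

lemma measure_convex_body_pos:
  assumes "convex_body K" shows "0 < measure lebesgue K"
proof -
  obtain x r where r: "0 < r" "cball x r \<subseteq> interior K"
    using assms open_contains_cball[of "interior K"] unfolding convex_body_def by blast
  have "0 < measure lebesgue (cball x r)" using r(1) content_cball_pos[of r x] by simp
  also have "\<dots> \<le> measure lebesgue K"
    using r(2) assms interior_subset[of K]
    by (intro measure_mono_fmeasurable) (auto simp: convex_body_def intro: lmeasurable_compact)
  finally show ?thesis .
qed

text \<open>First-order optimality: moving along \<open>x \<mapsto> x + h (c x - G x - z)\<close> pulls all contact points inside
  the ball at linear speed, while the volume changes only to second order since \<open>c\<close> is the mean
  of the eigenvalues of \<open>G\<close>; rescaling then contradicts maximality.\<close>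

lemma loewner_position_no_descent:
  fixes K F :: "'a::euclidean_space set" and c :: real and m :: "'a \<Rightarrow> real"
  assumes K: "convex_body K" and F: "subspace F" and pos: "loewner_position_axis F K"
    and lin: "linear G" and GF: "\<And>x. G x \<in> F" and G0: "\<And>x. x \<in> orthogonal_comp F \<Longrightarrow> G x = 0"
    and S: "onbasis S" and eig: "\<And>e. e \<in> S \<Longrightarrow> G e = m e *\<^sub>R e"
    and c: "c * DIM('a) = sum m S" and \<delta>: "0 < \<delta>"
    and contact: "\<And>u. u \<in> K \<Longrightarrow> norm u = 1 \<Longrightarrow> \<delta> \<le> G u \<bullet> u + z \<bullet> u - c"
  shows False
proof -
  have compK: "compact K" using K by (simp add: convex_body_def)
  have KB: "norm x \<le> 1" if "x \<in> K" for x using pos that by (auto simp: loewner_position_axis_def)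
  have finS: "finite S" using S orthonormal_finite by (auto simp: onbasis_def)
  define N where "N x = c *\<^sub>R x - G x - z" for x
  have contG: "continuous_on A G" for A using lin by (intro linear_continuous_on) (simp add: linear_linear)
  have contN: "continuous_on A N" for A unfolding N_def by (intro continuous_intros contG)
  have "bounded (N ` K)" using compact_continuous_image[OF contN compK] compact_imp_bounded by blast
  then obtain R where R: "1 \<le> R" "\<And>x. x \<in> K \<Longrightarrow> norm (N x) \<le> R"
    unfolding bounded_iff by (metis dual_order.trans imageI linear order_refl)
  have NR: "N x \<bullet> x \<le> R" if "x \<in> K" for x
  proof -
    have "N x \<bullet> x \<le> norm (N x) * norm x" by (rule norm_cauchy_schwarz)
    also have "\<dots> \<le> R * 1" using R that KB by (intro mult_mono) auto
    finally show ?thesis by simp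
  qed
  \<comment> \<open>Where \<open>N x \<bullet> x\<close> is at most \<open>- \<delta> / 2\<close>
    the motion is inward. The remaining points lie in a compact set without contact points, hence at
    a positive distance from the sphere, and tolerate any small motion.\<close>
  obtain q where q: "q < 1" "\<And>x. x \<in> K \<Longrightarrow> - \<delta> / 2 < N x \<bullet> x \<Longrightarrow> (norm x)\<^sup>2 \<le> q"
  proof -
    let ?K' = "K \<inter> {x. - \<delta> / 2 \<le> N x \<bullet> x}"
    have cl: "closed {x. - \<delta> / 2 \<le> N x \<bullet> x}"
      by (intro closed_Collect_le continuous_intros contN)
    have cK': "compact ?K'" using compK cl by (rule compact_Int_closed)
    have lt: "norm x < 1" if "x \<in> ?K'" for x
    proof (rule ccontr)
      assume "\<not> norm x < 1"
      then have 1: "norm x = 1" using that KB by force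
      then have "N x \<bullet> x \<le> - \<delta>"
        using contact[of x] that by (simp add: N_def inner_diff_left power2_norm_eq_inner[symmetric])
      then show False using that \<delta> by auto
    qed
    show ?thesis
    proof (cases "?K' = {}")
      case True
      then show ?thesis using that[of 0] by (force simp: less_imp_le)
    next
      case False
      then obtain x0 where x0: "x0 \<in> ?K'" "\<And>x. x \<in> ?K' \<Longrightarrow> norm x \<le> norm x0"
        using continuous_attains_sup[OF cK', of norm] continuous_on_norm_id by blast
      have "(norm x0)\<^sup>2 < 1" using lt[OF x0(1)] by (simp add: power_less_one_iff)
      moreover have "(norm x)\<^sup>2 \<le> (norm x0)\<^sup>2" if "x \<in> K" "- \<delta> / 2 < N x \<bullet> x" for x
        using x0(2)[of x] that by (intro power_mono) auto
      ultimately show ?thesis by (rule that)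
    qed
  qed
  \<comment> \<open>These are the eigenvalues of the perturbation \<open>c x - G x\<close>; they sum
    to zero by the choice of \<open>c\<close>.\<close>
  define \<nu> where "\<nu> e = c - m e" for e
  define V where "V = (\<Sum>e\<in>S. (\<nu> e)\<^sup>2)"
  have \<nu>0: "sum \<nu> S = 0" 
  proof -
    have "sum \<nu> S = real (card S) * c - sum m S" unfolding \<nu>_def sum_subtractf by simp
    then show ?thesis using c onbasis_card[OF S] by (simp add: mult.commute)
  qed
  \<comment> \<open>The conditions with \<open>R\<close> and \<open>q\<close> keep the moved points
    within squared norm \<open>s\<close> in the two cases above;
    \<open>h * (\<delta> / 2) < 1\<close> makes \<open>s\<close> positive; the one with
    \<open>V\<close> makes the volume gain win; those with \<open>c\<close> and \<open>\<nu>\<close>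
    keep the operator invertible.\<close>
  have "\<forall>\<^sub>F h in at_right 0. 0 < h \<and> h * 1 < 1 \<and> h * \<bar>c\<bar> < 1 \<and> h * R\<^sup>2 < \<delta> / 2 \<and> h * (2 * R + R\<^sup>2 + \<delta> / 2) < 1 - q
    \<and> h * (\<delta> / 2) < 1 \<and> h * (2 * V) < DIM('a) * (\<delta> / 4) \<and> (\<forall>e\<in>S. h * \<bar>\<nu> e\<bar> < 1 / 2)"
    using q(1) \<delta> finS
    by (intro eventually_conj eventually_at_right_0_mult_less eventually_at_right_less eventually_ball_finite ballI) auto
  from eventually_happens'[OF trivial_limit_at_right_real this]
  obtain h where h: "0 < h" "h < 1" "h * \<bar>c\<bar> < 1" "h * R\<^sup>2 < \<delta> / 2" "h * (2 * R + R\<^sup>2 + \<delta> / 2) < 1 - q"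
    "h * (\<delta> / 2) < 1" "h * (2 * V) < DIM('a) * (\<delta> / 4)" and h\<nu>: "\<forall>e\<in>S. h * \<bar>\<nu> e\<bar> < 1 / 2"
    unfolding mult_1_right by blast
  \<comment> \<open>All moved points have squared norm at most \<open>s < 1\<close>, so dilating by
    \<open>\<rho> = 1 / sqrt s\<close> stays in the unit ball and gains volume at first order in
    \<open>h\<close>.\<close>
  define s where "s = 1 - h * (\<delta> / 2)"
  have s: "0 < s" "s < 1" using h \<delta> by (auto simp: s_def)
  define \<rho> where "\<rho> = 1 / sqrt s"
  have \<rho>: "0 < \<rho>" using s by (simp add: \<rho>_def)
  define A where "A x = \<rho> *\<^sub>R ((1 + h * c) *\<^sub>R x - h *\<^sub>R G x)" for x
  have linA: "linear A"
    using lin by (intro linearI) (auto simp: A_def linear_add linear_scale algebra_simps)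
  have eigA: "A e = (\<rho> * (1 + h * \<nu> e)) *\<^sub>R e" if "e \<in> S" for e
    using eig[OF that] by (simp add: A_def \<nu>_def algebra_simps)
  have bound: "(norm (x + h *\<^sub>R N x))\<^sup>2 \<le> s" if x: "x \<in> K" for x
  proof -
    have eq: "(norm (x + h *\<^sub>R N x))\<^sup>2 = (norm x)\<^sup>2 + 2 * h * (N x \<bullet> x) + h\<^sup>2 * (norm (N x))\<^sup>2"
      unfolding power2_norm_eq_inner by (simp add: inner_add inner_commute power2_eq_square algebra_simps)
    have "(norm (N x))\<^sup>2 \<le> R\<^sup>2" using R(2)[OF x] by (intro power_mono) auto
    then have N2: "h\<^sup>2 * (norm (N x))\<^sup>2 \<le> h\<^sup>2 * R\<^sup>2" by (intro mult_left_mono) auto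
    have x1: "(norm x)\<^sup>2 \<le> 1" using KB[OF x] by (simp add: power_le_one)
    show ?thesis
    proof (cases "- \<delta> / 2 < N x \<bullet> x")
      case True
      have "2 * h * (N x \<bullet> x) \<le> 2 * h * R" using NR[OF x] h(1) by (intro mult_left_mono) auto
      moreover have "h\<^sup>2 * R\<^sup>2 \<le> h * R\<^sup>2" using h(1,2) by (intro mult_right_mono) (auto simp: power2_eq_square)
      ultimately show ?thesis
        using eq N2 q(2)[OF x True] h(5) by (simp add: s_def algebra_simps)
    next
      case False
      have "2 * h * (N x \<bullet> x) \<le> 2 * h * (- \<delta> / 2)" using False h(1) by (intro mult_left_mono) auto
      moreover have "h\<^sup>2 * R\<^sup>2 \<le> h * (\<delta> / 2)"
        using mult_left_mono[OF less_imp_le[OF h(4)], of h] h(1) by (simp add: power2_eq_square mult.assoc)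
      ultimately show ?thesis using eq N2 x1 by (simp add: s_def algebra_simps)
    qed
  qed
  define L where "L = (\<lambda>x. A x + (- (\<rho> * h) *\<^sub>R z)) ` K"
  have "L \<subseteq> cball 0 1"
  proof (clarsimp simp: L_def)
    fix x assume x: "x \<in> K"
    have "A x - (\<rho> * h) *\<^sub>R z = \<rho> *\<^sub>R (x + h *\<^sub>R N x)" by (simp add: A_def N_def algebra_simps)
    then have "norm (A x - (\<rho> * h) *\<^sub>R z) = \<rho> * norm (x + h *\<^sub>R N x)" using \<rho> by simp
    also have "\<dots> \<le> \<rho> * sqrt s" using real_le_rsqrt[OF bound[OF x]] \<rho> by (intro mult_left_mono) auto
    also have "\<dots> = 1" using s by (simp add: \<rho>_def)
    finally show "norm (A x - (\<rho> * h) *\<^sub>R z) \<le> 1" .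
  qed
  moreover have "F_operator F A"
    unfolding F_operator_def
  proof (intro conjI linA)
    have evpos: "0 < \<rho> * (1 + h * \<nu> e)" if "e \<in> S" for e
    proof -
      have "- (h * \<nu> e) \<le> h * \<bar>\<nu> e\<bar>" using h(1) abs_ge_minus_self[of "h * \<nu> e"] by (simp add: abs_mult)
      then show ?thesis using bspec[OF h\<nu> that] \<rho> by (intro mult_pos_pos) auto
    qed
    have "inj A"
    proof (subst linear_injective_0[OF linA], intro allI impI)
      fix x assume "A x = 0"
      have "A x = (\<Sum>e\<in>S. (x \<bullet> e) *\<^sub>R A e)"
      proof -
        have "A x = A (\<Sum>e\<in>S. (x \<bullet> e) *\<^sub>R e)" by (simp only: onbasis_expand[OF S])
        then show ?thesis by (simp only: linear_sum[OF linA] linear_scale[OF linA])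
      qed
      also have "\<dots> = (\<Sum>e\<in>S. ((x \<bullet> e) * (\<rho> * (1 + h * \<nu> e))) *\<^sub>R e)" by (intro sum.cong) (auto simp: eigA)
      finally have 0: "(\<Sum>e\<in>S. ((x \<bullet> e) * (\<rho> * (1 + h * \<nu> e))) *\<^sub>R e) = 0" using \<open>A x = 0\<close> by simp
      have "independent S" using S orthonormal_independent by (auto simp: onbasis_def)
      then have "\<forall>e\<in>S. (x \<bullet> e) * (\<rho> * (1 + h * \<nu> e)) = 0"
        using independentD[OF _ finS subset_refl 0] by blast
      then have "\<forall>e\<in>S. x \<bullet> e = 0" using evpos by force
      then show "x = 0" using onbasis_expand[OF S, of x] by simp
    qed
    then show "bij A" using linear_injective_imp_surjective[OF linA] by (simp add: bij_def)
    show "A ` F \<subseteq> F" using F GF by (auto simp: A_def subspace_scale subspace_diff)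
    have AF: "A x = (\<rho> * (1 + h * c)) *\<^sub>R x" if "x \<in> orthogonal_comp F" for x
      using G0[OF that] by (simp add: A_def)
    then show "A ` orthogonal_comp F \<subseteq> orthogonal_comp F"
      using subspace_orthogonal_comp[of F] by (auto simp: subspace_scale)
    have "- (h * c) \<le> h * \<bar>c\<bar>" using h(1) abs_ge_minus_self[of "h * c"] by (simp add: abs_mult)
    then have "\<rho> * (1 + h * c) \<noteq> 0" using h(3) \<rho> by auto
    then show "\<exists>c. c \<noteq> 0 \<and> (\<forall>x\<in>orthogonal_comp F. A x = c *\<^sub>R x)" using AF by blast
  qed
  then have "L \<in> A_family F K" unfolding A_family_def L_def by blast
  ultimately have "measure lebesgue L \<le> measure lebesgue K"
    using pos by (auto simp: loewner_position_axis_def)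
  moreover have "measure lebesgue L = \<bar>ldet A\<bar> * measure lebesgue K"
  proof -
    have "L = (+) (- (\<rho> * h) *\<^sub>R z) ` A ` K" by (auto simp: L_def image_image add.commute)
    then have "measure lebesgue L = measure lebesgue (A ` K)" by (simp only: measure_translation)
    then show ?thesis using measure_linear_image_ldet[OF linA compK] by simp
  qed
  moreover have "1 < ldet A"
  proof -
    \<comment> \<open>Each eigenvalue is bounded by \<open>ln \<rho> \<ge> h * \<delta> / 4\<close>
      and \<open>ln (1 + x) \<ge> x - 2 * x^2\<close>. In the sum of exponents the linear terms
      cancel, and the loss \<open>2 * h^2 * V\<close> is below the gain
      \<open>DIM('a) * h * \<delta> / 4\<close>.\<close>
    have "(\<Prod>e\<in>S. exp (h * \<delta> / 4 + (h * \<nu> e - 2 * (h * \<nu> e)\<^sup>2))) \<le> (\<Prod>e\<in>S. \<rho> * (1 + h * \<nu> e))"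
    proof (intro prod_mono conjI)
      fix e assume e: "e \<in> S"
      have ab: "\<bar>h * \<nu> e\<bar> \<le> 1 / 2" using bspec[OF h\<nu> e] h(1) by (simp add: abs_mult)
      then have "h * \<nu> e - 2 * (h * \<nu> e)\<^sup>2 \<le> ln (1 + h * \<nu> e)"
        using abs_ln_one_plus_x_minus_x_bound[OF ab] by linarith
      moreover have pos1: "0 < 1 + h * \<nu> e" using ab by linarith
      ultimately have 1: "exp (h * \<nu> e - 2 * (h * \<nu> e)\<^sup>2) \<le> 1 + h * \<nu> e"
        by (simp add: ln_ge_iff)
      have "ln s \<le> - (h * (\<delta> / 2))" using ln_le_minus_one[OF s(1)] by (simp add: s_def)
      then have "h * \<delta> / 4 \<le> ln \<rho>" using s by (simp add: \<rho>_def ln_div ln_sqrt)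
      then have "exp (h * \<delta> / 4) \<le> \<rho>" by (rule iffD1[OF ln_ge_iff[OF \<rho>]])
      then show "exp (h * \<delta> / 4 + (h * \<nu> e - 2 * (h * \<nu> e)\<^sup>2)) \<le> \<rho> * (1 + h * \<nu> e)"
        unfolding exp_add using 1 \<rho> by (intro mult_mono) auto
    qed (rule exp_ge_zero)
    also have "\<dots> = ldet A" by (rule ldet_eigenbasis[OF linA S eigA, symmetric])
    also have "(\<Prod>e\<in>S. exp (h * \<delta> / 4 + (h * \<nu> e - 2 * (h * \<nu> e)\<^sup>2))) =
        exp (h * (DIM('a) * (\<delta> / 4) - h * (2 * V)))"
      unfolding exp_sum[OF finS, symmetric]
      using \<nu>0 onbasis_card[OF S]
      by (simp add: sum.distrib sum_subtractf sum_distrib_left[symmetric] V_def power_mult_distrib)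
         (simp add: power2_eq_square algebra_simps)
    finally have "exp (h * (DIM('a) * (\<delta> / 4) - h * (2 * V))) \<le> ldet A" .
    moreover have "1 < exp (h * (DIM('a) * (\<delta> / 4) - h * (2 * V)))"
      unfolding one_less_exp_iff by (rule mult_pos_pos[OF h(1)]) (use h(7) in linarith)
    ultimately show ?thesis by linarith
  qed
  ultimately have "1 * measure lebesgue K < measure lebesgue K"
    using mult_strict_right_mono[OF _ measure_convex_body_pos[OF K], of 1 "\<bar>ldet A\<bar>"] by linarith
  then show False by simp
qed

text \<open>Both identities say that one point lies in the convex hull of the points
  \<open>q u\<close> over contact points \<open>u\<close>. Otherwise a hyperplane separates it
  strictly from the compact hull, and the normal vector provides an operator and a translation that
  \<open>loewner_position_no_descent\<close> excludes.\<close>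

lemma loewner_position_decomposition:
  fixes K F :: "'a::euclidean_space set"
  assumes K: "convex_body K" and F: "subspace F" and pos: "loewner_position_axis F K"
  obtains U and lam :: "'a \<Rightarrow> real" where "finite U" "U \<subseteq> K" "\<And>u. u \<in> U \<Longrightarrow> norm u = 1" "\<And>u. u \<in> U \<Longrightarrow> 0 < lam u"
    "sum lam U = DIM('a)" "(\<Sum>u\<in>U. lam u *\<^sub>R u) = 0"
    "\<And>x. (\<Sum>u\<in>U. (lam u * (orth_proj F u \<bullet> x)) *\<^sub>R orth_proj F u) = orth_proj F x"
proof -
  let ?P = "orth_proj F"
  define K0 where "K0 = K \<inter> sphere 0 1"
  have compK0: "compact K0" using K by (simp add: K0_def convex_body_def compact_Int)
  have contP: "continuous_on A ?P" for A
    using linear_orth_proj[OF F] by (intro linear_continuous_on) (simp add: linear_linear)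
  \<comment> \<open>The pair of the rank-one matrix of \<open>?P u\<close>, stored row by row, and
    the vector \<open>u\<close> itself.\<close>
  define q :: "'a \<Rightarrow> ('a ^ 'a bidx) \<times> 'a" where "q u = (\<chi> i. (?P u \<bullet> Rep_bidx i) *\<^sub>R ?P u, u)" for u
  have contq: "continuous_on A q" for A
    unfolding q_def by (intro continuous_intros continuous_on_vec_lambda contP)
  let ?H = "convex hull (q ` K0)"
  have compH: "compact ?H" by (intro compact_convex_hull compact_continuous_image contq compK0)
  \<comment> \<open>Hull coefficients sum to 1 while the weights must sum to the dimension, so the
    target is the projection divided by \<open>DIM('a)\<close>, paired with 0.\<close>
  define tgt :: "('a ^ 'a bidx) \<times> 'a" where "tgt = (\<chi> i. (1 / DIM('a)) *\<^sub>R ?P (Rep_bidx i), 0)"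
  have "tgt \<in> ?H"
  proof (rule ccontr)
    assume "tgt \<notin> ?H"
    then obtain a b where ab: "inner a tgt < b" "\<And>w. w \<in> ?H \<Longrightarrow> b < inner a w"
      using separating_hyperplane_closed_point[OF convex_convex_hull compact_imp_closed[OF compH]] by blast
    define T where "T p = (\<Sum>i\<in>UNIV. (p \<bullet> Rep_bidx i) *\<^sub>R (fst a $ i))" for p
    have linT: "linear T"
      by (rule linearI) (auto simp: T_def inner_add_left scaleR_add_left sum.distrib scaleR_sum_right)
    have aq: "inner a (q u) = T (?P u) \<bullet> ?P u + snd a \<bullet> u" for u
      by (simp add: inner_prod_def q_def inner_vec_def T_def inner_sum_left)
    \<comment> \<open>Symmetric part of \<open>T\<close>, compressed to \<open>F\<close>: it has the
      same quadratic form at each \<open>?P u\<close>, and it is self-adjoint and zero on the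
      complement, as the perturbation argument demands.\<close>
    define G where "G x = ?P ((1/2) *\<^sub>R (T (?P x) + adjoint T (?P x)))" for x
    have linG: "linear G"
      unfolding G_def using linear_orth_proj[OF F] linT adjoint_linear[OF linT]
      by (intro linearI) (auto simp: linear_add linear_scale algebra_simps)
    have Gxy: "G x \<bullet> y = (T (?P x) \<bullet> ?P y + ?P x \<bullet> T (?P y)) / 2" for x y
    proof -
      have "G x \<bullet> y = ((1/2) *\<^sub>R (T (?P x) + adjoint T (?P x))) \<bullet> ?P y"
        unfolding G_def by (rule orth_proj_self_adjoint[OF F])
      also have "\<dots> = (T (?P x) \<bullet> ?P y + ?P y \<bullet> adjoint T (?P x)) / 2"
        by (simp add: inner_add_left inner_commute[of "adjoint T (?P x)"])
      also have "?P y \<bullet> adjoint T (?P x) = ?P x \<bullet> T (?P y)"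
        using adjoint_works[OF linT, of "?P y" "?P x"] by (simp add: inner_commute)
      finally show ?thesis .
    qed
    have sa: "G x \<bullet> y = x \<bullet> G y" for x y
      using Gxy[of x y] Gxy[of y x] by (simp add: inner_commute add.commute)
    obtain S m where S: "onbasis S" and eig: "\<And>e. e \<in> S \<Longrightarrow> G e = m e *\<^sub>R e"
      using self_adjoint_eigenbasis[OF linG sa] by blast
    \<comment> \<open>The trace of \<open>G\<close> is \<open>DIM('a)\<close> times the value of the
      functional at \<open>tgt\<close>. Hence \<open>inner a tgt\<close> is exactly the mean
      eigenvalue, and strict separation is the strict contact inequality.\<close>
    have "sum m S = (\<Sum>e\<in>S. G e \<bullet> e)"
      using S eig by (intro sum.cong) (auto simp: onbasis_def orthonormal_def norm_eq_1)
    also have "\<dots> = (\<Sum>e\<in>S. \<Sum>i\<in>UNIV. (?P (Rep_bidx i) \<bullet> e) * (?P (fst a $ i) \<bullet> e))"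
    proof (intro sum.cong refl)
      fix e
      have "G e \<bullet> e = T (?P e) \<bullet> ?P e" using Gxy[of e e] by (simp add: inner_commute)
      also have "\<dots> = (\<Sum>i\<in>UNIV. (?P (Rep_bidx i) \<bullet> e) * (?P (fst a $ i) \<bullet> e))"
        unfolding T_def inner_sum_left
        by (intro sum.cong refl) (simp add: orth_proj_self_adjoint[OF F, of _ e] inner_commute[of "?P e"])
      finally show "G e \<bullet> e = (\<Sum>i\<in>UNIV. (?P (Rep_bidx i) \<bullet> e) * (?P (fst a $ i) \<bullet> e))" .
    qed
    also have "\<dots> = (\<Sum>i\<in>UNIV. ?P (Rep_bidx i) \<bullet> ?P (fst a $ i))"
      by (subst sum.swap) (simp add: onbasis_parseval[OF S])
    also have "\<dots> = (\<Sum>i\<in>UNIV. fst a $ i \<bullet> ?P (Rep_bidx i))"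
      by (simp add: orth_proj_inner[OF F, symmetric] inner_commute)
    also have "\<dots> = inner a tgt * DIM('a)"
      by (simp add: inner_prod_def tgt_def inner_vec_def sum_divide_distrib[symmetric])
    finally have tr: "inner a tgt * DIM('a) = sum m S" ..
    show False
    proof (rule loewner_position_no_descent[OF K F pos linG _ _ S eig tr])
      show "0 < b - inner a tgt" using ab by simp
      show "b - inner a tgt \<le> G u \<bullet> u + snd a \<bullet> u - inner a tgt" if "u \<in> K" "norm u = 1" for u
      proof -
        have "q u \<in> ?H" using that by (intro hull_inc) (auto simp: K0_def)
        then have "b < inner a (q u)" by (rule ab)
        then show ?thesis unfolding aq using Gxy[of u u] by (simp add: inner_commute)
      qed
      show "G x \<in> F" for x unfolding G_def by (rule orth_proj_in[OF F])
      show "G x = 0" if "x \<in> orthogonal_comp F" for x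
        using orth_proj_comp_eq_0[OF F that] linT adjoint_linear[OF linT] linear_orth_proj[OF F]
        by (simp add: G_def linear_0)
    qed
  qed
  then obtain Q v where Q: "finite Q" "Q \<subseteq> q ` K0" "\<And>x. x \<in> Q \<Longrightarrow> 0 \<le> v x" "sum v Q = 1" "(\<Sum>x\<in>Q. v x *\<^sub>R x) = tgt"
    unfolding convex_hull_explicit by blast
  \<comment> \<open>The second component of \<open>q u\<close> is \<open>u\<close>, so hull
    coefficients can be indexed by contact points. Zero coefficients are dropped, and the factor in
    \<open>lam\<close> undoes the division in \<open>tgt\<close>.\<close>
  define U where "U = {u \<in> snd ` Q. 0 < v (q u)}"
  define lam where "lam u = DIM('a) * v (q u)" for u
  have qs: "q (snd x) = x" if "x \<in> Q" for x using Q(2) that by (auto simp: q_def)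
  have injs: "inj_on snd Q" using qs by (metis inj_onI)
  have finU: "finite U" using Q(1) by (simp add: U_def)
  have sumU: "(\<Sum>u\<in>U. v (q u) *\<^sub>R f u) = (\<Sum>x\<in>Q. v x *\<^sub>R f (snd x))" for f :: "'a \<Rightarrow> 'z::real_vector"
  proof -
    have "(\<Sum>x\<in>Q. v x *\<^sub>R f (snd x)) = (\<Sum>x\<in>Q. v (q (snd x)) *\<^sub>R f (snd x))" using qs by simp
    also have "\<dots> = (\<Sum>u\<in>snd ` Q. v (q u) *\<^sub>R f u)" by (simp add: sum.reindex[OF injs])
    also have "\<dots> = (\<Sum>u\<in>U. v (q u) *\<^sub>R f u)"
    proof (rule sum.mono_neutral_right)
      show "\<forall>u\<in>snd ` Q - U. v (q u) *\<^sub>R f u = 0"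
        using Q(3) qs by (force simp: U_def)
    qed (use Q(1) in \<open>auto simp: U_def\<close>)
    finally show ?thesis ..
  qed
  have UK: "U \<subseteq> K0" using Q(2) by (auto simp: U_def q_def)
  have sumtgt: "(\<Sum>u\<in>U. v (q u) *\<^sub>R q u) = tgt"
    unfolding sumU Q(5)[symmetric] using qs by (intro sum.cong) auto
  show ?thesis
  proof (rule that[of U lam])
    show "sum lam U = DIM('a)"
      using sumU[of "\<lambda>_. 1::real"] Q(4) by (simp add: lam_def sum_distrib_left[symmetric])
    have "(\<Sum>u\<in>U. v (q u) *\<^sub>R u) = snd tgt"
      unfolding sumtgt[symmetric] snd_sum by (simp add: q_def)
    then have "DIM('a) *\<^sub>R (\<Sum>u\<in>U. v (q u) *\<^sub>R u) = 0" by (simp add: tgt_def)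
    then show "(\<Sum>u\<in>U. lam u *\<^sub>R u) = 0" by (simp add: lam_def scaleR_sum_right)
    show "(\<Sum>u\<in>U. (lam u * (?P u \<bullet> x)) *\<^sub>R ?P u) = ?P x" for x
    proof -
      have "(\<lambda>x. \<Sum>u\<in>U. (lam u * (?P u \<bullet> x)) *\<^sub>R ?P u) = ?P"
      proof (rule linear_eq_stdbasis)
        show "linear (\<lambda>x. \<Sum>u\<in>U. (lam u * (?P u \<bullet> x)) *\<^sub>R ?P u)"
          by (rule linearI) (auto simp: inner_add_right distrib_left scaleR_add_left sum.distrib scaleR_sum_right mult_ac)
        fix b :: 'a assume "b \<in> Basis"
        then obtain i where b: "b = Rep_bidx i" by (metis Abs_bidx_inverse)
        have "(\<Sum>u\<in>U. v (q u) *\<^sub>R ((?P u \<bullet> b) *\<^sub>R ?P u)) = fst tgt $ i"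
          unfolding sumtgt[symmetric] fst_sum sum_component by (simp add: q_def b)
        then have "DIM('a) *\<^sub>R (\<Sum>u\<in>U. v (q u) *\<^sub>R ((?P u \<bullet> b) *\<^sub>R ?P u)) = ?P b" by (simp add: tgt_def b)
        then show "(\<Sum>u\<in>U. (lam u * (?P u \<bullet> b)) *\<^sub>R ?P u) = ?P b"
          by (simp add: lam_def scaleR_sum_right mult.assoc)
      qed (rule linear_orth_proj[OF F])
      then show ?thesis by metis
    qed
  qed (use finU UK in \<open>auto simp: K0_def lam_def U_def\<close>)
qed

subsection \<open>Volumes in a subspace\<close>

lemma ex_orthonormal_span:
  fixes F :: "'a::euclidean_space set"
  assumes "subspace F"
  obtains B where "orthonormal B" "span B = F" "card B = dim F"
proof -
  obtain B where "B \<subseteq> F" "pairwise orthogonal B" "\<And>x. x \<in> B \<Longrightarrow> norm x = 1" "card B = dim F" "span B = F"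
    using orthonormal_basis_subspace[OF assms] by metis
  moreover from this have "orthonormal B" by (simp add: orthonormal_def)
  ultimately show ?thesis by (intro that[of B])
qed

lemma orthonormal_basis_of_onb:
  fixes F :: "'a::euclidean_space set"
  assumes "subspace F"
  shows "orthonormal_basis_of F (onb F)"
proof -
  obtain B where B: "orthonormal B" "span B = F" "card B = dim F"
    using ex_orthonormal_span[OF assms] .
  have "finite B" using B(1) by (rule orthonormal_finite)
  then obtain b where b: "bij_betw b {..<dim F} B"
    using B(3) by (metis bij_betw_from_nat_into_finite ex_bij_betw_nat_finite lessThan_atLeast0)
  then have img: "b ` {..<dim F} = B" and inj: "inj_on b {..<dim F}" by (auto simp: bij_betw_def)
  have "orthonormal_basis_of F b"
    unfolding orthonormal_basis_of_def
  proof (intro conjI allI impI)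
    fix i j assume i: "i < dim F" and j: "j < dim F"
    show "b i \<bullet> b j = (if i = j then 1 else 0)"
      using orthonormal_inner[OF B(1), of "b i" "b j"] i j img inj by (auto simp: inj_on_def)
  next
    fix i assume "i < dim F"
    then have "b i \<in> B" using img by blast
    then show "b i \<in> F" using span_base[of "b i" B] B(2) by simp
  qed (simp add: img B(2))
  then show ?thesis unfolding onb_def by (rule someI[of "orthonormal_basis_of F"])
qed

lemma onb:
  assumes "subspace F"
  shows onb_in: "i < dim F \<Longrightarrow> onb F i \<in> F"
    and onb_inner: "i < dim F \<Longrightarrow> j < dim F \<Longrightarrow> onb F i \<bullet> onb F j = (if i = j then 1 else 0)"
    and inj_onb: "inj_on (onb F) {..<dim F}"
    and orthonormal_onb: "orthonormal (onb F ` {..<dim F})"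
    and span_onb: "span (onb F ` {..<dim F}) = F"
proof -
  note b = orthonormal_basis_of_onb[OF assms, unfolded orthonormal_basis_of_def]
  show "i < dim F \<Longrightarrow> onb F i \<in> F" "span (onb F ` {..<dim F}) = F" using b by auto
  show 1: "i < dim F \<Longrightarrow> j < dim F \<Longrightarrow> onb F i \<bullet> onb F j = (if i = j then 1 else 0)" for i j using b by auto
  show "inj_on (onb F) {..<dim F}"
  proof (rule inj_onI)
    fix i j assume "i \<in> {..<dim F}" "j \<in> {..<dim F}" "onb F i = onb F j"
    then show "i = j" using 1[of i i] 1[of i j] by (auto split: if_splits)
  qed
  show "orthonormal (onb F ` {..<dim F})"
    using 1 by (auto simp: orthonormal_def pairwise_def orthogonal_def norm_eq_1 split: if_splits)
qed

lemma onb_expand: "subspace F \<Longrightarrow> (\<Sum>k<dim F. (x \<bullet> onb F k) *\<^sub>R onb F k) = orth_proj F x"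
proof -
  assume F: "subspace F"
  have "orth_proj F x = (\<Sum>c\<in>onb F ` {..<dim F}. (orth_proj F x \<bullet> c) *\<^sub>R c)"
    using orthonormal_span_expand[OF orthonormal_onb[OF F], of "orth_proj F x"] span_onb[OF F] orth_proj_in[OF F] by simp
  also have "\<dots> = (\<Sum>k<dim F. (orth_proj F x \<bullet> onb F k) *\<^sub>R onb F k)"
    by (simp add: sum.reindex[OF inj_onb[OF F]])
  also have "\<dots> = (\<Sum>k<dim F. (x \<bullet> onb F k) *\<^sub>R onb F k)"
    using F by (intro sum.cong) (simp_all add: orth_proj_self_adjoint orth_proj_id onb_in)
  finally show ?thesis ..
qed

text \<open>Volumes in \<open>F\<close> are computed as integrals over the whole space with Gaussian weight
  in the directions of an orthonormal basis \<open>C\<close> of the orthogonal complement.\<close>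

definition gw :: "'a::euclidean_space set \<Rightarrow> 'a \<Rightarrow> real" where
  "gw C x = (\<Prod>c\<in>C. gauss (c \<bullet> x))"

lemma gw_pos: "0 < gw C x"
  unfolding gw_def by (intro prod_pos) (simp add: gauss_pos)

lemma measurable_gw [measurable]: "gw C \<in> borel_measurable borel"
  unfolding gw_def[abs_def] by measurable

abbreviation "lebs n \<equiv> Pi\<^sub>M {..<n::nat} (\<lambda>_. lborel :: real measure)"

lemma measurable_coords [measurable]: "coords F \<in> borel \<rightarrow>\<^sub>M lebs (dim F)"
  unfolding coords_def[abs_def] by (intro measurable_restrict) simp

text \<open>Fubini in the orthonormal basis made of \<open>onb F\<close> and \<open>C\<close>: each
  Gaussian factor integrates to 1, leaving Lebesgue measure in the coordinates of \<open>F\<close>.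
  Boxes suffice to identify a product measure.\<close>

lemma distr_coords:
  fixes F :: "'a::euclidean_space set"
  assumes F: "subspace F" and C: "orthonormal C" "span C = orthogonal_comp F"
  shows "distr (density lborel (\<lambda>x. ennreal (gw C x))) (lebs (dim F)) (coords F) = lebs (dim F)"
proof -
  interpret product_sigma_finite "\<lambda>_::nat. lborel :: real measure" ..
  let ?D = "distr (density lborel (\<lambda>x. ennreal (gw C x))) (lebs (dim F)) (coords F)"
  let ?B = "onb F ` {..<dim F}"
  have S: "onbasis (?B \<union> C)" "?B \<inter> C = {}"
    using onbasis_Un[OF orthonormal_onb[OF F] span_onb[OF F] C] by auto
  have finC: "finite C" using C(1) by (rule orthonormal_finite)
  note bij = bij_betw_imageI[OF inj_onb[OF F] refl]
  show ?thesis
  proof (rule PiM_eqI)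
    fix A :: "nat \<Rightarrow> real set" assume A: "\<And>i. i \<in> {..<dim F} \<Longrightarrow> A i \<in> sets lborel"
    define f where "f c t = (if c \<in> ?B then indicator (A (the_inv_into {..<dim F} (onb F) c)) t else ennreal (gauss t))" for c t
    have fb: "f (onb F k) = indicator (A k)" if "k < dim F" for k
      using that the_inv_into_f_f[OF inj_onb[OF F], of k] by (auto simp: f_def fun_eq_iff)
    have fc: "f c = (\<lambda>t. ennreal (gauss t))" if "c \<in> C" for c
      using that S(2) by (auto simp: f_def fun_eq_iff)
    have fm: "f c \<in> borel_measurable borel" if c: "c \<in> ?B \<union> C" for c
    proof (cases "c \<in> C")
      case False
      then obtain k where "k < dim F" "c = onb F k" using c by auto
      then show ?thesis using fb A[of k] by simp
    qed (simp add: fc)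
    have [measurable]: "Pi\<^sub>E {..<dim F} A \<in> sets (lebs (dim F))"
      using A by (intro sets_PiM_I_finite) auto
    have pm: "coords F -` Pi\<^sub>E {..<dim F} A \<in> sets borel"
      using measurable_sets[OF measurable_coords, of "Pi\<^sub>E {..<dim F} A" F] by simp
    have "emeasure (?D) (Pi\<^sub>E {..<dim F} A)
      = (\<integral>\<^sup>+x. ennreal (gw C x) * indicator (coords F -` Pi\<^sub>E {..<dim F} A) x \<partial>lborel)"
      using pm by (subst emeasure_distr) (auto simp: emeasure_density)
    also have "\<dots> = (\<integral>\<^sup>+x. (\<Prod>c\<in>?B \<union> C. f c (x \<bullet> c)) \<partial>lborel)"
    proof (intro nn_integral_cong)
      fix x
      have "(\<Prod>c\<in>?B \<union> C. f c (x \<bullet> c)) = (\<Prod>c\<in>?B. f c (x \<bullet> c)) * (\<Prod>c\<in>C. f c (x \<bullet> c))"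
        using finC S(2) by (intro prod.union_disjoint) auto
      also have "(\<Prod>c\<in>C. f c (x \<bullet> c)) = ennreal (gw C x)"
        by (simp add: fc gw_def prod_ennreal inner_commute)
      also have "(\<Prod>c\<in>?B. f c (x \<bullet> c)) = (\<Prod>k<dim F. indicator (A k) (x \<bullet> onb F k))"
        by (simp add: prod.reindex[OF inj_onb[OF F]] fb)
      also have "\<dots> = indicator (coords F -` Pi\<^sub>E {..<dim F} A) x"
        by (auto simp: coords_def PiE_iff indicator_def prod_eq_1_iff intro!: prod.neutral prod_zero)
      finally show "ennreal (gw C x) * indicator (coords F -` Pi\<^sub>E {..<dim F} A) x = (\<Prod>c\<in>?B \<union> C. f c (x \<bullet> c))"
        by (simp add: mult.commute)
    qed
    also have "\<dots> = (\<Prod>c\<in>?B \<union> C. \<integral>\<^sup>+t. f c t \<partial>lborel)"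
      by (rule nn_integral_onbasis_prod[OF S(1) fm])
    also have "\<dots> = (\<Prod>c\<in>?B. \<integral>\<^sup>+t. f c t \<partial>lborel) * (\<Prod>c\<in>C. \<integral>\<^sup>+t. f c t \<partial>lborel)"
      using finC S(2) by (intro prod.union_disjoint) auto
    also have "(\<Prod>c\<in>C. \<integral>\<^sup>+t. f c t \<partial>lborel) = 1" by (simp add: fc nn_integral_gauss)
    also have "(\<Prod>c\<in>?B. \<integral>\<^sup>+t. f c t \<partial>lborel) = (\<Prod>k<dim F. emeasure lborel (A k))"
      using A by (simp add: prod.reindex[OF inj_onb[OF F]] fb)
    finally show "emeasure (?D) (Pi\<^sub>E {..<dim F} A)
      = (\<Prod>k<dim F. emeasure lborel (A k))" by simp
  qed auto
qed

lemma coords_image_iff: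
  assumes F: "subspace F" and X: "X \<subseteq> F"
  shows "coords F x \<in> coords F ` X \<longleftrightarrow> orth_proj F x \<in> X"
proof
  assume "coords F x \<in> coords F ` X"
  then obtain y where y: "y \<in> X" "coords F x = coords F y" by auto
  have "x \<bullet> onb F k = y \<bullet> onb F k" if "k < dim F" for k
    using fun_cong[OF y(2), of k] that by (simp add: coords_def)
  then have "orth_proj F x = orth_proj F y"
    unfolding onb_expand[OF F, symmetric] by (intro sum.cong) auto
  then show "orth_proj F x \<in> X" using y X F by (simp add: orth_proj_id subsetD)
next
  assume "orth_proj F x \<in> X"
  moreover have "coords F (orth_proj F x) = coords F x"
    using F by (auto simp: coords_def fun_eq_iff orth_proj_self_adjoint orth_proj_id onb_in)
  ultimately show "coords F x \<in> coords F ` X" by (metis imageI)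
qed

lemma measurable_orth_proj [measurable (raw)]:
  "subspace F \<Longrightarrow> f \<in> borel_measurable M \<Longrightarrow> (\<lambda>x. orth_proj F (f x)) \<in> borel_measurable M"
proof -
  assume F: "subspace F" and f: "f \<in> borel_measurable M"
  have "orth_proj F \<in> borel_measurable borel"
    using linear_orth_proj[OF F]
    by (intro borel_measurable_continuous_onI linear_continuous_on) (simp add: linear_linear)
  then show ?thesis using f by (rule measurable_compose_rev)
qed

text \<open>The image is also a preimage, namely of \<open>X\<close> under the linear map
  \<open>g\<close> that rebuilds a vector of \<open>F\<close> from its coordinates.\<close>

lemma sets_coords_image:
  fixes F :: "'a::euclidean_space set"
  assumes F: "subspace F" and X: "X \<subseteq> F" "compact X"
  shows "coords F ` X \<in> sets (lebs (dim F))"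
proof -
  let ?M = "lebs (dim F)"
  define g where "g z = (\<Sum>k<dim F. z k *\<^sub>R onb F k)" for z :: "nat \<Rightarrow> real"
  have g: "g \<in> borel_measurable ?M" unfolding g_def[abs_def] by measurable
  have cg: "coords F (g z) = z" if "z \<in> space ?M" for z
  proof
    fix k
    show "coords F (g z) k = z k"
    proof (cases "k < dim F")
      case True
      have "g z \<bullet> onb F k = (\<Sum>j<dim F. z j * (onb F j \<bullet> onb F k))" by (simp add: g_def inner_sum_left)
      also have "\<dots> = (\<Sum>j<dim F. if j = k then z j else 0)"
        using True F by (intro sum.cong) (auto simp: onb_inner)
      finally show ?thesis using True by (simp add: coords_def)
    next
      case False
      then show ?thesis using that by (auto simp: coords_def space_PiM PiE_def extensional_def)
    qed
  qed
  have gF: "orth_proj F (g z) = g z" for z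
    unfolding g_def using F by (intro orth_proj_id) (auto intro!: subspace_sum subspace_scale onb_in)
  have "coords F ` X = g -` X \<inter> space ?M"
  proof (intro set_eqI iffI)
    fix z assume "z \<in> coords F ` X"
    then show "z \<in> g -` X \<inter> space ?M"
      using coords_image_iff[OF F X(1), of "g z"] cg[of z] gF measurable_space[OF measurable_coords] by fastforce
  next
    fix z assume "z \<in> g -` X \<inter> space ?M"
    then show "z \<in> coords F ` X"
      using coords_image_iff[OF F X(1), of "g z"] cg[of z] gF by auto
  qed
  then show ?thesis using measurable_sets[OF g, of X] X(2) by (simp add: borel_compact)
qed

lemma vol_sub_eq_nn_integral:
  fixes F :: "'a::euclidean_space set"
  assumes F: "subspace F" and C: "orthonormal C" "span C = orthogonal_comp F" and X: "X \<subseteq> F" "compact X"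
  shows "(\<integral>\<^sup>+x. ennreal (indicator X (orth_proj F x) * gw C x) \<partial>lborel) = ennreal (vol_sub F X)"
proof -
  interpret product_sigma_finite "\<lambda>_::nat. lborel :: real measure" ..
  let ?M = "lebs (dim F)"
  note sets = sets_coords_image[OF F X]
  have vim: "coords F -` coords F ` X \<in> sets borel"
    using measurable_sets[OF measurable_coords sets] by simp
  have "emeasure ?M (coords F ` X) = emeasure (distr (density lborel (\<lambda>x. ennreal (gw C x))) ?M (coords F)) (coords F ` X)"
    by (simp add: distr_coords[OF F C])
  also have "\<dots> = (\<integral>\<^sup>+x. ennreal (gw C x) * indicator (coords F -` coords F ` X) x \<partial>lborel)"
    using sets vim by (subst emeasure_distr) (auto simp: emeasure_density)
  also have "\<dots> = (\<integral>\<^sup>+x. ennreal (indicator X (orth_proj F x) * gw C x) \<partial>lborel)"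
    by (intro nn_integral_cong) (auto simp: indicator_def coords_image_iff[OF F X(1)])
  finally have eq: "emeasure ?M (coords F ` X) = (\<integral>\<^sup>+x. ennreal (indicator X (orth_proj F x) * gw C x) \<partial>lborel)" .
  \<comment> \<open>Finiteness matters: \<open>measure\<close> returns 0 on sets of infinite
    measure, so \<open>vol_sub\<close> agrees with the integral only after bounding the image by a
    cube.\<close>
  obtain r where r: "\<And>x. x \<in> X \<Longrightarrow> norm x \<le> r" using compact_imp_bounded[OF X(2)] by (auto simp: bounded_iff)
  have sub: "coords F ` X \<subseteq> Pi\<^sub>E {..<dim F} (\<lambda>_. {-r..r})"
  proof
    fix z assume "z \<in> coords F ` X"
    then obtain x where x: "x \<in> X" "z = coords F x" by auto
    have "\<bar>x \<bullet> onb F k\<bar> \<le> r" if "k < dim F" for k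
    proof -
      have "norm (onb F k) = 1" using onb_inner[OF F that that] by (simp add: norm_eq_1)
      then show ?thesis using Cauchy_Schwarz_ineq2[of x "onb F k"] r[OF x(1)] by simp
    qed
    then show "z \<in> Pi\<^sub>E {..<dim F} (\<lambda>_. {-r..r})" by (auto simp: x coords_def abs_le_iff minus_le_iff)
  qed
  have "emeasure ?M (coords F ` X) \<le> emeasure ?M (Pi\<^sub>E {..<dim F} (\<lambda>_. {-r..r}))"
    using sub by (intro emeasure_mono sets_PiM_I_finite) auto
  also have "\<dots> = (\<Prod>k<dim F. emeasure lborel {-r..r})" by (rule emeasure_PiM) auto
  also have "\<dots> < \<infinity>" by (simp add: ennreal_prod_eq_top less_top[symmetric] emeasure_lborel_Icc_eq power_eq_top_ennreal)
  finally have "emeasure ?M (coords F ` X) = ennreal (measure ?M (coords F ` X))"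
    by (intro emeasure_eq_ennreal_measure) auto
  then show ?thesis using eq by (simp add: vol_sub_def)
qed

text \<open>The map that stretches \<open>F\<close> by \<open>t\<close> and fixes the complement has
  determinant \<open>t ^ dim F\<close> and leaves \<open>gw C\<close> unchanged.\<close>

lemma scaled_section_le:
  fixes F :: "'a::euclidean_space set"
  assumes F: "subspace F" and C: "orthonormal C" "span C = orthogonal_comp F" and X: "compact X" and t: "0 < t"
  shows "ennreal (t ^ dim F) * (\<integral>\<^sup>+x. ennreal (indicator X (orth_proj F x) * gw C x) \<partial>lborel)
    \<le> (\<integral>\<^sup>+x. ennreal (indicator X ((1/t) *\<^sub>R orth_proj F x) * gw C x) \<partial>lborel)"
proof -
  have [measurable]: "X \<in> sets borel" using X by (rule borel_compact)
  note [measurable] = F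
  let ?P = "orth_proj F" and ?B = "onb F ` {..<dim F}"
  have S: "onbasis (?B \<union> C)" "?B \<inter> C = {}"
    using onbasis_Un[OF orthonormal_onb[OF F] span_onb[OF F] C] by auto
  define A where "A x = x + (t - 1) *\<^sub>R ?P x" for x
  have linA: "linear A"
    using linear_orth_proj[OF F] by (intro linearI) (auto simp: A_def linear_add linear_scale algebra_simps)
  have CF: "c \<in> orthogonal_comp F" if "c \<in> C" for c using C(2) that span_base by blast
  have PA: "?P (A x) = t *\<^sub>R ?P x" for x
    unfolding A_def linear_add[OF linear_orth_proj[OF F]] linear_scale[OF linear_orth_proj[OF F]]
    by (simp add: orth_proj_id[OF F orth_proj_in[OF F]] algebra_simps)
  have cA: "c \<bullet> A x = c \<bullet> x" if "c \<in> C" for c x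
    using orth_proj_comp_eq_0[OF F CF[OF that]] by (simp add: A_def inner_add_right orth_proj_self_adjoint[OF F, symmetric])
  have ld: "ldet A = t ^ dim F"
  proof -
    have "ldet A = (\<Prod>e\<in>?B \<union> C. if e \<in> ?B then t else 1)"
    proof (rule ldet_eigenbasis[OF linA S(1)])
      fix e assume "e \<in> ?B \<union> C"
      then show "A e = (if e \<in> ?B then t else 1) *\<^sub>R e"
        using CF orth_proj_comp_eq_0[OF F] orth_proj_id[OF F onb_in[OF F]] by (auto simp: A_def algebra_simps)
    qed
    also have "\<dots> = (\<Prod>e\<in>?B. if e \<in> ?B then t else 1) * (\<Prod>e\<in>C. if e \<in> ?B then t else 1)"
      using S(2) orthonormal_finite[OF C(1)] by (intro prod.union_disjoint) auto
    also have "(\<Prod>e\<in>C. if e \<in> ?B then t else 1) = 1"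
      using S(2) by (intro prod.neutral) auto
    also have "(\<Prod>e\<in>?B. if e \<in> ?B then t else 1) = (\<Prod>e\<in>?B. t)" by (rule prod.cong) simp_all
    also have "\<dots> = t ^ dim F" by (simp add: card_image[OF inj_onb[OF F]])
    finally show ?thesis by simp
  qed
  have injA: "inj A"
  proof (subst linear_injective_0[OF linA], intro allI impI)
    fix x assume "A x = 0"
    then have "t *\<^sub>R ?P x = 0" using PA[of x] linear_0[OF linear_orth_proj[OF F]] by simp
    then show "x = 0" using \<open>A x = 0\<close> t by (simp add: A_def)
  qed
  have "(\<integral>\<^sup>+x. ennreal (t ^ dim F * (indicator X (?P x) * gw C x)) \<partial>lborel)
    \<le> (\<integral>\<^sup>+x. ennreal (indicator X ((1/t) *\<^sub>R ?P x) * gw C x) \<partial>lborel)"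
  proof (rule nn_integral_change_of_variables_le)
    show "(A has_derivative A) (at x)" for x using linA by (rule linear_imp_has_derivative)
    show "0 \<le> indicator X ((1 / t) *\<^sub>R ?P x) * gw C x" for x using gw_pos[of C x] by simp
    show "t ^ dim F * (indicator X (?P x) * gw C x) \<le> \<bar>ldet A\<bar> * (indicator X ((1 / t) *\<^sub>R ?P (A x)) * gw C (A x))" for x
      using t by (simp add: ld PA gw_def cA)
  qed (use injA in measurable)
  moreover have "(\<integral>\<^sup>+x. ennreal (t ^ dim F * (indicator X (?P x) * gw C x)) \<partial>lborel) =
      ennreal (t ^ dim F) * (\<integral>\<^sup>+x. ennreal (indicator X (?P x) * gw C x) \<partial>lborel)"
    using t by (subst nn_integral_cmult[symmetric]) (auto simp: ennreal_mult' intro!: nn_integral_cong)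
  ultimately show ?thesis by simp
qed

lemma scaled_section:
  fixes F :: "'a::euclidean_space set"
  assumes F: "subspace F" and C: "orthonormal C" "span C = orthogonal_comp F"
    and X: "X \<subseteq> F" "compact X" and t: "0 < t"
  shows "(\<integral>\<^sup>+x. ennreal (indicator X ((1/t) *\<^sub>R orth_proj F x) * gw C x) \<partial>lborel) = ennreal (t ^ dim F * vol_sub F X)"
proof -
  let ?I = "\<lambda>X. \<integral>\<^sup>+x. ennreal (indicator X (orth_proj F x) * gw C x) \<partial>lborel"
  let ?J = "\<integral>\<^sup>+x. ennreal (indicator X ((1/t) *\<^sub>R orth_proj F x) * gw C x) \<partial>lborel"
  let ?tX = "(*\<^sub>R) t ` X"
  have mem: "y \<in> ?tX \<longleftrightarrow> (1/t) *\<^sub>R y \<in> X" for y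
    using t by (auto simp: image_iff) (metis divide_self_if less_irrefl scaleR_one scaleR_scaleR times_divide_eq_right mult_1_right)
  have J: "?J = ?I ?tX" by (intro nn_integral_cong) (simp add: indicator_def mem)
  have V: "?I X = ennreal (vol_sub F X)" by (rule vol_sub_eq_nn_integral[OF F C X])
  have 1: "ennreal (t ^ dim F) * ?I X \<le> ?J" by (rule scaled_section_le[OF F C X(2) t])
  \<comment> \<open>The reverse inequality is the same estimate for the dilated set with the
    reciprocal factor.\<close>
  have "ennreal ((1/t) ^ dim F) * ?I ?tX \<le> (\<integral>\<^sup>+x. ennreal (indicator ?tX ((1/(1/t)) *\<^sub>R orth_proj F x) * gw C x) \<partial>lborel)"
    using t X(2) by (intro scaled_section_le[OF F C] compact_scaling) auto
  also have "\<dots> = ?I X" by (intro nn_integral_cong) (use t in \<open>simp add: indicator_def mem\<close>)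
  finally have "ennreal (t ^ dim F) * (ennreal ((1/t) ^ dim F) * ?J) \<le> ennreal (t ^ dim F) * ?I X"
    unfolding J by (rule mult_left_mono) simp
  moreover have "ennreal (t ^ dim F) * (ennreal ((1/t) ^ dim F) * ?J) = ?J"
    unfolding mult.assoc[symmetric] using t by (simp add: ennreal_mult'[symmetric] power_mult_distrib[symmetric])
  ultimately have "?J = ennreal (t ^ dim F) * ?I X" using 1 by simp
  also have "\<dots> = ennreal (t ^ dim F * vol_sub F X)"
    unfolding V using t by (intro ennreal_mult'[symmetric]) simp
  finally show ?thesis .
qed

section \<open>Volumes as exponential integrals over dilates and cones\<close>

lemma nn_integral_power_exp: "(\<integral>\<^sup>+t. ennreal (indicator {0<..} t * exp (- t) * t ^ n) \<partial>lborel) = ennreal (fact n)"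
proof -
  have "(\<integral>\<^sup>+t. ennreal (indicator {0<..} t * exp (- t) * t ^ n) \<partial>lborel) = (\<integral>\<^sup>+t. ennreal (t ^ n * exp (- t)) * indicator {0..} t \<partial>lborel)"
    by (rule nn_integral_cong_AE, rule AE_mp[OF AE_lborel_singleton[of 0]]) (auto simp: indicator_def mult.commute)
  also have "\<dots> = ennreal (fact n)" using nn_intergal_power_times_exp_Ici[of n] by simp
  finally show ?thesis .
qed

lemma nn_integral_exp_tail: "(\<integral>\<^sup>+t. ennreal (indicator {a..} t * exp (- t)) \<partial>lborel) = ennreal (exp (- a))"
proof -
  have "(\<integral>\<^sup>+t. ennreal (exp (- t)) * indicator {a..} t \<partial>lborel) = ennreal (0 - (- exp (- a)))"
  proof (rule nn_integral_FTC_atLeast)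
    show "((\<lambda>x. - exp (- x)) has_real_derivative exp (- x)) (at x)" for x :: real
      by (auto intro!: derivative_eq_intros)
    show "((\<lambda>x. - exp (- x)) \<longlongrightarrow> (0::real)) at_top" by real_asymp
  qed auto
  then show ?thesis by (simp add: ennreal_mult' mult.commute ennreal_indicator[symmetric] del: ennreal_indicator)
qed

text \<open>For convex \<open>X\<close> containing 0, integrating over \<open>t\<close> gives the
  exponential of minus the gauge of \<open>X\<close> at the projection of \<open>x\<close>, times
  the Gaussian weight; integrating over \<open>x\<close> first gives volumes of dilates.\<close>

abbreviation "layer F C X t x \<equiv> indicator {0<..} t * exp (- t) * indicator X ((1/t) *\<^sub>R orth_proj F x) * gw C x"

text \<open>After exchanging the integrals, the slice at \<open>t\<close> has volume
  \<open>t ^ dim F\<close> times that of \<open>X\<close>, and the Gamma integral produces the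
  factorial.\<close>

lemma nn_integral_layers:
  fixes F :: "'a::euclidean_space set"
  assumes F: "subspace F" and C: "orthonormal C" "span C = orthogonal_comp F"
    and X: "X \<subseteq> F" "compact X"
  shows "(\<integral>\<^sup>+x. (\<integral>\<^sup>+t. ennreal (layer F C X t x) \<partial>lborel) \<partial>lborel)
    = ennreal (fact (dim F) * vol_sub F X)"
proof -
  have [measurable]: "X \<in> sets borel" using X(2) by (rule borel_compact)
  note [measurable] = F
  have V: "0 \<le> vol_sub F X" by (simp add: vol_sub_def)
  have "(\<integral>\<^sup>+x. (\<integral>\<^sup>+t. ennreal (layer F C X t x) \<partial>lborel) \<partial>lborel)
    = (\<integral>\<^sup>+t. (\<integral>\<^sup>+x. ennreal (layer F C X t x) \<partial>lborel) \<partial>lborel)"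
    by (rule lborel_pair.Fubini') measurable
  also have "\<dots> = (\<integral>\<^sup>+t. ennreal (vol_sub F X) * ennreal (indicator {0<..} t * exp (- t) * t ^ dim F) \<partial>lborel)"
  proof (intro nn_integral_cong)
    fix t :: real
    show "(\<integral>\<^sup>+x. ennreal (layer F C X t x) \<partial>lborel)
      = ennreal (vol_sub F X) * ennreal (indicator {0<..} t * exp (- t) * t ^ dim F)"
    proof (cases "0 < t")
      case True
      have "(\<integral>\<^sup>+x. ennreal (layer F C X t x) \<partial>lborel)
        = ennreal (exp (- t)) * (\<integral>\<^sup>+x. ennreal (indicator X ((1/t) *\<^sub>R orth_proj F x) * gw C x) \<partial>lborel)"
        using True by (subst nn_integral_cmult[symmetric]) (auto simp: ennreal_mult' mult.assoc intro!: nn_integral_cong)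
      also have "\<dots> = ennreal (vol_sub F X) * ennreal (indicator {0<..} t * exp (- t) * t ^ dim F)"
        unfolding scaled_section[OF F C X True] using True V by (simp add: ennreal_mult'[symmetric] mult_ac)
      finally show ?thesis .
    qed simp
  qed
  also have "\<dots> = ennreal (vol_sub F X) * ennreal (fact (dim F))"
    by (subst nn_integral_cmult) (simp_all add: nn_integral_power_exp)
  finally show ?thesis using V by (simp add: ennreal_mult'[symmetric] mult.commute)
qed

text \<open>The extra coordinate now plays the role of the dilation factor: the integrand lives on
  the cone whose slice at height \<open>r\<close> is \<open>a * r\<close> times \<open>X\<close>.
  The substitution \<open>t = a * r\<close> contributes \<open>1 / a\<close>.\<close>

lemma nn_integral_cone:
  fixes F :: "'a::euclidean_space set"
  assumes F: "subspace F" and C: "orthonormal C" "span C = orthogonal_comp F"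
    and X: "X \<subseteq> F" "compact X" and a: "0 < a"
  shows "(\<integral>\<^sup>+z. ennreal (indicator {0<..} (snd z) * exp (- (a * snd z)) * indicator X ((1 / (a * snd z)) *\<^sub>R orth_proj F (fst z)) * gw C (fst z)) \<partial>(lborel :: ('a \<times> real) measure))
    = ennreal (fact (dim F) * vol_sub F X / a)"
proof -
  have [measurable]: "X \<in> sets borel" using X(2) by (rule borel_compact)
  note [measurable] = F
  have V: "0 \<le> vol_sub F X" by (simp add: vol_sub_def)
  let ?h = "\<lambda>t x. ennreal (layer F C X t x)"
  have "(\<integral>\<^sup>+z. ?h (a * snd z) (fst z) \<partial>(lborel :: ('a \<times> real) measure)) = (\<integral>\<^sup>+z. ?h (a * snd z) (fst z) \<partial>(lborel \<Otimes>\<^sub>M lborel))"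
    by (simp add: lborel_prod)
  also have "\<dots> = (\<integral>\<^sup>+x. (\<integral>\<^sup>+r. ?h (a * r) x \<partial>lborel) \<partial>lborel)"
    by (subst lborel.nn_integral_fst[symmetric]) auto
  also have "\<dots> = (\<integral>\<^sup>+x. ennreal (1/a) * (\<integral>\<^sup>+t. ?h t x \<partial>lborel) \<partial>lborel)"
  proof (intro nn_integral_cong)
    fix x
    have "(\<integral>\<^sup>+t. ?h t x \<partial>lborel) = ennreal \<bar>a\<bar> * (\<integral>\<^sup>+r. ?h (0 + a * r) x \<partial>lborel)"
      using a by (intro nn_integral_real_affine) auto
    then show "(\<integral>\<^sup>+r. ?h (a * r) x \<partial>lborel) = ennreal (1/a) * (\<integral>\<^sup>+t. ?h t x \<partial>lborel)"
      using a by (simp add: mult.assoc[symmetric] ennreal_mult'[symmetric])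
  qed
  also have "\<dots> = ennreal (1/a) * (\<integral>\<^sup>+x. (\<integral>\<^sup>+t. ?h t x \<partial>lborel) \<partial>lborel)"
    by (rule nn_integral_cmult) measurable
  also have "\<dots> = ennreal (fact (dim F) * vol_sub F X / a)"
    unfolding nn_integral_layers[OF F C X] using a V by (simp add: ennreal_mult'[symmetric])
  also have "(\<integral>\<^sup>+z. ?h (a * snd z) (fst z) \<partial>(lborel :: ('a \<times> real) measure)) =
    (\<integral>\<^sup>+z. ennreal (indicator {0<..} (snd z) * exp (- (a * snd z)) * indicator X ((1 / (a * snd z)) *\<^sub>R orth_proj F (fst z)) * gw C (fst z)) \<partial>(lborel :: ('a \<times> real) measure))"
    using a by (intro nn_integral_cong) (simp add: indicator_def zero_less_mult_iff)
  finally show ?thesis .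
qed

subsection \<open>Volume bounds for hulls of frames\<close>

lemma perp_expand:
  fixes F :: "'a::euclidean_space set"
  assumes F: "subspace F" and C: "orthonormal C" "span C = orthogonal_comp F"
  shows "(\<Sum>c\<in>C. (c \<bullet> x) *\<^sub>R c) = x - orth_proj F x"
    and perp_inner: "c \<in> C \<Longrightarrow> y \<in> F \<Longrightarrow> c \<bullet> y = 0"
proof -
  show 0: "c \<bullet> y = 0" if "c \<in> C" "y \<in> F" for c y
  proof -
    have "c \<in> orthogonal_comp F" using C(2) span_base[OF that(1)] by simp
    then show ?thesis using that(2) by (auto simp: orthogonal_comp_def orthogonal_def inner_commute[of c])
  qed
  have "x - orth_proj F x \<in> span C"
    using orth_proj_in[OF subspace_orthogonal_comp, of F x] by (simp add: C(2) orth_proj_orthogonal_comp[OF F])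
  then have "x - orth_proj F x = (\<Sum>c\<in>C. ((x - orth_proj F x) \<bullet> c) *\<^sub>R c)"
    using orthonormal_span_expand[OF C(1)] by metis
  also have "\<dots> = (\<Sum>c\<in>C. (c \<bullet> x) *\<^sub>R c)"
  proof (intro sum.cong refl)
    fix c assume "c \<in> C"
    then have "c \<bullet> orth_proj F x = 0" using 0 orth_proj_in[OF F] by blast
    then show "((x - orth_proj F x) \<bullet> c) *\<^sub>R c = (c \<bullet> x) *\<^sub>R c"
      by (simp add: inner_diff_right inner_commute[of _ c])
  qed
  finally show "(\<Sum>c\<in>C. (c \<bullet> x) *\<^sub>R c) = x - orth_proj F x" ..
qed

lemma perp_expand_embed:
  fixes F :: "'a::euclidean_space set"
  assumes F: "subspace F" and C: "orthonormal C" "span C = orthogonal_comp F"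
  shows "(\<Sum>c\<in>(\<lambda>c. (c, 0::real)) ` C. (c \<bullet> z) *\<^sub>R c) = (fst z - orth_proj F (fst z), 0)"
proof -
  have "inj_on (\<lambda>c::'a. (c, 0::real)) C" by (auto simp: inj_on_def)
  then have "(\<Sum>c\<in>(\<lambda>c. (c, 0::real)) ` C. (c \<bullet> z) *\<^sub>R c) = (\<Sum>c\<in>C. ((c \<bullet> fst z) *\<^sub>R c, 0))"
    by (subst sum.reindex) (auto simp: inner_prod_def)
  also have "\<dots> = (\<Sum>c\<in>C. (c \<bullet> fst z) *\<^sub>R c, 0)" by (simp add: prod_eq_iff fst_sum snd_sum)
  finally show ?thesis by (simp add: perp_expand[OF F C])
qed

lemma frame_norms:
  fixes p :: "'u \<Rightarrow> 'a::euclidean_space" and lam :: "'u \<Rightarrow> real"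
  assumes F: "subspace F" and frame: "\<And>x. (\<Sum>u\<in>U. (lam u * (p u \<bullet> x)) *\<^sub>R p u) = orth_proj F x"
  shows "(\<Sum>u\<in>U. lam u * (p u \<bullet> x)\<^sup>2) = orth_proj F x \<bullet> x"
  by (simp add: frame[symmetric] inner_sum_left power2_eq_square mult.assoc)

text \<open>Trace of the frame identity, taken over the orthonormal basis of
  \<open>F\<close>.\<close>

lemma frame_trace:
  fixes p :: "'u \<Rightarrow> 'a::euclidean_space" and lam :: "'u \<Rightarrow> real"
  assumes F: "subspace F" and frame: "\<And>x. (\<Sum>u\<in>U. (lam u * (p u \<bullet> x)) *\<^sub>R p u) = orth_proj F x"
    and p: "\<And>u. u \<in> U \<Longrightarrow> p u \<in> F"
  shows "(\<Sum>u\<in>U. lam u * (norm (p u))\<^sup>2) = dim F"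
proof -
  have "(norm (p u))\<^sup>2 = (\<Sum>k<dim F. (p u \<bullet> onb F k)\<^sup>2)" if "u \<in> U" for u
  proof -
    have "(norm (p u))\<^sup>2 = (\<Sum>k<dim F. (p u \<bullet> onb F k) *\<^sub>R onb F k) \<bullet> p u"
      by (simp add: onb_expand[OF F] orth_proj_id[OF F p[OF that]] power2_norm_eq_inner)
    then show ?thesis by (simp add: inner_sum_left power2_eq_square inner_commute[of "onb F _" "p u"])
  qed
  then have "(\<Sum>u\<in>U. lam u * (norm (p u))\<^sup>2) = (\<Sum>u\<in>U. \<Sum>k<dim F. lam u * (p u \<bullet> onb F k)\<^sup>2)"
    by (simp add: sum_distrib_left)
  also have "\<dots> = (\<Sum>k<dim F. \<Sum>u\<in>U. lam u * (p u \<bullet> onb F k)\<^sup>2)" by (rule sum.swap)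
  also have "\<dots> = (\<Sum>k<dim F. orth_proj F (onb F k) \<bullet> onb F k)"
    using frame_norms[OF F frame] by simp
  also have "\<dots> = (\<Sum>k<dim F. 1)"
    using F by (intro sum.cong) (simp_all add: orth_proj_id onb_in onb_inner)
  finally show ?thesis by simp
qed

lemma orthonormal_embed:
  fixes C :: "'a::euclidean_space set"
  assumes "orthonormal C"
  shows "orthonormal ((\<lambda>c. (c, 0::real)) ` C)"
  using assms by (auto simp: orthonormal_def pairwise_def orthogonal_def norm_Pair)

text \<open>The positive transport sends the lifted frame into the cone over \<open>X\<close>, where
  the exponential weight depends on the height alone. Lifted squared lengths are
  \<open>(norm (p u))^2 + 1 / L\<close>, so their weighted sum is \<open>dim F + 1\<close>.\<close>

lemma simplex_volume_bound:
  fixes p :: "'u \<Rightarrow> 'a::euclidean_space" and lam :: "'u \<Rightarrow> real"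
  assumes F: "subspace F" and fin: "finite U" and lam: "\<And>u. u \<in> U \<Longrightarrow> 0 < lam u"
    and L: "sum lam U = L" "0 < L" and p: "\<And>u. u \<in> U \<Longrightarrow> p u \<in> F"
    and frame: "\<And>x. (\<Sum>u\<in>U. (lam u * (p u \<bullet> x)) *\<^sub>R p u) = orth_proj F x"
    and centre: "(\<Sum>u\<in>U. lam u *\<^sub>R p u) = 0"
    and X: "X \<subseteq> F" "compact X" "convex X" "\<And>u. u \<in> U \<Longrightarrow> p u \<in> X"
  shows "((real (dim F) + 1) / L) powr ((real (dim F) + 1) / 2) \<le> fact (dim F) * vol_sub F X / sqrt L"
proof -
  obtain C where C: "orthonormal C" "span C = orthogonal_comp F"
    using ex_orthonormal_span[OF subspace_orthogonal_comp[of F]] by metis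
  obtain T T' :: "real \<Rightarrow> real" where T: "\<And>t. (T has_real_derivative T' t) (at t)" "\<And>t. 0 < T' t"
    "\<And>t. 0 < T t" "\<And>t. T' t * exp (- T t) = gauss t"
    using exponential_transport by blast
  have Xb [measurable]: "X \<in> sets borel" using X(2) by (rule borel_compact)
  note [measurable] = F
  \<comment> \<open>With height \<open>1 / a\<close> the squared heights have weighted sum 1, which
    is the diagonal entry needed on the added line; \<open>centre\<close> cancels the mixed
    terms.\<close>
  define a where "a = sqrt L"
  have a: "0 < a" "a * a = L" using L by (auto simp: a_def)
  define w where "w u = (p u, 1 / a)" for u
  define C' where "C' = (\<lambda>c. (c, 0::real)) ` C"
  have injC: "inj_on (\<lambda>c::'a. (c, 0::real)) C" by (auto simp: inj_on_def)
  have sumC: "(\<Sum>c\<in>C'. (c \<bullet> z) *\<^sub>R c) = (fst z - orth_proj F (fst z), 0)" for z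
    unfolding C'_def by (rule perp_expand_embed[OF F C])
  have w2: "(norm (w u))\<^sup>2 = (norm (p u))\<^sup>2 + 1 / L" for u
    using a L(2) by (simp add: w_def norm_Pair power_divide power2_eq_square[of a])
  define H where "H z = indicator {0<..} (snd z) * exp (- (a * snd z)) * indicator X ((1 / (a * snd z)) *\<^sub>R orth_proj F (fst z)) * gw C (fst z)" for z
  have "ennreal (1 powr (real (dim F) + 1) * ((real (dim F) + 1) / L) powr ((real (dim F) + 1) / 2)) \<le> (\<integral>\<^sup>+z. ennreal (H z) \<partial>lborel)"
  proof (rule gaussian_transport[OF fin lam, where w = w and C = C' and T = T and T' = T' and \<tau> = "\<lambda>t. t"])
    show "w u \<noteq> 0" for u using a by (simp add: w_def zero_prod_def)
    show "orthonormal C'" unfolding C'_def by (rule orthonormal_embed[OF C(1)])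
    show "(\<Sum>u\<in>U. (lam u * (w u \<bullet> x)) *\<^sub>R w u) + (\<Sum>c\<in>C'. (c \<bullet> x) *\<^sub>R c) = x" for x
    proof (rule prod_eqI)
      have "(\<Sum>u\<in>U. (lam u * (p u \<bullet> fst x + snd x / a)) *\<^sub>R p u) =
          (\<Sum>u\<in>U. (lam u * (p u \<bullet> fst x)) *\<^sub>R p u) + (snd x / a) *\<^sub>R (\<Sum>u\<in>U. lam u *\<^sub>R p u)"
        by (simp add: distrib_left scaleR_add_left sum.distrib scaleR_sum_right mult.commute)
      then show "fst ((\<Sum>u\<in>U. (lam u * (w u \<bullet> x)) *\<^sub>R w u) + (\<Sum>c\<in>C'. (c \<bullet> x) *\<^sub>R c)) = fst x"
        unfolding fst_add sumC by (simp add: fst_sum w_def inner_prod_def frame centre)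
      have "(\<Sum>u\<in>U. lam u * (p u \<bullet> fst x)) = (\<Sum>u\<in>U. lam u *\<^sub>R p u) \<bullet> fst x" by (simp add: inner_sum_left)
      then have 0: "(\<Sum>u\<in>U. lam u * (p u \<bullet> fst x)) = 0" using centre by simp
      have "(\<Sum>u\<in>U. lam u * (p u \<bullet> fst x + snd x / a) / a) =
          (\<Sum>u\<in>U. lam u * (p u \<bullet> fst x)) / a + sum lam U * (snd x / (a * a))"
        by (simp add: distrib_left add_divide_distrib sum.distrib sum_divide_distrib sum_distrib_right)
      also have "\<dots> = snd x" using 0 L a by simp
      finally show "snd ((\<Sum>u\<in>U. (lam u * (w u \<bullet> x)) *\<^sub>R w u) + (\<Sum>c\<in>C'. (c \<bullet> x) *\<^sub>R c)) = snd x"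
        unfolding snd_add sumC by (simp add: snd_sum w_def inner_prod_def)
    qed
    have "H \<in> borel_measurable (borel \<Otimes>\<^sub>M borel)" unfolding H_def[abs_def] by measurable
    then show "H \<in> borel_measurable borel" by (simp add: borel_prod)
    show "0 \<le> H z" for z unfolding H_def using gw_pos[of C "fst z"] by simp
    show "(\<Sum>u\<in>U. lam u * (norm (w u))\<^sup>2) = real (dim F) + 1"
      using frame_trace[OF F frame p] L
      by (simp add: w2 distrib_left sum.distrib sum_divide_distrib[symmetric])
    show "exp (- (\<Sum>u\<in>U. lam u * (norm (w u))\<^sup>2 * \<theta> u)) * (\<Prod>c\<in>C'. gauss (c \<bullet> y))
      \<le> H ((\<Sum>u\<in>U. (lam u * (norm (w u))\<^sup>2 * \<theta> u) *\<^sub>R w u) + (\<Sum>c\<in>C'. (c \<bullet> y) *\<^sub>R c))"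
      if \<theta>: "\<And>u. \<theta> u \<in> range T" for y \<theta>
    proof -
      \<comment> \<open>The coefficients are positive because \<open>T\<close> is. Their sum
        \<open>A\<close> equals \<open>a\<close> times the height of the image point, so dividing by
        it turns the \<open>F\<close>-part into a convex combination of the \<open>p u\<close>,
        hence a point of \<open>X\<close>.\<close>
      define b where "b u = lam u * (norm (w u))\<^sup>2 * \<theta> u" for u
      define A where "A = sum b U"
      have b: "0 < b u" if "u \<in> U" for u
      proof -
        have "0 < \<theta> u" using \<theta>[of u] T(3) by auto
        moreover have "0 < (norm (w u))\<^sup>2" using L unfolding w2 by (intro add_nonneg_pos) auto
        ultimately show ?thesis using lam[OF that] by (simp add: b_def)
      qed
      have "U \<noteq> {}" using L by auto
      then have A: "0 < A" unfolding A_def using b fin by (intro sum_pos) auto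
      define z where "z = (\<Sum>u\<in>U. b u *\<^sub>R w u) + (\<Sum>c\<in>C'. (c \<bullet> y) *\<^sub>R c)"
      have fz: "fst z = (\<Sum>u\<in>U. b u *\<^sub>R p u) + (fst y - orth_proj F (fst y))"
        by (simp add: z_def sumC fst_sum w_def)
      have sz: "a * snd z = A"
        using a(1) by (simp add: z_def sumC snd_sum w_def A_def sum_divide_distrib[symmetric])
      have sz0: "0 < snd z" using sz A a(1) zero_less_mult_pos[of a "snd z"] by simp
      have inF: "(\<Sum>u\<in>U. b u *\<^sub>R p u) \<in> F" using F p by (intro subspace_sum subspace_scale) auto
      have Pz: "orth_proj F (fst z) = (\<Sum>u\<in>U. b u *\<^sub>R p u)"
        unfolding fz linear_add[OF linear_orth_proj[OF F]] linear_diff[OF linear_orth_proj[OF F]]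
        by (simp add: orth_proj_id[OF F inF] orth_proj_id[OF F orth_proj_in[OF F]])
      have "(1 / A) *\<^sub>R (\<Sum>u\<in>U. b u *\<^sub>R p u) = (\<Sum>u\<in>U. (b u / A) *\<^sub>R p u)"
        by (simp add: scaleR_sum_right)
      also have "\<dots> \<in> X"
        using A b X(4) by (intro convex_sum[OF fin X(3)])
          (auto simp: A_def sum_divide_distrib[symmetric] less_imp_le)
      finally have inX: "(1 / A) *\<^sub>R orth_proj F (fst z) \<in> X" by (simp add: Pz)
      have "gw C (fst z) = (\<Prod>c\<in>C. gauss (c \<bullet> fst y))"
        unfolding gw_def fz
        by (intro prod.cong refl) (simp add: inner_add_right inner_diff_right perp_inner[OF F C _ inF] perp_inner[OF F C _ orth_proj_in[OF F]])
      also have "\<dots> = (\<Prod>c\<in>C'. gauss (c \<bullet> y))"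
        unfolding C'_def by (subst prod.reindex[OF injC]) (simp add: inner_prod_def)
      finally have "H z = exp (- A) * (\<Prod>c\<in>C'. gauss (c \<bullet> y))"
        using inX sz0 by (simp add: H_def sz)
      then show ?thesis unfolding z_def b_def A_def by simp
    qed
  qed (use T L in auto)
  also have "(\<integral>\<^sup>+z. ennreal (H z) \<partial>lborel) = ennreal (fact (dim F) * vol_sub F X / a)"
    unfolding H_def by (rule nn_integral_cone[OF F C X(1,2) a(1)])
  finally show ?thesis using a(1) by (simp add: a_def vol_sub_def)
qed

text \<open>Signs are moved from the coefficients onto the points, and the missing mass goes to 0,
  the midpoint of an opposite pair.\<close>

lemma convex_abs_combination:
  fixes p :: "'u \<Rightarrow> 'a::real_vector"
  assumes X: "convex X" "\<And>i. i \<in> I \<Longrightarrow> p i \<in> X" "\<And>i. i \<in> I \<Longrightarrow> - p i \<in> X"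
    and I: "finite I" "I \<noteq> {}" and th: "(\<Sum>i\<in>I. \<bar>\<theta> i\<bar>) \<le> 1"
  shows "(\<Sum>i\<in>I. \<theta> i *\<^sub>R p i) \<in> X"
proof -
  obtain i where "i \<in> I" using I by auto
  then have "(1/2) *\<^sub>R p i + (1/2) *\<^sub>R (- p i) \<in> X" using X by (intro convexD) auto
  then have X0: "0 \<in> X" by simp
  define t where "t = (\<Sum>i\<in>I. \<bar>\<theta> i\<bar>)"
  show ?thesis
  proof (cases "t = 0")
    case True
    then have "\<forall>i\<in>I. \<theta> i = 0" using I by (simp add: t_def sum_nonneg_eq_0_iff)
    then show ?thesis using X0 by simp
  next
    case False
    then have t: "0 < t" "t \<le> 1" using th by (auto simp: t_def less_le sum_nonneg)
    define y where "y = (\<Sum>i\<in>I. (\<bar>\<theta> i\<bar> / t) *\<^sub>R (if 0 \<le> \<theta> i then p i else - p i))"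
    have "y \<in> X" unfolding y_def
      using t X(2,3) by (intro convex_sum[OF I(1) X(1)]) (auto simp: sum_divide_distrib[symmetric] t_def)
    then have "t *\<^sub>R y + (1 - t) *\<^sub>R 0 \<in> X" using X0 X(1) t by (intro convexD) auto
    moreover have "t *\<^sub>R y = (\<Sum>i\<in>I. \<theta> i *\<^sub>R p i)"
      unfolding y_def scaleR_sum_right using t by (intro sum.cong) auto
    ultimately show ?thesis by simp
  qed
qed

lemma layer_integral_le_1:
  "(\<integral>\<^sup>+t. ennreal (indicator {0<..} t * exp (- t) * indicator X (f t)) \<partial>lborel) \<le> 1"
proof -
  have "(\<integral>\<^sup>+t. ennreal (indicator {0<..} t * exp (- t) * indicator X (f t)) \<partial>lborel)
    \<le> (\<integral>\<^sup>+t. ennreal (indicator {0..} t * exp (- t)) \<partial>lborel)"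
    by (intro nn_integral_mono ennreal_leI) (auto simp: indicator_def)
  then show ?thesis by (simp add: nn_integral_exp_tail)
qed

text \<open>Here the transported density is the two-sided exponential, and the gauge of
  \<open>X\<close> at the combination of the \<open>p u\<close> is at most the sum of absolute
  coefficients. No lift is involved, so \<open>n = dim F\<close>, and each unit of weight
  contributes the mass 2.\<close>

lemma cross_polytope_volume_bound:
  fixes p :: "'u \<Rightarrow> 'a::euclidean_space" and lam :: "'u \<Rightarrow> real"
  assumes F: "subspace F" "0 < dim F" and fin: "finite U" and lam: "\<And>u. u \<in> U \<Longrightarrow> 0 < lam u"
    and L: "sum lam U = L" and p: "\<And>u. u \<in> U \<Longrightarrow> p u \<in> F"
    and frame: "\<And>x. (\<Sum>u\<in>U. (lam u * (p u \<bullet> x)) *\<^sub>R p u) = orth_proj F x"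
    and X: "X \<subseteq> F" "compact X" "convex X" "\<And>u. u \<in> U \<Longrightarrow> p u \<in> X" "\<And>u. u \<in> U \<Longrightarrow> - p u \<in> X"
  shows "2 powr dim F * (dim F / L) powr (dim F / 2) \<le> fact (dim F) * vol_sub F X"
proof -
  obtain C where C: "orthonormal C" "span C = orthogonal_comp F"
    using ex_orthonormal_span[OF subspace_orthogonal_comp[of F]] by metis
  obtain T T' :: "real \<Rightarrow> real" where T: "\<And>t. (T has_real_derivative T' t) (at t)" "\<And>t. 0 < T' t"
    "\<And>t. T' t * exp (- \<bar>T t\<bar>) = 2 * gauss t"
    using laplace_transport by blast
  have Xb [measurable]: "X \<in> sets borel" using X(2) by (rule borel_compact)
  note [measurable] = F(1)
  \<comment> \<open>This inner integral stands for the exponential of minus the gauge of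
    \<open>X\<close>. It is at most 1, so passing to a real number by \<open>enn2real\<close> loses
    nothing.\<close>
  let ?I = "\<lambda>x. \<integral>\<^sup>+t. ennreal (indicator {0<..} t * exp (- t) * indicator X ((1/t) *\<^sub>R orth_proj F x)) \<partial>lborel"
  define H where "H x = enn2real (?I x) * gw C x" for x
  have I: "ennreal (enn2real (?I x)) = ?I x" for x
    using layer_integral_le_1[of X "\<lambda>t. (1/t) *\<^sub>R orth_proj F x"] by (intro ennreal_enn2real) (simp add: order_le_less_trans)
  \<comment> \<open>Without a lift some projections may vanish, and the transport divides by
    lengths. Removing them leaves frame and trace intact and can only lower the total
    weight.\<close>
  define V where "V = {u \<in> U. p u \<noteq> 0}"
  have finV: "finite V" and VU: "V \<subseteq> U" using fin by (auto simp: V_def)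
  have toV: "(\<Sum>u\<in>V. f u) = (\<Sum>u\<in>U. f u)" if "\<And>u. p u = 0 \<Longrightarrow> f u = 0" for f :: "'u \<Rightarrow> 'z::comm_monoid_add"
    using that fin by (intro sum.mono_neutral_left) (auto simp: V_def)
  have trV: "(\<Sum>u\<in>V. lam u * (norm (p u))\<^sup>2) = dim F"
    using toV[of "\<lambda>u. lam u * (norm (p u))\<^sup>2"] frame_trace[OF F(1) frame p] by simp
  have "V \<noteq> {}" 
  proof
    assume "V = {}"
    then have "0 = real (dim F)" using trV by (simp only: sum.empty)
    then show False using F(2) by linarith
  qed
  then have "0 < sum lam V" using finV VU lam by (intro sum_pos) auto
  also have LV: "sum lam V \<le> L" unfolding L[symmetric] using VU fin lam by (intro sum_mono2) (auto simp: less_imp_le)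
  finally have L0: "0 < L" .
  have "ennreal (2 powr dim F * (dim F / L) powr (dim F / 2)) \<le> (\<integral>\<^sup>+x. ennreal (H x) \<partial>lborel)"
  proof (rule gaussian_transport[OF finV, where w = p and lam = lam and C = C and T = T and T' = T' and \<tau> = abs])
    show "0 < lam u" "p u \<noteq> 0" if "u \<in> V" for u using that lam by (auto simp: V_def)
    show "orthonormal C" by fact
    show "(\<Sum>u\<in>V. (lam u * (p u \<bullet> x)) *\<^sub>R p u) + (\<Sum>c\<in>C. (c \<bullet> x) *\<^sub>R c) = x" for x
      using toV[of "\<lambda>u. (lam u * (p u \<bullet> x)) *\<^sub>R p u"] by (simp add: frame perp_expand[OF F(1) C])
    show "H \<in> borel_measurable borel" unfolding H_def[abs_def] by measurable
    show "0 \<le> H z" for z unfolding H_def using gw_pos[of C z] by simp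
    show "(\<Sum>u\<in>V. lam u * (norm (p u))\<^sup>2) = real (dim F)" by (rule trV)
    show "exp (- (\<Sum>u\<in>V. lam u * (norm (p u))\<^sup>2 * \<bar>\<theta> u\<bar>)) * (\<Prod>c\<in>C. gauss (c \<bullet> y))
      \<le> H ((\<Sum>u\<in>V. (lam u * (norm (p u))\<^sup>2 * \<theta> u) *\<^sub>R p u) + (\<Sum>c\<in>C. (c \<bullet> y) *\<^sub>R c))" for y \<theta>
    proof -
      define b where "b u = lam u * (norm (p u))\<^sup>2 * \<theta> u" for u
      define A where "A = (\<Sum>u\<in>V. \<bar>b u\<bar>)"
      have Aeq: "A = (\<Sum>u\<in>V. lam u * (norm (p u))\<^sup>2 * \<bar>\<theta> u\<bar>)"
        unfolding A_def b_def by (intro sum.cong refl) (simp add: abs_mult abs_of_pos[OF lam] subsetD[OF VU])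
      have A0: "0 \<le> A" by (simp add: A_def sum_nonneg)
      define z where "z = (\<Sum>u\<in>V. b u *\<^sub>R p u) + (\<Sum>c\<in>C. (c \<bullet> y) *\<^sub>R c)"
      have fz: "z = (\<Sum>u\<in>V. b u *\<^sub>R p u) + (y - orth_proj F y)"
        by (simp add: z_def perp_expand[OF F(1) C])
      have inF: "(\<Sum>u\<in>V. b u *\<^sub>R p u) \<in> F" using F(1) p VU by (intro subspace_sum subspace_scale) auto
      have Pz: "orth_proj F z = (\<Sum>u\<in>V. b u *\<^sub>R p u)"
        unfolding fz linear_add[OF linear_orth_proj[OF F(1)]] linear_diff[OF linear_orth_proj[OF F(1)]]
        by (simp add: orth_proj_id[OF F(1) inF] orth_proj_id[OF F(1) orth_proj_in[OF F(1)]])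
      have gz: "gw C z = (\<Prod>c\<in>C. gauss (c \<bullet> y))"
        unfolding gw_def fz
        by (intro prod.cong refl) (simp add: inner_add_right inner_diff_right perp_inner[OF F(1) C _ inF] perp_inner[OF F(1) C _ orth_proj_in[OF F(1)]])
      \<comment> \<open>The gauge estimate: every dilate \<open>t\<close> times \<open>X\<close>
        with \<open>t \<ge> A\<close> contains the projected point, so the inner integral is at
        least the exponential tail from \<open>A\<close>.\<close>
      have inX: "(1 / t) *\<^sub>R orth_proj F z \<in> X" if t: "0 < t" "A \<le> t" for t
      proof -
        have "(1 / t) *\<^sub>R orth_proj F z = (\<Sum>u\<in>V. (b u / t) *\<^sub>R p u)"
          by (simp add: Pz scaleR_sum_right)
        also have "\<dots> \<in> X"
        proof (rule convex_abs_combination[OF X(3)])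
          have "(\<Sum>u\<in>V. \<bar>b u / t\<bar>) = A / t" using t by (simp add: A_def sum_divide_distrib)
          then show "(\<Sum>u\<in>V. \<bar>b u / t\<bar>) \<le> 1" using t by simp
        qed (use X(4,5) VU finV \<open>V \<noteq> {}\<close> in auto)
        finally show ?thesis .
      qed
      have "ennreal (exp (- A)) = (\<integral>\<^sup>+t. ennreal (indicator {A..} t * exp (- t)) \<partial>lborel)"
        by (rule nn_integral_exp_tail[symmetric])
      also have "\<dots> \<le> ?I z"
      proof (rule nn_integral_mono_AE, rule AE_mp[OF AE_lborel_singleton[of 0]], rule AE_I2, rule impI, rule ennreal_leI)
        fix t :: real assume "t \<noteq> 0"
        then show "indicator {A..} t * exp (- t) \<le> indicator {0<..} t * exp (- t) * indicator X ((1/t) *\<^sub>R orth_proj F z)"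
          using inX[of t] A0 by (auto simp: indicator_def)
      qed
      finally have "ennreal (exp (- A)) \<le> ennreal (enn2real (?I z))" using I[of z] by simp
      then have "exp (- A) \<le> enn2real (?I z)" by (simp add: ennreal_le_iff)
      then have "exp (- A) * gw C z \<le> H z" unfolding H_def using gw_pos[of C z] by (intro mult_right_mono) auto
      then show ?thesis unfolding gz unfolding Aeq z_def b_def .
    qed
  qed (use T F LV L0 in auto)
  also have "(\<integral>\<^sup>+x. ennreal (H x) \<partial>lborel) = ennreal (fact (dim F) * vol_sub F X)"
  proof -
    have "(\<integral>\<^sup>+x. ennreal (H x) \<partial>lborel) = (\<integral>\<^sup>+x. (\<integral>\<^sup>+t. ennreal (layer F C X t x) \<partial>lborel) \<partial>lborel)"
    proof (intro nn_integral_cong)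
      fix x
      have "ennreal (H x) = ennreal (enn2real (?I x)) * ennreal (gw C x)"
        unfolding H_def by (rule ennreal_mult[OF enn2real_nonneg less_imp_le[OF gw_pos]])
      also have "\<dots> = ?I x * ennreal (gw C x)" by (simp only: I)
      also have "\<dots> = (\<integral>\<^sup>+t. ennreal (indicator {0<..} t * exp (- t) * indicator X ((1/t) *\<^sub>R orth_proj F x)) * ennreal (gw C x) \<partial>lborel)"
        by (rule nn_integral_multc[symmetric]) measurable
      finally show "ennreal (H x) = (\<integral>\<^sup>+t. ennreal (layer F C X t x) \<partial>lborel)"
        using gw_pos[of C x] by (simp add: ennreal_mult'' less_imp_le)
    qed
    then show ?thesis by (simp add: nn_integral_layers[OF F(1) C X(1,2)])
  qed
  finally show ?thesis by (simp add: vol_sub_def)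
qed

subsection \<open>Volumes of the cross-polytope and the regular simplex\<close>

declare dim_eq_0 [simp del] \<comment> \<open>rewrites \<open>dim F = 0\<close> to \<open>F \<subseteq> {0}\<close>, which hides the exponent\<close>

lemma nn_integral_coords_prod:
  fixes F :: "'a::euclidean_space set"
  assumes F: "subspace F" and C: "orthonormal C" "span C = orthogonal_comp F"
    and f [measurable]: "\<And>k. f k \<in> borel_measurable borel"
  shows "(\<integral>\<^sup>+x. (\<Prod>k<dim F. f k (x \<bullet> onb F k)) * ennreal (gw C x) \<partial>lborel) = (\<Prod>k<dim F. \<integral>\<^sup>+t. f k t \<partial>lborel)"
proof -
  interpret product_sigma_finite "\<lambda>_::nat. lborel :: real measure" ..
  let ?M = "lebs (dim F)"
  let ?h = "\<lambda>z. \<Prod>k<dim F. f k (z k)"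
  have h: "?h \<in> borel_measurable ?M"
    by (intro borel_measurable_prod_ennreal measurable_compose[OF measurable_component_singleton]) simp_all
  have "(\<integral>\<^sup>+x. (\<Prod>k<dim F. f k (x \<bullet> onb F k)) * ennreal (gw C x) \<partial>lborel) = (\<integral>\<^sup>+x. ennreal (gw C x) * ?h (coords F x) \<partial>lborel)"
    by (intro nn_integral_cong) (simp add: coords_def mult.commute)
  also have "\<dots> = (\<integral>\<^sup>+x. ?h (coords F x) \<partial>density lborel (\<lambda>x. ennreal (gw C x)))"
    by (rule nn_integral_density[symmetric]) (use measurable_compose[OF measurable_coords h] in auto)
  also have "\<dots> = (\<integral>\<^sup>+z. ?h z \<partial>distr (density lborel (\<lambda>x. ennreal (gw C x))) ?M (coords F))"
    by (rule nn_integral_distr[symmetric]) (use h in auto)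
  also have "\<dots> = (\<Prod>k<dim F. \<integral>\<^sup>+t. f k t \<partial>lborel)"
    unfolding distr_coords[OF F C] by (rule product_nn_integral_prod) auto
  finally show ?thesis .
qed

lemma nn_integral_exp_abs: "(\<integral>\<^sup>+t. ennreal (exp (- \<bar>t\<bar>)) \<partial>lborel) = 2"
proof -
  have "(\<integral>\<^sup>+t. ennreal (exp (- \<bar>t\<bar>)) \<partial>lborel)
    = (\<integral>\<^sup>+t. ennreal (indicator {0..} t * exp (- t)) + ennreal (indicator {0..} (- t) * exp (- (- t))) \<partial>lborel)"
    by (rule nn_integral_cong_AE, rule AE_mp[OF AE_lborel_singleton[of 0]]) (auto simp: indicator_def)
  also have "\<dots> = (\<integral>\<^sup>+t. ennreal (indicator {0..} t * exp (- t)) \<partial>lborel) + (\<integral>\<^sup>+t. ennreal (indicator {0..} (- t) * exp (- (- t))) \<partial>lborel)"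
    by (rule nn_integral_add) measurable
  also have "(\<integral>\<^sup>+t. ennreal (indicator {0..} (- t) * exp (- (- t))) \<partial>lborel) = (\<integral>\<^sup>+t. ennreal (indicator {0..} t * exp (- t)) \<partial>lborel)"
    using nn_integral_real_affine[of "\<lambda>t. ennreal (indicator {0..} t * exp (- t))" "-1" 0] by simp
  also have "(\<integral>\<^sup>+t. ennreal (indicator {0..} t * exp (- t)) \<partial>lborel) = 1"
    using nn_integral_exp_tail[of 0] by (simp only: minus_zero exp_zero ennreal_1)
  finally show ?thesis by simp
qed

text \<open>The polytope is the unit ball of the 1-norm in the coordinates of \<open>onb F\<close>:
  that ball is convex and contains the vertices, and conversely the coordinates themselves are
  admissible signed coefficients.\<close>

lemma cross_polytope_in_iff:
  fixes F :: "'a::euclidean_space set"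
  assumes F: "subspace F" "0 < dim F" and x: "x \<in> F"
  shows "x \<in> cross_polytope_in F \<longleftrightarrow> (\<Sum>k<dim F. \<bar>x \<bullet> onb F k\<bar>) \<le> 1"
proof
  let ?D = "{x. (\<Sum>k<dim F. \<bar>x \<bullet> onb F k\<bar>) \<le> 1}"
  have "convex ?D"
  proof (rule convexI, simp)
    fix y z :: 'a and u v :: real
    assume y: "(\<Sum>k<dim F. \<bar>y \<bullet> onb F k\<bar>) \<le> 1" and z: "(\<Sum>k<dim F. \<bar>z \<bullet> onb F k\<bar>) \<le> 1"
      and uv: "0 \<le> u" "0 \<le> v" "u + v = 1"
    have "(\<Sum>k<dim F. \<bar>(u *\<^sub>R y + v *\<^sub>R z) \<bullet> onb F k\<bar>) \<le> (\<Sum>k<dim F. u * \<bar>y \<bullet> onb F k\<bar> + v * \<bar>z \<bullet> onb F k\<bar>)"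
    proof (rule sum_mono)
      fix k
      have "\<bar>u * (y \<bullet> onb F k) + v * (z \<bullet> onb F k)\<bar> \<le> \<bar>u * (y \<bullet> onb F k)\<bar> + \<bar>v * (z \<bullet> onb F k)\<bar>" by (rule abs_triangle_ineq)
      then show "\<bar>(u *\<^sub>R y + v *\<^sub>R z) \<bullet> onb F k\<bar> \<le> u * \<bar>y \<bullet> onb F k\<bar> + v * \<bar>z \<bullet> onb F k\<bar>"
        using uv by (simp add: inner_add_left abs_mult)
    qed
    also have "\<dots> = u * (\<Sum>k<dim F. \<bar>y \<bullet> onb F k\<bar>) + v * (\<Sum>k<dim F. \<bar>z \<bullet> onb F k\<bar>)"
      by (simp add: sum.distrib sum_distrib_left)
    also have "\<dots> \<le> u * 1 + v * 1" using y z uv by (intro add_mono mult_left_mono) auto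
    finally show "(\<Sum>k<dim F. \<bar>(u *\<^sub>R y + v *\<^sub>R z) \<bullet> onb F k\<bar>) \<le> 1" using uv by simp
  qed
  moreover have "onb F i \<in> ?D" "- onb F i \<in> ?D" if i: "i < dim F" for i
  proof -
    have "(\<Sum>k<dim F. \<bar>onb F i \<bullet> onb F k\<bar>) = (\<Sum>k<dim F. if k = i then 1 else 0)"
      using i F(1) by (intro sum.cong) (auto simp: onb_inner)
    then show "onb F i \<in> ?D" "- onb F i \<in> ?D" using i by simp_all
  qed
  ultimately have "cross_polytope_in F \<subseteq> ?D"
    unfolding cross_polytope_in_def by (intro hull_minimal) auto
  then show "x \<in> cross_polytope_in F \<Longrightarrow> (\<Sum>k<dim F. \<bar>x \<bullet> onb F k\<bar>) \<le> 1" by auto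
next
  assume le: "(\<Sum>k<dim F. \<bar>x \<bullet> onb F k\<bar>) \<le> 1"
  have "(\<Sum>k<dim F. (x \<bullet> onb F k) *\<^sub>R onb F k) \<in> cross_polytope_in F"
    unfolding cross_polytope_in_def using F(2) le
    by (intro convex_abs_combination[OF convex_convex_hull]) (auto intro!: hull_inc)
  then show "x \<in> cross_polytope_in F" by (simp add: onb_expand[OF F(1)] orth_proj_id[OF F(1) x])
qed

lemma convex_hull_finite_in_subspace:
  fixes F :: "'a::euclidean_space set"
  assumes "subspace F" "finite S" "S \<subseteq> F"
  shows "convex hull S \<subseteq> F" "compact (convex hull S)"
  by (rule hull_minimal[where S = convex, OF assms(3) subspace_imp_convex[OF assms(1)]])
     (rule finite_imp_compact_convex_hull[OF assms(2)])

text \<open>The gauge is the 1-norm, so its exponential factors over the coordinates and every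
  factor integrates to 2.\<close>

lemma vol_cross_polytope:
  fixes F :: "'a::euclidean_space set"
  assumes F: "subspace F" "0 < dim F"
  shows "fact (dim F) * vol_sub F (cross_polytope_in F) = 2 ^ dim F"
proof -
  obtain C where C: "orthonormal C" "span C = orthogonal_comp F"
    using ex_orthonormal_span[OF subspace_orthogonal_comp[of F]] by metis
  let ?X = "cross_polytope_in F"
  have X: "?X \<subseteq> F" "compact ?X"
    unfolding cross_polytope_in_def using onb_in[OF F(1)]
    by (intro convex_hull_finite_in_subspace[OF F(1)]; auto intro!: subspace_neg[OF F(1)])+
  have "ennreal (fact (dim F) * vol_sub F ?X) =
    (\<integral>\<^sup>+x. (\<integral>\<^sup>+t. ennreal (layer F C ?X t x) \<partial>lborel) \<partial>lborel)"
    by (rule nn_integral_layers[OF F(1) C X, symmetric])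
  also have "\<dots> = (\<integral>\<^sup>+x. (\<Prod>k<dim F. ennreal (exp (- \<bar>x \<bullet> onb F k\<bar>))) * ennreal (gw C x) \<partial>lborel)"
  proof (rule nn_integral_cong)
    fix x
    define A where "A = (\<Sum>k<dim F. \<bar>x \<bullet> onb F k\<bar>)"
    have A0: "0 \<le> A" by (simp add: A_def sum_nonneg)
    have iff: "(1/t) *\<^sub>R orth_proj F x \<in> ?X \<longleftrightarrow> A \<le> t" if "0 < t" for t
    proof -
      have "(\<Sum>k<dim F. \<bar>((1/t) *\<^sub>R orth_proj F x) \<bullet> onb F k\<bar>) = A / t"
        unfolding A_def sum_divide_distrib using that F(1)
        by (intro sum.cong refl) (simp add: orth_proj_self_adjoint orth_proj_id onb_in)
      then show ?thesis
        using cross_polytope_in_iff[OF F, of "(1/t) *\<^sub>R orth_proj F x"] that F(1)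
        by (simp add: subspace_scale orth_proj_in)
    qed
    have "(\<integral>\<^sup>+t. ennreal (layer F C ?X t x) \<partial>lborel)
      = (\<integral>\<^sup>+t. ennreal (indicator {A..} t * exp (- t)) * ennreal (gw C x) \<partial>lborel)"
    proof (rule nn_integral_cong_AE, rule AE_mp[OF AE_lborel_singleton[of 0]], rule AE_I2, rule impI)
      fix t :: real assume "t \<noteq> 0"
      then have "indicator {0<..} t * exp (- t) * indicator ?X ((1/t) *\<^sub>R orth_proj F x) = indicator {A..} t * exp (- t)"
        using iff[of t] A0 by (auto simp: indicator_def)
      then show "ennreal (layer F C ?X t x)
        = ennreal (indicator {A..} t * exp (- t)) * ennreal (gw C x)"
        using gw_pos[of C x] by (simp only: ennreal_mult'' less_imp_le)
    qed
    also have "\<dots> = (\<integral>\<^sup>+t. ennreal (indicator {A..} t * exp (- t)) \<partial>lborel) * ennreal (gw C x)"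
      by (rule nn_integral_multc) measurable
    also have "\<dots> = ennreal (exp (- A)) * ennreal (gw C x)" by (simp only: nn_integral_exp_tail)
    also have "ennreal (exp (- A)) = (\<Prod>k<dim F. ennreal (exp (- \<bar>x \<bullet> onb F k\<bar>)))"
      by (simp add: A_def sum_negf[symmetric] exp_sum prod_ennreal)
    finally show "(\<integral>\<^sup>+t. ennreal (layer F C ?X t x) \<partial>lborel)
      = (\<Prod>k<dim F. ennreal (exp (- \<bar>x \<bullet> onb F k\<bar>))) * ennreal (gw C x)" .
  qed
  also have "\<dots> = (\<Prod>k<dim F. \<integral>\<^sup>+t. ennreal (exp (- \<bar>t\<bar>)) \<partial>lborel)"
    by (rule nn_integral_coords_prod[OF F(1) C]) measurable
  also have "\<dots> = ennreal (2 ^ dim F)" by (simp add: nn_integral_exp_abs ennreal_power[symmetric])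
  finally show ?thesis by (simp add: vol_sub_def)
qed

text \<open>\<open>reg_simplex_in\<close> chooses its vertices by \<open>SOME\<close>, so it denotes
  a simplex only once existence is shown. The construction shifts scaled basis vectors along their
  sum \<open>S\<close> and adds a last vertex on the opposite ray.\<close>

lemma ex_reg_simplex_vertices:
  fixes F :: "'a::euclidean_space set"
  assumes F: "subspace F"
  shows "\<exists>v. reg_simplex_vertices F v"
proof (cases "dim F = 0")
  case True
  then show ?thesis unfolding reg_simplex_vertices_def by (intro exI[of _ "\<lambda>_. 0"]) (simp add: True)
next
  case False
  define s where "s = real (dim F)"
  have s: "0 < s" using False by (simp add: s_def)
  \<comment> \<open>\<open>r\<close> gives the last vertex norm 1;
    \<open>\<alpha>^2 = 1 + 1 / s\<close> is the gap between the diagonal and off-diagonal inner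
    products 1 and \<open>- 1 / s\<close>; \<open>\<beta>\<close> makes the vertices sum to
    zero.\<close>
  define r where "r = 1 / sqrt s"
  define \<alpha> where "\<alpha> = sqrt (1 + 1 / s)"
  define \<beta> where "\<beta> = (\<alpha> - r) / s"
  have r2: "r * r = 1 / s" using s by (simp add: r_def)
  have a2: "\<alpha> * \<alpha> = 1 + 1 / s" using s by (simp add: \<alpha>_def)
  have b: "s * \<beta> = \<alpha> - r" using s by (simp add: \<beta>_def)
  have sr: "s * r * r = 1" using s r2 by (simp add: mult.assoc)
  have q: "\<beta> * \<beta> * s - 2 * \<alpha> * \<beta> = - 1 / s"
  proof -
    have "s * (\<beta> * \<beta> * s - 2 * \<alpha> * \<beta>) = (s * \<beta>) * (s * \<beta> - 2 * \<alpha>)" by (simp add: algebra_simps)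
    also have "\<dots> = r * r - \<alpha> * \<alpha>" unfolding b by (simp add: algebra_simps)
    also have "\<dots> = - 1" unfolding r2 a2 by simp
    finally show ?thesis using s by (simp add: field_simps)
  qed
  define S where "S = (\<Sum>i<dim F. onb F i)"
  have bS: "onb F i \<bullet> S = 1" if "i < dim F" for i
  proof -
    have "onb F i \<bullet> S = (\<Sum>j<dim F. if j = i then 1 else 0)"
      unfolding S_def inner_sum_right using that F by (intro sum.cong) (auto simp: onb_inner)
    then show ?thesis using that by simp
  qed
  have SS: "S \<bullet> S = s"
  proof -
    have "S \<bullet> S = (\<Sum>i<dim F. onb F i \<bullet> S)" by (simp add: S_def inner_sum_left)
    then show ?thesis by (simp add: bS s_def)
  qed
  have SF: "S \<in> F" unfolding S_def using F by (intro subspace_sum onb_in) auto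
  define v where "v i = (if i < dim F then \<alpha> *\<^sub>R onb F i - \<beta> *\<^sub>R S else - (r *\<^sub>R S))" for i
  have inner: "v i \<bullet> v j = (if i = j then 1 else - 1 / s)" if ij: "i \<le> dim F" "j \<le> dim F" for i j
  proof -
    have 1: "v i \<bullet> v j = \<alpha> * \<alpha> * (if i = j then 1 else 0) + (\<beta> * \<beta> * s - 2 * \<alpha> * \<beta>)" if "i < dim F" "j < dim F" for i j
    proof -
      have "v i \<bullet> v j = \<alpha> * \<alpha> * (onb F i \<bullet> onb F j) - \<alpha> * \<beta> * (onb F i \<bullet> S) - \<beta> * \<alpha> * (onb F j \<bullet> S) + \<beta> * \<beta> * (S \<bullet> S)"
        using that by (simp add: v_def inner_diff_left inner_diff_right inner_commute[of S "onb F j"] right_diff_distrib mult.assoc)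
      then show ?thesis using that F by (simp add: bS SS onb_inner algebra_simps)
    qed
    have 2: "v i \<bullet> v j = - 1 / s" if "i < dim F" "\<not> j < dim F" for i j
    proof -
      have "v i \<bullet> v j = - (r * (\<alpha> - s * \<beta>))"
        using that by (simp add: v_def inner_diff_left bS SS right_diff_distrib mult_ac)
      then show ?thesis unfolding b by (simp add: r2)
    qed
    have 3: "v i \<bullet> v j = 1" if "\<not> i < dim F" "\<not> j < dim F" for i j
      using that sr by (simp add: v_def SS mult_ac)
    show ?thesis
    proof (cases "i < dim F"; cases "j < dim F")
      assume "i < dim F" "j < dim F"
      then show ?thesis using 1[of i j] by (simp add: q a2)
    next
      assume "i < dim F" "\<not> j < dim F"
      then show ?thesis using 2[of i j] by auto
    next
      assume "\<not> i < dim F" "j < dim F"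
      then show ?thesis using 2[of j i] by (auto simp: inner_commute)
    next
      assume "\<not> i < dim F" "\<not> j < dim F"
      then show ?thesis using 3[of i j] ij by auto
    qed
  qed
  have vF: "v i \<in> F" if "i \<le> dim F" for i
    using F that SF by (auto simp: v_def intro!: subspace_diff subspace_scale subspace_neg onb_in)
  have "reg_simplex_vertices F v"
    unfolding reg_simplex_vertices_def
  proof (intro conjI impI allI exI)
    fix i assume i: "i \<le> dim F"
    show "v i \<in> F" by (rule vF[OF i])
    show "norm (v i) = 1" using inner[OF i i] by (simp add: norm_eq_1)
  next
    show "inj_on v {..dim F}"
    proof (rule inj_onI, rule ccontr)
      fix i j assume ij: "i \<in> {..dim F}" "j \<in> {..dim F}" "v i = v j" "i \<noteq> j"
      then have "1 = - 1 / s" using inner[of i j] inner[of i i] by simp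
      moreover have "- 1 / s < 0" using s by simp
      ultimately show False by linarith
    qed
  next
    fix i j assume ij: "i \<le> dim F" "j \<le> dim F" "i \<noteq> j"
    then show "dist (v i) (v j) = sqrt (2 + 2 / s)"
      by (simp add: dist_norm norm_eq_sqrt_inner inner_diff_left inner_diff_right inner)
  qed (use False in simp)
  then show ?thesis by blast
qed

text \<open>Only the defining properties of the chosen vertices are available. Equal distances
  between unit vectors give one common inner product \<open>g\<close>; \<open>dim F + 1\<close>
  vectors in dimension \<open>dim F\<close> are dependent, and the dependency forces
  \<open>1 + g * dim F = 0\<close>.\<close>

lemma reg_simplex_inner:
  fixes F :: "'a::euclidean_space set"
  assumes F: "0 < dim F" and v: "reg_simplex_vertices F v" and ij: "i \<le> dim F" "j \<le> dim F"
  shows "v i \<bullet> v j = (if i = j then 1 else - 1 / dim F)"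
proof -
  let ?I = "{..dim F}"
  have vF: "\<And>i. i \<le> dim F \<Longrightarrow> v i \<in> F" and n1: "\<And>i. i \<le> dim F \<Longrightarrow> v i \<bullet> v i = 1" and inj: "inj_on v ?I"
    using v F by (auto simp: reg_simplex_vertices_def norm_eq_1)
  obtain a where a: "\<And>i j. i \<le> dim F \<Longrightarrow> j \<le> dim F \<Longrightarrow> i \<noteq> j \<Longrightarrow> dist (v i) (v j) = a"
    using v F unfolding reg_simplex_vertices_def by blast
  define g where "g = 1 - a\<^sup>2 / 2"
  have g: "v i \<bullet> v j = g" if "i \<le> dim F" "j \<le> dim F" "i \<noteq> j" for i j
  proof -
    have "a\<^sup>2 = (v i - v j) \<bullet> (v i - v j)" using a[OF that] by (simp add: dist_norm power2_norm_eq_inner[symmetric])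
    also have "\<dots> = 2 - 2 * (v i \<bullet> v j)" using n1 that by (simp add: inner_diff_left inner_diff_right inner_commute)
    finally show ?thesis by (simp add: g_def field_simps)
  qed
  have g1: "g \<noteq> 1"
  proof
    assume "g = 1"
    then have "dist (v 0) (v 1) = 0" using a[of 0 1] F by (simp add: g_def)
    then show False using inj_onD[OF inj, of 0 1] F by simp
  qed
  have "dependent (v ` ?I)"
  proof (rule ccontr)
    assume "independent (v ` ?I)"
    then have "card (v ` ?I) \<le> dim F" using vF by (intro independent_card_le_dim) auto
    then show False using inj by (simp add: card_image)
  qed
  then obtain u where u: "\<exists>x\<in>v ` ?I. u x \<noteq> 0" "(\<Sum>x\<in>v ` ?I. u x *\<^sub>R x) = 0"
    using dependent_finite[of "v ` ?I"] by auto
  define c where "c i = u (v i)" for i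
  have c0: "(\<Sum>i\<in>?I. c i *\<^sub>R v i) = 0" using u(2) by (simp add: sum.reindex[OF inj] c_def)
  \<comment> \<open>The dependency paired with \<open>v j\<close>. As \<open>g\<close> is not 1,
    every coefficient has the same value, which is nonzero because one of them is.\<close>
  have cj: "(1 - g) * c j + g * sum c ?I = 0" if j: "j \<in> ?I" for j
  proof -
    have "0 = (\<Sum>i\<in>?I. c i * (v i \<bullet> v j))"
      using arg_cong[OF c0, of "\<lambda>x. x \<bullet> v j"] by (simp add: inner_sum_left)
    also have "\<dots> = c j * (v j \<bullet> v j) + (\<Sum>i\<in>?I - {j}. c i * (v i \<bullet> v j))"
      using j by (simp add: sum.remove)
    also have "(\<Sum>i\<in>?I - {j}. c i * (v i \<bullet> v j)) = (\<Sum>i\<in>?I - {j}. c i * g)"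
      using j by (intro sum.cong refl) (simp add: g)
    also have "c j * (v j \<bullet> v j) = c j" using j n1 by simp
    also have "(\<Sum>i\<in>?I - {j}. c i * g) = g * (sum c ?I - c j)"
      using j by (subst sum_distrib_right[symmetric]) (simp add: sum_diff1 mult.commute)
    finally show ?thesis by (simp add: algebra_simps)
  qed
  define t where "t = - g * sum c ?I / (1 - g)"
  have ct: "c j = t" if "j \<in> ?I" for j
    using cj[OF that] g1 by (simp add: t_def field_simps)
  obtain i0 where i0: "i0 \<in> ?I" "c i0 \<noteq> 0" using u(1) by (auto simp: c_def)
  have "sum c ?I = (real (dim F) + 1) * t" using ct by simp
  then have "t * ((1 - g) + g * (real (dim F) + 1)) = 0" using cj[OF i0(1)] ct[OF i0(1)] by (simp add: algebra_simps)
  then have "(1 - g) + g * (real (dim F) + 1) = 0" using i0 ct by auto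
  then have "g * real (dim F) = - 1" by (simp add: algebra_simps)
  then have "g = - 1 / dim F" 
  proof -
    have "real (dim F) \<noteq> 0" using F by linarith
    then show ?thesis using \<open>g * real (dim F) = - 1\<close> nonzero_eq_divide_eq[of "real (dim F)" g "- 1"] by blast
  qed
  then show ?thesis using g[OF ij] n1[OF ij(1)] by auto
qed

lemma onbasisI_card:
  fixes S :: "'a::euclidean_space set"
  assumes "orthonormal S" "card S = DIM('a)"
  shows "onbasis S"
  unfolding onbasis_def
proof
  show "span S = UNIV"
    using card_ge_dim_independent[of S UNIV] orthonormal_independent[OF assms(1)] assms(2)
    by (auto simp: dim_UNIV)
qed (rule assms(1))

text \<open>Open and closed half-lines are treated together because the simplex cone is later
  squeezed between an open and a closed orthant.\<close>

lemma nn_integral_exp_scaled: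
  assumes "0 < b" and J: "J = {0<..} \<or> J = {0..}"
  shows "(\<integral>\<^sup>+t. ennreal (indicator J t * exp (- (b * t))) \<partial>lborel) = ennreal (1 / b)"
proof -
  have "(\<integral>\<^sup>+t. ennreal (indicator J t * exp (- (b * t))) \<partial>lborel) = (\<integral>\<^sup>+t. ennreal (indicator {0..} (0 + b * t) * exp (- (0 + b * t))) \<partial>lborel)"
    by (rule nn_integral_cong_AE, rule AE_mp[OF AE_lborel_singleton[of 0]], rule AE_I2)
      (use assms in \<open>auto simp: indicator_def zero_le_mult_iff\<close>)
  moreover have "(\<integral>\<^sup>+t. ennreal (indicator {0..} t * exp (- t)) \<partial>lborel) = ennreal \<bar>b\<bar> * (\<integral>\<^sup>+t. ennreal (indicator {0..} (0 + b * t) * exp (- (0 + b * t))) \<partial>lborel)"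
    using assms by (intro nn_integral_real_affine) auto
  moreover have "(\<integral>\<^sup>+t. ennreal (indicator {0..} t * exp (- t)) \<partial>lborel) = 1"
    using nn_integral_exp_tail[of 0] by (simp only: minus_zero exp_zero ennreal_1)
  ultimately have 1: "1 = ennreal b * (\<integral>\<^sup>+t. ennreal (indicator J t * exp (- (b * t))) \<partial>lborel)"
    using assms by simp
  have "ennreal (1/b) = ennreal (1/b) * (ennreal b * (\<integral>\<^sup>+t. ennreal (indicator J t * exp (- (b * t))) \<partial>lborel))"
    by (simp only: 1[symmetric] mult_1_right)
  also have "\<dots> = (\<integral>\<^sup>+t. ennreal (indicator J t * exp (- (b * t))) \<partial>lborel)"
  proof -
    have "ennreal (1/b) * ennreal b = 1" using assms by (simp add: ennreal_mult'[symmetric])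
    then show ?thesis unfolding mult.assoc[symmetric] by (simp only: mult_1_left)
  qed
  finally show ?thesis by simp
qed

text \<open>The vectors \<open>(v i, 1 / sqrt s)\<close> are pairwise orthogonal of equal length, so
  the cone over the simplex is an orthant in suitable orthonormal coordinates and the cone integral
  becomes a product of one-dimensional exponentials.\<close>

lemma vol_reg_simplex:
  fixes F :: "'a::euclidean_space set"
  assumes F: "subspace F" "0 < dim F"
  shows "fact (dim F) * vol_sub F (reg_simplex_in F) / sqrt (dim F)
    = ((real (dim F) + 1) / dim F) powr ((real (dim F) + 1) / 2)"
proof -
  obtain C where C: "orthonormal C" "span C = orthogonal_comp F"
    using ex_orthonormal_span[OF subspace_orthogonal_comp[of F]] by metis
  define v where "v = (SOME v. reg_simplex_vertices F v)"
  have v: "reg_simplex_vertices F v"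
    unfolding v_def by (rule someI_ex[OF ex_reg_simplex_vertices[OF F(1)]])
  let ?I = "{..dim F}" and ?X = "reg_simplex_in F"
  have Xv: "?X = convex hull (v ` ?I)" by (simp add: reg_simplex_in_def v_def)
  have vF: "\<And>i. i \<in> ?I \<Longrightarrow> v i \<in> F" and injv: "inj_on v ?I"
    using v F(2) by (auto simp: reg_simplex_vertices_def)
  note vin = reg_simplex_inner[OF F(2) v]
  have X: "?X \<subseteq> F" "compact ?X"
    unfolding Xv using vF by (intro convex_hull_finite_in_subspace[OF F(1)]; auto)+
  have Xb [measurable]: "?X \<in> sets borel" using X(2) by (rule borel_compact)
  note [measurable] = F(1)
  define s where "s = real (dim F)"
  have s: "0 < s" using F(2) by (simp add: s_def)
  \<comment> \<open>Normalising factor: the vector \<open>(v i, 1 / sqrt s)\<close> has squared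
    length \<open>1 + 1 / s\<close>.\<close>
  define b where "b = sqrt (s / (s + 1))"
  have b: "0 < b" "b * b = s / (s + 1)" using s by (auto simp: b_def)
  define w where "w i = (b *\<^sub>R v i, b / sqrt s)" for i
  define C' where "C' = (\<lambda>c. (c, 0::real)) ` C"
  have injC: "inj_on (\<lambda>c::'a. (c, 0::real)) C" by (auto simp: inj_on_def)
  have finC: "finite C" using C(1) by (rule orthonormal_finite)
  have win: "w i \<bullet> w j = (if i = j then 1 else 0)" if "i \<in> ?I" "j \<in> ?I" for i j
  proof -
    have "w i \<bullet> w j = (b * b) * (v i \<bullet> v j + 1 / s)"
      using s by (simp add: w_def inner_prod_def algebra_simps)
    also have "\<dots> = (s / (s + 1)) * (if i = j then (s + 1) / s else 0)"
      using that s vin[of i j] by (simp add: b s_def[symmetric] add_divide_distrib)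
    finally show ?thesis using s by simp
  qed
  have injw: "inj_on w ?I"
    using win by (intro inj_onI) (metis zero_neq_one)
  have wC: "w i \<bullet> (c, 0) = 0" if "i \<in> ?I" "c \<in> C" for i c
    using perp_inner[OF F(1) C that(2) vF[OF that(1)]] by (simp add: w_def inner_prod_def inner_commute)
  have disj: "w ` ?I \<inter> C' = {}"
  proof (rule ccontr)
    assume "w ` ?I \<inter> C' \<noteq> {}"
    then obtain x where x: "x \<in> w ` ?I" "x \<in> C'" by blast
    then obtain i where "i \<in> ?I" "x = w i" by blast
    moreover obtain c where "c \<in> C" "x = (c, 0)" using x(2) unfolding C'_def by blast
    ultimately have ic: "i \<in> ?I" "c \<in> C" "w i = (c, 0)" by simp_all
    then show False using wC[OF ic(1,2)] win[OF ic(1,1)] by simp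
  qed
  have onS: "orthonormal (w ` ?I \<union> C')"
  proof -
    have "orthonormal C'" unfolding C'_def by (rule orthonormal_embed[OF C(1)])
    moreover have "orthonormal (w ` ?I)"
      using win by (auto simp: orthonormal_def pairwise_def orthogonal_def norm_eq_1 split: if_splits)
    moreover have "x \<bullet> y = 0" "y \<bullet> x = 0" if "x \<in> w ` ?I" "y \<in> C'" for x y
      using that wC by (auto simp: C'_def inner_commute)
    ultimately show ?thesis unfolding orthonormal_def pairwise_def orthogonal_def by blast
  qed
  have S: "onbasis (w ` ?I \<union> C')"
  proof (rule onbasisI_card[OF onS])
    have "card (onb F ` {..<dim F} \<union> C) = DIM('a)" "onb F ` {..<dim F} \<inter> C = {}"
      using onbasis_card onbasis_Un[OF orthonormal_onb[OF F(1)] span_onb[OF F(1)] C] by blast+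
    then have "dim F + card C = DIM('a)"
      using finC by (simp add: card_Un_disjoint card_image[OF inj_onb[OF F(1)]])
    then show "card (w ` ?I \<union> C') = DIM('a \<times> real)"
      using disj finC by (simp add: card_Un_disjoint card_image[OF injw] C'_def card_image[OF injC])
  qed
  define f where "f J c t = (if c \<in> C' then gauss t else indicator J t * exp (- (b * t)))" for J c and t :: real
  have f0: "0 \<le> f J c t" for J c t using gauss_pos[of t] by (simp add: f_def)
  define P where "P J z = (\<Prod>c\<in>w ` ?I \<union> C'. f J c (z \<bullet> c))" for J z
  have P: "P J z = (\<Prod>i\<in>?I. indicator J (z \<bullet> w i) * exp (- (b * (z \<bullet> w i)))) * gw C (fst z)" for J z
  proof -
    have "P J z = (\<Prod>c\<in>w ` ?I. f J c (z \<bullet> c)) * (\<Prod>c\<in>C'. f J c (z \<bullet> c))"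
      unfolding P_def using disj finC by (intro prod.union_disjoint) (auto simp: C'_def)
    also have "(\<Prod>c\<in>C'. f J c (z \<bullet> c)) = (\<Prod>c\<in>C'. gauss (z \<bullet> c))"
      by (intro prod.cong) (auto simp: f_def)
    also have "\<dots> = gw C (fst z)"
      unfolding C'_def gw_def by (subst prod.reindex[OF injC]) (simp add: inner_prod_def inner_commute)
    also have "(\<Prod>c\<in>w ` ?I. f J c (z \<bullet> c)) = (\<Prod>i\<in>?I. indicator J (z \<bullet> w i) * exp (- (b * (z \<bullet> w i))))"
      unfolding prod.reindex[OF injw] o_def using disj by (intro prod.cong) (auto simp: f_def)
    finally show ?thesis .
  qed
  have intP: "(\<integral>\<^sup>+z. ennreal (P J z) \<partial>lborel) = ennreal ((1 / b) ^ (dim F + 1))" if J: "J = {0<..} \<or> J = {0..}" for J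
  proof -
    have Jb [measurable]: "J \<in> sets borel" using J by auto
    have "(\<integral>\<^sup>+z. ennreal (P J z) \<partial>lborel) = (\<integral>\<^sup>+z. (\<Prod>c\<in>w ` ?I \<union> C'. ennreal (f J c (z \<bullet> c))) \<partial>lborel)"
      unfolding P_def by (simp add: prod_ennreal f0)
    also have "\<dots> = (\<Prod>c\<in>w ` ?I \<union> C'. \<integral>\<^sup>+t. ennreal (f J c t) \<partial>lborel)"
      by (rule nn_integral_onbasis_prod[OF S]) (simp add: f_def[abs_def])
    also have "\<dots> = (\<Prod>c\<in>w ` ?I \<union> C'. if c \<in> C' then 1 else ennreal (1 / b))"
      by (intro prod.cong refl) (auto simp: f_def nn_integral_gauss nn_integral_exp_scaled[OF b(1) J] simp del: ennreal_mult ennreal_mult' ennreal_mult'')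
    also have "\<dots> = (\<Prod>c\<in>w ` ?I. if c \<in> C' then 1 else ennreal (1 / b)) * (\<Prod>c\<in>C'. if c \<in> C' then 1 else ennreal (1 / b))"
      using disj finC by (intro prod.union_disjoint) (auto simp: C'_def)
    also have "(\<Prod>c\<in>C'. if c \<in> C' then 1 else ennreal (1 / b)) = 1" by (rule prod.neutral) simp
    also have "(\<Prod>c\<in>w ` ?I. if c \<in> C' then 1 else ennreal (1 / b)) = (\<Prod>c\<in>w ` ?I. ennreal (1 / b))"
      using disj by (intro prod.cong) auto
    also have "\<dots> = ennreal ((1 / b) ^ (dim F + 1))"
      using b(1) by (simp only: prod_constant card_image[OF injw] card_atMost Suc_eq_plus1 ennreal_power zero_le_divide_1_iff less_imp_le)
    finally show ?thesis by simp
  qed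
  define H where "H z = indicator {0<..} (snd z) * exp (- (sqrt s * snd z)) * indicator ?X ((1 / (sqrt s * snd z)) *\<^sub>R orth_proj F (fst z)) * gw C (fst z)" for z
  have intH: "(\<integral>\<^sup>+z. ennreal (H z) \<partial>lborel) = ennreal (fact (dim F) * vol_sub F ?X / sqrt s)"
    unfolding H_def using s by (intro nn_integral_cone[OF F(1) C X]) simp
  \<comment> \<open>The cone agrees with an orthant only up to its boundary. Comparing with the
    products over the open and closed orthants avoids describing the boundary, since both products
    have the same integral.\<close>
  have sandwich: "P {0<..} z \<le> H z \<and> H z \<le> P {0..} z" for z
  proof -
    define \<theta> where "\<theta> i = z \<bullet> w i" for i
    define A where "A = sum \<theta> ?I"
    have ze: "z = (\<Sum>i\<in>?I. \<theta> i *\<^sub>R w i) + (\<Sum>c\<in>C'. (z \<bullet> c) *\<^sub>R c)"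
    proof -
      have "z = (\<Sum>c\<in>w ` ?I \<union> C'. (z \<bullet> c) *\<^sub>R c)" by (rule onbasis_expand[OF S, symmetric])
      also have "\<dots> = (\<Sum>c\<in>w ` ?I. (z \<bullet> c) *\<^sub>R c) + (\<Sum>c\<in>C'. (z \<bullet> c) *\<^sub>R c)"
        using disj finC by (intro sum.union_disjoint) (auto simp: C'_def)
      also have "(\<Sum>c\<in>w ` ?I. (z \<bullet> c) *\<^sub>R c) = (\<Sum>i\<in>?I. \<theta> i *\<^sub>R w i)"
        by (simp add: sum.reindex[OF injw] \<theta>_def)
      finally show ?thesis .
    qed
    have sC: "(\<Sum>c\<in>C'. (z \<bullet> c) *\<^sub>R c) = (fst z - orth_proj F (fst z), 0)"
      unfolding C'_def inner_commute[of z] by (rule perp_expand_embed[OF F(1) C])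
    have "fst z = (\<Sum>i\<in>?I. (\<theta> i * b) *\<^sub>R v i) + (fst z - orth_proj F (fst z))"
      using arg_cong[OF ze, of fst] unfolding sC fst_add fst_sum by (simp add: w_def)
    then have Pz: "orth_proj F (fst z) = b *\<^sub>R (\<Sum>i\<in>?I. \<theta> i *\<^sub>R v i)"
      by (simp add: scaleR_sum_right mult.commute)
    have sz0: "snd z = (\<Sum>i\<in>?I. \<theta> i * (b / sqrt s))"
      using arg_cong[OF ze, of snd] unfolding sC snd_add snd_sum by (simp add: w_def)
    have sz: "sqrt s * snd z = b * A"
      unfolding sz0 A_def sum_distrib_right[symmetric] using s by simp
    have pos: "0 < snd z \<longleftrightarrow> 0 < A"
      unfolding sz0 sum_distrib_right[symmetric] A_def[symmetric] using s b(1) by (simp add: zero_less_mult_iff zero_less_divide_iff)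
    have scaled: "(1 / (sqrt s * snd z)) *\<^sub>R orth_proj F (fst z) = (\<Sum>i\<in>?I. (\<theta> i / A) *\<^sub>R v i)"
      unfolding sz Pz using b(1) by (simp add: scaleR_sum_right)
    have Q: "P J z = (\<Prod>i\<in>?I. indicator J (\<theta> i)) * exp (- (b * A)) * gw C (fst z)" for J
      unfolding P \<theta>_def[symmetric] prod.distrib by (simp add: exp_sum[symmetric] A_def sum_negf sum_distrib_left)
    have g0: "0 < gw C (fst z)" by (rule gw_pos)
    have Heq: "H z = indicator {0<..} A * indicator ?X (\<Sum>i\<in>?I. (\<theta> i / A) *\<^sub>R v i) * exp (- (b * A)) * gw C (fst z)"
      unfolding H_def scaled unfolding sz by (simp add: indicator_def pos)
    have lower: "0 < A \<and> (\<Sum>i\<in>?I. (\<theta> i / A) *\<^sub>R v i) \<in> ?X" if "\<And>i. i \<in> ?I \<Longrightarrow> 0 < \<theta> i"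
    proof -
      have A: "0 < A" unfolding A_def using that by (intro sum_pos) auto
      have "(\<Sum>i\<in>?I. (\<theta> i / A) *\<^sub>R v i) \<in> convex hull (v ` ?I)"
        using A that by (intro convex_sum) (auto simp: A_def sum_divide_distrib[symmetric] less_imp_le intro!: hull_inc)
      then show ?thesis using A by (simp add: Xv)
    qed
    \<comment> \<open>Uniqueness of barycentric coordinates: the difference \<open>\<gamma>\<close>
      of two coefficient families has zero sum and zero combination, and pairing it with
      \<open>v j\<close> gives \<open>(1 + 1 / s) * \<gamma> j = 0\<close>.\<close>
    have upper: "0 \<le> \<theta> j" if A: "0 < A" and inX: "(\<Sum>i\<in>?I. (\<theta> i / A) *\<^sub>R v i) \<in> ?X" and j: "j \<in> ?I" for j
    proof -
      obtain u where u: "\<And>x. x \<in> v ` ?I \<Longrightarrow> 0 \<le> u x" "sum u (v ` ?I) = 1"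
        "(\<Sum>x\<in>v ` ?I. u x *\<^sub>R x) = (\<Sum>i\<in>?I. (\<theta> i / A) *\<^sub>R v i)"
        using inX unfolding Xv by (subst (asm) convex_hull_finite) auto
      define \<gamma> where "\<gamma> i = u (v i) - \<theta> i / A" for i
      have "sum \<gamma> ?I = 0"
        using u(2) A by (simp add: \<gamma>_def sum_subtractf sum.reindex[OF injv] sum_divide_distrib[symmetric] A_def)
      have \<gamma>v: "(\<Sum>i\<in>?I. \<gamma> i *\<^sub>R v i) = 0"
        using u(3) by (simp add: \<gamma>_def scaleR_diff_left sum_subtractf sum.reindex[OF injv])
      have "0 = (\<Sum>i\<in>?I. \<gamma> i * (v i \<bullet> v j))"
        using arg_cong[OF \<gamma>v, of "\<lambda>x. x \<bullet> v j"] by (simp add: inner_sum_left)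
      also have "\<dots> = (\<Sum>i\<in>?I. - (1 / s) * \<gamma> i + (if i = j then (1 + 1 / s) * \<gamma> i else 0))"
        using j by (intro sum.cong refl) (auto simp: vin s_def[symmetric] algebra_simps)
      also have "\<dots> = - (1 / s) * sum \<gamma> ?I + (1 + 1 / s) * \<gamma> j"
        unfolding sum.distrib sum_distrib_left[symmetric] using j by simp
      finally have "(1 + 1 / s) * \<gamma> j = 0" using \<open>sum \<gamma> ?I = 0\<close> by simp
      moreover have "1 + 1 / s > 0" using s by (simp add: add_pos_pos)
      ultimately have "\<gamma> j = 0" by simp
      then have "0 \<le> \<theta> j / A" using u(1)[of "v j"] j by (simp add: \<gamma>_def)
      then show ?thesis using A by (simp add: zero_le_divide_iff)
    qed
    have "P {0<..} z \<le> H z"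
    proof (cases "\<forall>i\<in>?I. 0 < \<theta> i")
      case True
      then show ?thesis using lower unfolding Q Heq by (auto simp: indicator_def)
    next
      case False
      then have 0: "(\<Prod>i\<in>?I. indicator {0<..} (\<theta> i)) = (0::real)" by (intro prod_zero) (auto simp: indicator_def)
      show ?thesis using g0 unfolding Q Heq 0 by simp
    qed
    moreover have "H z \<le> P {0..} z"
    proof (cases "0 < A \<and> (\<Sum>i\<in>?I. (\<theta> i / A) *\<^sub>R v i) \<in> ?X")
      case True
      then have 1: "(\<Prod>i\<in>?I. indicator {0..} (\<theta> i)) = (1::real)" using upper by (intro prod.neutral) (auto simp: indicator_def)
      show ?thesis using True unfolding Q Heq 1 by (simp add: indicator_def)
    next
      case False
      then have "H z = 0" unfolding Heq by (auto simp: indicator_def)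
      moreover have "0 \<le> P {0..} z" unfolding P_def by (intro prod_nonneg f0)
      ultimately show ?thesis by simp
    qed
    ultimately show ?thesis ..
  qed
  have "ennreal (fact (dim F) * vol_sub F ?X / sqrt s) = ennreal ((1 / b) ^ (dim F + 1))"
  proof (rule antisym)
    have iP: "(\<integral>\<^sup>+z. ennreal (P {0..} z) \<partial>lborel) = ennreal ((1 / b) ^ (dim F + 1))"
      "(\<integral>\<^sup>+z. ennreal (P {0<..} z) \<partial>lborel) = ennreal ((1 / b) ^ (dim F + 1))"
      by (rule intP; simp)+
    have "(\<integral>\<^sup>+z. ennreal (H z) \<partial>lborel) \<le> (\<integral>\<^sup>+z. ennreal (P {0..} z) \<partial>lborel)"
      by (intro nn_integral_mono ennreal_leI) (simp only: sandwich)
    then show "ennreal (fact (dim F) * vol_sub F ?X / sqrt s) \<le> ennreal ((1 / b) ^ (dim F + 1))"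
      by (simp only: intH iP)
    have "(\<integral>\<^sup>+z. ennreal (P {0<..} z) \<partial>lborel) \<le> (\<integral>\<^sup>+z. ennreal (H z) \<partial>lborel)"
      by (intro nn_integral_mono ennreal_leI) (simp only: sandwich)
    then show "ennreal ((1 / b) ^ (dim F + 1)) \<le> ennreal (fact (dim F) * vol_sub F ?X / sqrt s)"
      by (simp only: intH iP)
  qed
  then have "fact (dim F) * vol_sub F ?X / sqrt s = (1 / b) ^ (dim F + 1)"
    using b(1) by (subst (asm) ennreal_inj) (auto simp: vol_sub_def s less_imp_le)
  also have "\<dots> = ((s + 1) / s) powr ((s + 1) / 2)"
  proof -
    have "1 / b = ((s + 1) / s) powr (1 / 2)" using s by (simp add: b_def powr_half_sqrt real_sqrt_divide)
    moreover have "(((s + 1) / s) powr (1 / 2)) ^ (dim F + 1) = (((s + 1) / s) powr (1 / 2)) powr real (dim F + 1)"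
      using s by (intro powr_realpow[symmetric]) simp
    moreover have "real (dim F + 1) = s + 1" by (simp add: s_def)
    ultimately have "(1 / b) ^ (dim F + 1) = (((s + 1) / s) powr (1 / 2)) powr (s + 1)" by (simp only:)
    then show ?thesis by (simp add: powr_powr)
  qed
  finally show ?thesis by (simp add: s_def)
qed

text \<open>By separation, the inclusion reduces to a norm estimate for functionals on
  \<open>F\<close>, which the frame identities can check. If \<open>y / r\<close> were outside
  \<open>X\<close>, some \<open>e\<close> in \<open>F\<close> would be below a level
  \<open>M\<close> on \<open>X\<close> although
  \<open>r * M < e \<bullet> y \<le> norm e\<close>.\<close>

lemma unit_ball_subset_scaled:
  fixes F X :: "'a::euclidean_space set"
  assumes F: "subspace F" and X: "closed X" "convex X" "X \<subseteq> F" and r: "0 < r"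
    and support: "\<And>e M. e \<in> F \<Longrightarrow> (\<And>w. w \<in> X \<Longrightarrow> e \<bullet> w < M) \<Longrightarrow> norm e \<le> r * M"
  shows "orth_proj F ` cball 0 1 \<subseteq> (\<lambda>x. r *\<^sub>R x) ` X"
proof
  fix y assume "y \<in> orth_proj F ` cball 0 1"
  then obtain x where x: "norm x \<le> 1" "y = orth_proj F x" by auto
  have y: "y \<in> F" "norm y \<le> 1"
    using x orth_proj_in[OF F] norm_orth_proj_le[OF F, of x] by auto
  have "(1 / r) *\<^sub>R y \<in> X"
  proof (rule ccontr)
    assume "(1 / r) *\<^sub>R y \<notin> X"
    then obtain a b where ab: "a \<bullet> ((1 / r) *\<^sub>R y) < b" "\<And>w. w \<in> X \<Longrightarrow> b < a \<bullet> w"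
      using separating_hyperplane_closed_point[OF X(2,1)] by blast
    \<comment> \<open>The sign places \<open>X\<close> strictly below the level \<open>- b\<close>;
      projecting the functional to \<open>F\<close> does not change its values there.\<close>
    define e where "e = - orth_proj F a"
    have eF: "e \<in> F" unfolding e_def by (intro subspace_neg orth_proj_in F)
    have e: "e \<bullet> w = - (a \<bullet> w)" if "w \<in> F" for w
      using orth_proj_self_adjoint[OF F, of a w] orth_proj_id[OF F that] by (simp add: e_def)
    have "norm e \<le> r * (- b)"
    proof (rule support[OF eF])
      fix w assume w: "w \<in> X"
      then show "e \<bullet> w < - b" using ab(2)[OF w] e[of w] X(3) by auto
    qed
    moreover have "r * (- b) < e \<bullet> y"
      using ab(1) r e[OF y(1)] by (simp add: field_simps)
    moreover have "e \<bullet> y \<le> norm e * 1"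
      using norm_cauchy_schwarz[of e y] mult_left_mono[OF y(2) norm_ge_zero[of e]] by linarith
    ultimately show False by simp
  qed
  moreover have "y = r *\<^sub>R ((1 / r) *\<^sub>R y)" using r by simp
  ultimately show "y \<in> (\<lambda>x. r *\<^sub>R x) ` X" by blast
qed

subsection \<open>Bodies in Loewner position\<close>

lemma powr_volume_ratio:
  fixes V W s d :: real
  assumes s: "0 < s" and d: "0 < d" and W: "0 < W" and le: "(s / d) powr (s / 2) * W \<le> V"
  shows "sqrt (s / d) \<le> (V / W) powr (1 / s)"
proof -
  have "(s / d) powr (s / 2) \<le> V / W" using le W by (simp add: pos_le_divide_eq)
  then have "((s / d) powr (s / 2)) powr (1 / s) \<le> (V / W) powr (1 / s)"
    using s by (intro powr_mono2) auto
  moreover have "((s / d) powr (s / 2)) powr (1 / s) = sqrt (s / d)"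
    using s d by (simp add: powr_powr powr_half_sqrt)
  ultimately show ?thesis by simp
qed

theorem mainTheorem5:
  fixes K F :: "'a::euclidean_space set"
  assumes "convex_body K"
    and "subspace F"
    and "loewner_position_axis F K"
  shows "(vol_sub F (orth_proj F ` K) / vol_sub F (reg_simplex_in F)) powr (1 / real (dim F))
           \<ge> sqrt (real (dim F) / real DIM('a))
       \<and> orth_proj F ` K \<subseteq> orth_proj F ` cball 0 1
       \<and> orth_proj F ` cball 0 1 \<subseteq> (\<lambda>x. real DIM('a) *\<^sub>R x) ` (orth_proj F ` K)
       \<and> circumradius (orth_proj (orthogonal_comp F) ` K)
           \<ge> sqrt ((real DIM('a) - real (dim F)) / real DIM('a))
       \<and> (centrally_symmetric K \<longrightarrow>
           (vol_sub F (orth_proj F ` K) / vol_sub F (cross_polytope_in F)) powr (1 / real (dim F))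
             \<ge> sqrt (real (dim F) / real DIM('a))
           \<and> orth_proj F ` K \<subseteq> orth_proj F ` cball 0 1
           \<and> orth_proj F ` cball 0 1 \<subseteq> (\<lambda>x. sqrt (real DIM('a)) *\<^sub>R x) ` (orth_proj F ` K))"
proof -
  note K = assms(1) and F = assms(2) and pos = assms(3)
  let ?P = "orth_proj F" and ?d = "real DIM('a)" and ?s = "real (dim F)"
  let ?X = "?P ` K"
  obtain U and lam :: "'a \<Rightarrow> real" where U: "finite U" "U \<subseteq> K" "\<And>u. u \<in> U \<Longrightarrow> norm u = 1"
    and lam: "\<And>u. u \<in> U \<Longrightarrow> 0 < lam u" "sum lam U = DIM('a)" "(\<Sum>u\<in>U. lam u *\<^sub>R u) = 0"
    and frame: "\<And>x. (\<Sum>u\<in>U. (lam u * (?P u \<bullet> x)) *\<^sub>R ?P u) = ?P x"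
    using loewner_position_decomposition[OF K F pos] by blast
  note linP = linear_orth_proj[OF F]
  have d0: "0 < ?d" by simp
  have Une: "U \<noteq> {}"
  proof
    assume "U = {}"
    then have "0 = ?d" using lam(2) by simp
    then show False using d0 by linarith
  qed
  have KB: "K \<subseteq> cball 0 1" using pos by (simp add: loewner_position_axis_def)
  have Xc: "compact ?X" "convex ?X"
    using K linP by (auto simp: convex_body_def linear_linear
      intro!: compact_continuous_image linear_continuous_on convex_linear_image)
  have XF: "?X \<subseteq> F" using orth_proj_in[OF F] by auto
  have PX: "?P u \<in> ?X" if "u \<in> U" for u using that U(2) by auto
  have centre: "(\<Sum>u\<in>U. lam u *\<^sub>R ?P u) = 0"
    using arg_cong[OF lam(3), of ?P] by (simp add: linear_sum[OF linP] linear_scale[OF linP] linear_0[OF linP])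
  have trace: "(\<Sum>u\<in>U. lam u * (norm (?P u))\<^sup>2) = ?s"
    by (rule frame_trace[OF F frame orth_proj_in[OF F]])
  have norms: "(\<Sum>u\<in>U. lam u * (?P u \<bullet> e)\<^sup>2) = (norm e)\<^sup>2" if "e \<in> F" for e
    using frame_norms[OF F frame, of e] orth_proj_id[OF F that] by (simp add: power2_norm_eq_inner)
  have sum0: "(\<Sum>u\<in>U. lam u * (?P u \<bullet> e)) = 0" for e
    using arg_cong[OF centre, of "\<lambda>x. x \<bullet> e"] by (simp add: inner_sum_left)
  have c1: "sqrt (?s / ?d) \<le> (vol_sub F ?X / vol_sub F (reg_simplex_in F)) powr (1 / ?s)"
  \<comment> \<open>In dimension 0 the left side is \<open>sqrt 0\<close>, and a \<open>powr\<close>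
    is never negative.\<close>
  proof (cases "dim F = 0")
    case True
    then show ?thesis by simp
  next
    case False
    then have s: "0 < ?s" and s': "0 < dim F" by linarith+
    let ?V = "vol_sub F ?X" and ?W = "vol_sub F (reg_simplex_in F)" and ?h = "(?s + 1) / 2"
    have V: "((?s + 1) / ?d) powr ?h \<le> fact (dim F) * ?V / sqrt ?d"
      using simplex_volume_bound[OF F U(1) lam(1,2) d0 orth_proj_in[OF F] frame centre XF Xc PX] by simp
    have W: "fact (dim F) * ?W / sqrt ?s = ((?s + 1) / ?s) powr ?h"
      using vol_reg_simplex[OF F s'] by simp
    have W0: "0 < ?W"
    proof -
      have "0 < fact (dim F) * ?W / sqrt ?s" unfolding W using s by simp
      then show ?thesis using s by (simp add: zero_less_mult_iff zero_less_divide_iff)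
    qed
    \<comment> \<open>Here the simplex bound for total weight \<open>?d\<close> meets its exact
      value for \<open>?s\<close>. The exponents \<open>(?s + 1) / 2\<close> combine to
      \<open>?s / 2\<close> once \<open>sqrt ?s / sqrt ?d\<close>, left by the two heights, absorbs
      the extra half power.\<close>
    have "(?s / ?d) powr (?s / 2) * (fact (dim F) * ?W) = (?s / ?d) powr (?s / 2) * (sqrt ?s * ((?s + 1) / ?s) powr ?h)"
      using W s by (simp add: field_simps)
    also have "\<dots> = sqrt ?d * ((?s + 1) / ?d) powr ?h"
    proof -
      have "(?s + 1) / ?d = (?s / ?d) * ((?s + 1) / ?s)" using s by (simp add: field_simps)
      then have "((?s + 1) / ?d) powr ?h = (?s / ?d) powr ?h * ((?s + 1) / ?s) powr ?h"
        using s by (simp only: powr_mult)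
      also have "(?s / ?d) powr ?h = (?s / ?d) powr (?s / 2) * (?s / ?d) powr (1 / 2)"
        by (simp add: powr_add[symmetric] add_divide_distrib)
      also have "(?s / ?d) powr (1 / 2) = sqrt ?s / sqrt ?d"
        using s by (simp add: powr_half_sqrt real_sqrt_divide)
      finally show ?thesis by simp
    qed
    also have "\<dots> \<le> fact (dim F) * ?V"
    proof -
      have "sqrt ?d * ((?s + 1) / ?d) powr ?h \<le> sqrt ?d * (fact (dim F) * ?V / sqrt ?d)"
        by (intro mult_left_mono V) simp
      then show ?thesis by simp
    qed
    finally have "fact (dim F) * ((?s / ?d) powr (?s / 2) * ?W) \<le> fact (dim F) * ?V" by (simp add: mult_ac)
    then have "(?s / ?d) powr (?s / 2) * ?W \<le> ?V" by (rule mult_left_le_imp_le) simp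
    then show ?thesis by (intro powr_volume_ratio s d0 W0)
  qed
  moreover have c2a: "?X \<subseteq> ?P ` cball 0 1" using KB by auto
  moreover have c2b: "?P ` cball 0 1 \<subseteq> (\<lambda>x. ?d *\<^sub>R x) ` ?X"
  proof (rule unit_ball_subset_scaled[OF F compact_imp_closed[OF Xc(1)] Xc(2) XF d0])
    fix e M assume e: "e \<in> F" and M: "\<And>w. w \<in> ?X \<Longrightarrow> e \<bullet> w < M"
    \<comment> \<open>Product of two nonnegative factors, one from the unit ball and one from the
      level \<open>M\<close>. In the weighted sum the linear terms vanish by \<open>sum0\<close>,
      and the quadratic term is the norm of \<open>e\<close> squared.\<close>
    have "0 \<le> (\<Sum>u\<in>U. lam u * ((?P u \<bullet> e + norm e) * (M - ?P u \<bullet> e)))"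
    proof (intro sum_nonneg mult_nonneg_nonneg)
      fix u assume u: "u \<in> U"
      show "0 \<le> lam u" using lam(1)[OF u] by simp
      show "0 \<le> M - ?P u \<bullet> e" using M[OF PX[OF u]] by (simp add: inner_commute)
      have "norm (?P u) * norm e \<le> 1 * norm e"
        using norm_orth_proj_le[OF F, of u] U(3)[OF u] by (intro mult_right_mono) auto
      then show "0 \<le> ?P u \<bullet> e + norm e" using Cauchy_Schwarz_ineq2[of "?P u" e] by linarith
    qed
    also have "\<dots> = (\<Sum>u\<in>U. lam u * (norm e * M) + (M - norm e) * (lam u * (?P u \<bullet> e)) - lam u * (?P u \<bullet> e)\<^sup>2)"
      by (intro sum.cong refl) (simp add: power2_eq_square algebra_simps)
    also have "\<dots> = ?d * (norm e * M) - (norm e)\<^sup>2"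
      unfolding sum.distrib sum_subtractf sum_distrib_left[symmetric] sum_distrib_right[symmetric] sum0 norms[OF e] lam(2) by simp
    finally have ineq: "norm e * norm e \<le> norm e * (?d * M)" by (simp add: power2_eq_square mult_ac)
    show "norm e \<le> ?d * M"
    proof (cases "e = 0")
      case True
      obtain u where "u \<in> U" using Une by blast
      then have "0 < M" using M[OF PX] True by auto
      then show ?thesis using True by simp
    next
      case False
      then show ?thesis using mult_left_le_imp_le[OF ineq] by simp
    qed
  qed
  moreover have c3: "sqrt ((?d - ?s) / ?d) \<le> circumradius (orth_proj (orthogonal_comp F) ` K)"
    unfolding circumradius_def
  proof (rule cInf_greatest)
    have "orth_proj (orthogonal_comp F) ` K \<subseteq> cball 0 1"
    proof
      fix y assume "y \<in> orth_proj (orthogonal_comp F) ` K"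
      then obtain x where "x \<in> K" "y = orth_proj (orthogonal_comp F) x" by blast
      then show "y \<in> cball 0 1"
        using norm_orth_proj_le[OF subspace_orthogonal_comp, of F x] KB by fastforce
    qed
    then show "{r. \<exists>c. orth_proj (orthogonal_comp F) ` K \<subseteq> cball c r} \<noteq> {}" by blast
    fix r assume "r \<in> {r. \<exists>c. orth_proj (orthogonal_comp F) ` K \<subseteq> cball c r}"
    then obtain c where c: "orth_proj (orthogonal_comp F) ` K \<subseteq> cball c r" by blast
    let ?q = "\<lambda>u. u - ?P u"
    have q: "norm (c - ?q u) \<le> r" if "u \<in> U" for u
      using c U(2) that by (force simp: orth_proj_orthogonal_comp[OF F] dist_norm)
    have r0: "0 \<le> r" using q Une norm_ge_zero order_trans by blast
    have q2: "(norm (?q u))\<^sup>2 = 1 - (norm (?P u))\<^sup>2" if "u \<in> U" for u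
    proof -
      have "u \<bullet> u = 1" using U(3)[OF that] by (simp add: norm_eq_1)
      moreover have "u \<bullet> ?P u = ?P u \<bullet> ?P u" using orth_proj_inner[OF F, of u u] by (simp add: inner_commute[of u])
      ultimately show ?thesis
        unfolding power2_norm_eq_inner by (simp add: inner_diff_left inner_diff_right inner_commute[of "?P u" u])
    qed
    have sumq: "(\<Sum>u\<in>U. lam u * (c \<bullet> ?q u)) = 0"
    proof -
      have "(\<Sum>u\<in>U. lam u *\<^sub>R ?q u) = 0" by (simp add: scaleR_diff_right sum_subtractf lam(3) centre)
      from arg_cong[OF this, of "\<lambda>x. c \<bullet> x"] show ?thesis by (simp add: inner_sum_right)
    qed
    \<comment> \<open>Mean squared distance of the projected contact points from an arbitrary centre
      \<open>c\<close>. The cross term vanishes, so the mean is at least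
      \<open>(?d - ?s) / ?d\<close>, and it cannot exceed the squared radius.\<close>
    have "(\<Sum>u\<in>U. lam u * (norm (c - ?q u))\<^sup>2) =
        (\<Sum>u\<in>U. lam u * (norm c)\<^sup>2 - 2 * (lam u * (c \<bullet> ?q u)) + (lam u - lam u * (norm (?P u))\<^sup>2))"
    proof (intro sum.cong refl)
      fix u assume u: "u \<in> U"
      have "(norm (c - ?q u))\<^sup>2 = (norm c)\<^sup>2 - 2 * (c \<bullet> ?q u) + (norm (?q u))\<^sup>2"
        unfolding power2_norm_eq_inner inner_diff_left[of c "?q u"] inner_diff_right[of _ c "?q u"]
        by (simp add: inner_commute[of "?q u" c])
      then have eq: "(norm (c - ?q u))\<^sup>2 = (norm c)\<^sup>2 - 2 * (c \<bullet> ?q u) + (1 - (norm (?P u))\<^sup>2)"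
        unfolding q2[OF u] .
      show "lam u * (norm (c - ?q u))\<^sup>2 = lam u * (norm c)\<^sup>2 - 2 * (lam u * (c \<bullet> ?q u)) + (lam u - lam u * (norm (?P u))\<^sup>2)"
        unfolding eq by (simp only: right_diff_distrib distrib_left mult_1_right mult.left_commute)
    qed
    also have "\<dots> = ?d * (norm c)\<^sup>2 + (?d - ?s)"
      unfolding sum.distrib sum_subtractf sum_distrib_left[symmetric] sum_distrib_right[symmetric] sumq trace lam(2) by simp
    finally have "?d - ?s \<le> (\<Sum>u\<in>U. lam u * (norm (c - ?q u))\<^sup>2)" by simp
    also have "\<dots> \<le> (\<Sum>u\<in>U. lam u * r\<^sup>2)"
      using lam(1) q by (intro sum_mono mult_left_mono power_mono) (auto simp: less_imp_le)
    also have "\<dots> = ?d * r\<^sup>2" by (simp add: sum_distrib_right[symmetric] lam(2))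
    finally have "(?d - ?s) / ?d \<le> r\<^sup>2" by (simp add: pos_divide_le_eq mult.commute)
    then show "sqrt ((?d - ?s) / ?d) \<le> r" using r0 by (intro real_le_lsqrt) auto
  qed
  moreover have "sqrt (?s / ?d) \<le> (vol_sub F ?X / vol_sub F (cross_polytope_in F)) powr (1 / ?s)
      \<and> ?P ` cball 0 1 \<subseteq> (\<lambda>x. sqrt ?d *\<^sub>R x) ` ?X" if sym: "centrally_symmetric K"
  proof
    obtain c where c: "\<And>x. x \<in> K \<longleftrightarrow> 2 *\<^sub>R c - x \<in> K" using sym by (auto simp: centrally_symmetric_def)
    \<comment> \<open>The centre of symmetry turns out to be 0: reflected contact points stay in the
      ball, which gives this inequality, and averaging it against \<open>sum lam(u) u = 0\<close>
      yields \<open>c \<bullet> c \<le> 0\<close>.\<close>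
    have cu: "c \<bullet> c \<le> c \<bullet> u" if "u \<in> U" for u
    proof -
      have "norm (2 *\<^sub>R c - u) \<le> 1" using c[of u] that U(2) KB by auto
      then have "(2 *\<^sub>R c - u) \<bullet> (2 *\<^sub>R c - u) \<le> 1" by (simp add: norm_le_square)
      moreover have "u \<bullet> u = 1" using U(3)[OF that] by (simp add: norm_eq_1)
      ultimately show ?thesis by (simp add: inner_diff_left inner_diff_right inner_commute)
    qed
    have "?d * (c \<bullet> c) = (\<Sum>u\<in>U. lam u * (c \<bullet> c))" by (simp add: sum_distrib_right[symmetric] lam(2))
    also have "\<dots> \<le> (\<Sum>u\<in>U. lam u * (c \<bullet> u))" using lam(1) cu by (intro sum_mono mult_left_mono) (auto simp: less_imp_le)
    also have "\<dots> = c \<bullet> (\<Sum>u\<in>U. lam u *\<^sub>R u)" by (simp add: inner_sum_right)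
    also have "\<dots> = 0" by (simp add: lam(3))
    finally have "c \<bullet> c \<le> 0" by (simp add: mult_le_0_iff)
    then have "c = 0" by (metis inner_eq_zero_iff inner_ge_zero order_antisym)
    then have neg: "- x \<in> K" if "x \<in> K" for x using c[of x] that by simp
    have PXn: "- ?P u \<in> ?X" if "u \<in> U" for u
    proof -
      have "?P (- u) \<in> ?X" using neg[of u] that U(2) by blast
      then show ?thesis by (simp add: linear_neg[OF linP])
    qed
    show "sqrt (?s / ?d) \<le> (vol_sub F ?X / vol_sub F (cross_polytope_in F)) powr (1 / ?s)"
    proof (cases "dim F = 0")
      case True
      then show ?thesis by simp
    next
      case False
      then have s: "0 < ?s" and s': "0 < dim F" by linarith+
      let ?V = "vol_sub F ?X" and ?W = "vol_sub F (cross_polytope_in F)"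
      have V: "2 powr ?s * (?s / ?d) powr (?s / 2) \<le> fact (dim F) * ?V"
        using cross_polytope_volume_bound[OF F s' U(1) lam(1,2) orth_proj_in[OF F] frame XF Xc PX PXn] by simp
      have W: "fact (dim F) * ?W = 2 powr ?s"
        using vol_cross_polytope[OF F s'] by (simp add: powr_realpow)
      have W0: "0 < ?W"
      proof -
        have "0 < fact (dim F) * ?W" unfolding W by simp
        then show ?thesis by (simp add: zero_less_mult_iff)
      qed
      have "fact (dim F) * ((?s / ?d) powr (?s / 2) * ?W) \<le> fact (dim F) * ?V"
        using V unfolding W[symmetric] by (simp add: mult_ac)
      then have "(?s / ?d) powr (?s / 2) * ?W \<le> ?V" by (rule mult_left_le_imp_le) simp
      then show ?thesis by (intro powr_volume_ratio s d0 W0)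
    qed
    show "?P ` cball 0 1 \<subseteq> (\<lambda>x. sqrt ?d *\<^sub>R x) ` ?X"
    proof (rule unit_ball_subset_scaled[OF F compact_imp_closed[OF Xc(1)] Xc(2) XF])
      show "0 < sqrt ?d" by simp
      fix e M assume e: "e \<in> F" and M: "\<And>w. w \<in> ?X \<Longrightarrow> e \<bullet> w < M"
      \<comment> \<open>Symmetry bounds the products from both sides, so the squares can be
        estimated directly; this improves the factor from the dimension to its square root.\<close>
      have ab: "\<bar>?P u \<bullet> e\<bar> \<le> M" if "u \<in> U" for u
        using M[OF PX[OF that]] M[OF PXn[OF that]] by (simp add: inner_commute abs_le_iff)
      obtain u where "u \<in> U" using Une by blast
      then have M0: "0 \<le> M" using ab[of u] by linarith
      have "(norm e)\<^sup>2 = (\<Sum>u\<in>U. lam u * (?P u \<bullet> e)\<^sup>2)" by (simp add: norms[OF e])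
      also have "\<dots> \<le> (\<Sum>u\<in>U. lam u * M\<^sup>2)"
        using lam(1) ab M0 by (intro sum_mono mult_left_mono) (auto simp: less_imp_le abs_le_square_iff[symmetric])
      also have "\<dots> = (sqrt ?d * M)\<^sup>2" by (simp add: sum_distrib_right[symmetric] lam(2) power_mult_distrib)
      finally show "norm e \<le> sqrt ?d * M" by (rule power2_le_imp_le) (simp add: M0)
    qed
  qed
  ultimately show ?thesis by blast
qed

end
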